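(* Let $K:\mathbb{R}^d\times\mathbb{R}^d\to\mathbb{C}$ be a continuous, Hermitian and positive-definite kernel, and let $\omega$ be a stationary and ergodic determinantal point process on $\mathbb{R}^d$ with kernel $K$ and with mean density $1$. Put $g(x):=|K(0,x)|^2$ for $x\in\mathbb{R}^d$. Then, almost surely, the autocorrelation measure $\gamma$ and the diffraction measure $\widehat\gamma$ of $\omega$ exist and are given by \[ \gamma=\delta_0+(1-g)\,\lambda^d\qquad\text{and}\qquad\widehat\gamma=\delta_0+(1-\widehat g\,)\,\lambda^d . \] Moreover, $0\le\widehat g(t)\le 1$ for all $t\in\mathbb{R}^d$, with $\widehat g(t)=1$ at most for $t=0$. In particular, the absolutely continuous part of the diffraction measure is equivalent to Lebesgue measure.
   Context: Kernels: $K$ is Hermitian if $K(x,y)=\overline{K(y,x)}$ for all $x,y$, and positive-definite if $\det\bigl(K(x_i,x_j)\bigr)_{1\le i,j\le k}\ge 0$ for all $k\in\mathbb{N}$ and $x_1,\dots,x_k\in\mathbb{R}^d$. Point processes: a point process on $\mathbb{R}^d$ is a random variable $\omega$ with values in the space of locally finite $\mathbb{N}_0\cup\{\infty\}$-valued Borel measures on $\mathbb{R}^d$ (with the $\sigma$-field generated by the maps $\omega\mapsto\omega(A)$, $A$ Borel). Writing $\omega=\sum_{i\in I}\delta_{x_i}$, put $\omega^{\bullet k}:=\sum_{i_1,\dots,i_k\in I\ \text{distinct}}\delta_{(x_{i_1},\dots,x_{i_k})}$. If $\mathbb{E}(\omega(A)^k)<\infty$ for all bounded Borel $A$, the $k$th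 factorial moment measure is the expectation measure $\mathbb{E}(\omega^{\bullet k}(\cdot))$ on $(\mathbb{R}^d)^k$; if it is absolutely continuous, its density $\varrho_k$ is the $k$-point correlation function. $\omega$ is determinantal with kernel $K$ if, for every $k\in\mathbb{N}$, $\varrho_k$ exists and $\varrho_k(x_1,\dots,x_k)=\det\bigl(K(x_i,x_j)\bigr)_{1\le i,j\le k}$. $\omega$ is stationary if $\omega$ and its translate $T_x\omega$ have the same distribution for all $x\in\mathbb{R}^d$, where $(T_x\omega)(A)=\omega(-x+A)$; it is ergodic if it is stationary and $\mathbb{P}(\omega\in B)\in\{0,1\}$ for every measurable set $B$ of locally finite measures with $T_x^{-1}(B)=B$ for all $x$. The mean density of a stationary $\omega$ is the constant $\varrho$ with $\mathbb{E}(\omega(A))=\varrho\,\lambda^d(A)$. $\lambda^d$ is Lebesgue measure on $\mathbb{R}^d$, and $F\,\lambda^d$ is the (signed) measure with density $F$. Fourier transform of functions: $\widehat f(y)=\int_{\mathbb{R}^d}f(x)e^{-2\pi i xy}\,dx$. Under the hypotheses, $g$ is integrable, so $\widehat g$ is a well-defined continuous function. For a locally finite measure $\omega$, with $\widetilde\omega(A):=\omega(-A)$ and $B_n$ the open ball of radius $n$ around $0$, the autocorrelation measure is the vague limit $\gamma:=\lim_{n\to\infty}\frac{\omega|_{B_n}\ast\widetilde{\omega|_{B_n}}}{\lambda^d(B_n)}$, if it exists. The diffraction measure is the Fourier transform $\widehat\gamma$ of $\gamma$, i.e. the unique translation-bounded measure with $\int f\,d\widehat\gamma=\int\widehat f\,d\gamma$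 for all Schwartz functions $f$ (translation-bounded: $\sup_x\mu(x+B)<\infty$ for every bounded Borel $B$). For a point process these notions are applied to its realisations. Two measures are equivalent if they have the same null sets. *)

theory Defs
  imports
    "HOL-Probability.Probability"
    "Jordan_Normal_Form.Determinant"
begin

subsection \<open>Kernels\<close>

definition kernel_det :: "('a \<Rightarrow> 'a \<Rightarrow> complex) \<Rightarrow> nat \<Rightarrow> (nat \<Rightarrow> 'a) \<Rightarrow> complex" where
  "kernel_det K k x = Determinant.det (Matrix.mat k k (\<lambda>(i, j). K (x i) (x j)))"

definition hermitian_kernel :: "('a \<Rightarrow> 'a \<Rightarrow> complex) \<Rightarrow> bool" where
  "hermitian_kernel K \<longleftrightarrow> (\<forall>x y. K x y = cnj (K y x))"

definition positive_definite_kernel :: "('a \<Rightarrow> 'a \<Rightarrow> complex) \<Rightarrow> bool" where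
  "positive_definite_kernel K \<longleftrightarrow> (\<forall>k x. k \<ge> 1 \<longrightarrow> kernel_det K k x \<in> \<real>\<^sub>\<ge>\<^sub>0)"


subsection \<open>Point processes\<close>

definition locally_finite :: "'a::euclidean_space measure \<Rightarrow> bool" where
  "locally_finite M \<longleftrightarrow> sets M = sets borel \<and>
     (\<forall>A\<in>sets borel. bounded A \<longrightarrow> emeasure M A < \<infinity>)"

definition counting_measures :: "'a::euclidean_space measure set" where
  "counting_measures =
     {M. locally_finite M \<and> (\<forall>A\<in>sets borel. emeasure M A \<in> insert \<infinity> (range of_nat))}"

definition counting_space :: "'a::euclidean_space measure measure" where
  "counting_space = sigma counting_measures
     {{M \<in> counting_measures. emeasure M A \<in> B} | A B. A \<in> sets borel \<and> B \<in> sets borel}"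

definition point_process :: "'w measure \<Rightarrow> ('w \<Rightarrow> 'a::euclidean_space measure) \<Rightarrow> bool" where
  "point_process P \<omega> \<longleftrightarrow> prob_space P \<and> \<omega> \<in> measurable P counting_space"

definition translate :: "'a::euclidean_space \<Rightarrow> 'a measure \<Rightarrow> 'a measure" where
  "translate x M = distr M borel (\<lambda>y. x + y)"

definition stationary :: "'w measure \<Rightarrow> ('w \<Rightarrow> 'a::euclidean_space measure) \<Rightarrow> bool" where
  "stationary P \<omega> \<longleftrightarrow>
     (\<forall>x. distr P counting_space (\<lambda>w. translate x (\<omega> w)) = distr P counting_space \<omega>)"

definition ergodic :: "'w measure \<Rightarrow> ('w \<Rightarrow> 'a::euclidean_space measure) \<Rightarrow> bool" where
  "ergodic P \<omega> \<longleftrightarrow> stationary P \<omega> \<and>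
     (\<forall>B\<in>sets counting_space.
        (\<forall>x. translate x -` B \<inter> space counting_space = B) \<longrightarrow>
        measure P {w \<in> space P. \<omega> w \<in> B} \<in> {0, 1})"

definition has_mean_density ::
    "'w measure \<Rightarrow> ('w \<Rightarrow> 'a::euclidean_space measure) \<Rightarrow> real \<Rightarrow> bool" where
  "has_mean_density P \<omega> \<rho> \<longleftrightarrow> 0 \<le> \<rho> \<and>
     (\<forall>A\<in>sets borel. (\<integral>\<^sup>+w. emeasure (\<omega> w) A \<partial>P) = ennreal \<rho> * emeasure lborel A)"

text \<open>
  The space of \<open>k\<close>-tuples of points is the product over the index set \<open>{..<k}\<close>. A locally finite
  counting measure is a sum of countably many Dirac measures, that is, the image of the counting
  measure on some \<open>I \<subseteq> \<nat>\<close> under some \<open>x\<close>. The family of points is unique up to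
  relabelling and repeats multiple points, so the choice made below does not matter.
\<close>

definition factorial_power :: "nat \<Rightarrow> 'a::euclidean_space measure \<Rightarrow> (nat \<Rightarrow> 'a) measure" where
  "factorial_power k M =
     (let (I, x) = (SOME (I :: nat set, x :: nat \<Rightarrow> 'a). M = distr (count_space I) borel x) in
      distr (count_space {j \<in> {..<k} \<rightarrow>\<^sub>E I. inj_on j {..<k}}) (\<Pi>\<^sub>M i\<in>{..<k}. borel)
        (\<lambda>j. \<lambda>i\<in>{..<k}. x (j i)))"

definition factorial_moment_measure ::
    "'w measure \<Rightarrow> ('w \<Rightarrow> 'a::euclidean_space measure) \<Rightarrow> nat \<Rightarrow> (nat \<Rightarrow> 'a) measure" where
  "factorial_moment_measure P \<omega> k =
     measure_of (space (\<Pi>\<^sub>M i\<in>{..<k}. borel)) (sets (\<Pi>\<^sub>M i\<in>{..<k}. borel))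
       (\<lambda>A. \<integral>\<^sup>+w. emeasure (factorial_power k (\<omega> w)) A \<partial>P)"

definition correlation_function ::
    "'w measure \<Rightarrow> ('w \<Rightarrow> 'a::euclidean_space measure) \<Rightarrow> nat \<Rightarrow> ((nat \<Rightarrow> 'a) \<Rightarrow> real) \<Rightarrow> bool" where
  "correlation_function P \<omega> k \<rho> \<longleftrightarrow>
     (\<forall>A\<in>sets borel. bounded A \<longrightarrow> (\<integral>\<^sup>+w. emeasure (\<omega> w) A ^ k \<partial>P) < \<infinity>) \<and>
     \<rho> \<in> borel_measurable (\<Pi>\<^sub>M i\<in>{..<k}. lborel) \<and> (\<forall>x. 0 \<le> \<rho> x) \<and>
     factorial_moment_measure P \<omega> k = density (\<Pi>\<^sub>M i\<in>{..<k}. lborel) (\<lambda>x. ennreal (\<rho> x))"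

text \<open>Densities are determined almost everywhere only, hence the \<open>AE\<close>.\<close>

definition determinantal ::
    "'w measure \<Rightarrow> ('w \<Rightarrow> 'a::euclidean_space measure) \<Rightarrow> ('a \<Rightarrow> 'a \<Rightarrow> complex) \<Rightarrow> bool" where
  "determinantal P \<omega> K \<longleftrightarrow>
     (\<forall>k\<ge>1. \<exists>\<rho>. correlation_function P \<omega> k \<rho> \<and>
        (AE x in (\<Pi>\<^sub>M i\<in>{..<k}. lborel). complex_of_real (\<rho> x) = kernel_det K k x))"


subsection \<open>Autocorrelation and diffraction\<close>

definition add_measure :: "'a measure \<Rightarrow> 'a measure \<Rightarrow> 'a measure" where
  "add_measure M N = measure_of (space M) (sets M) (\<lambda>A. emeasure M A + emeasure N A)"

definition vague_limit ::
    "(nat \<Rightarrow> 'a::euclidean_space measure) \<Rightarrow> 'a measure \<Rightarrow> bool" where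
  "vague_limit \<mu> \<gamma> \<longleftrightarrow> locally_finite \<gamma> \<and>
     (\<forall>f :: 'a \<Rightarrow> real. continuous_on UNIV f \<longrightarrow> compact (closure {x. f x \<noteq> 0}) \<longrightarrow>
        (\<lambda>n. integral\<^sup>L (\<mu> n) f) \<longlonglongrightarrow> integral\<^sup>L \<gamma> f)"

definition restricted :: "'a::euclidean_space measure \<Rightarrow> nat \<Rightarrow> 'a measure" where
  "restricted M n = density M (indicator (ball 0 (real n)))"

definition reflect :: "'a::euclidean_space measure \<Rightarrow> 'a measure" where
  "reflect M = distr M borel uminus"

definition is_autocorrelation ::
    "'a::ordered_euclidean_space measure \<Rightarrow> 'a measure \<Rightarrow> bool" where
  "is_autocorrelation M \<gamma> \<longleftrightarrow>
     vague_limit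
       (\<lambda>n. scale_measure (1 / emeasure lborel (ball (0::'a) (real n)))
              (convolution (restricted M n) (reflect (restricted M n)))) \<gamma>"

definition fourier :: "('a::euclidean_space \<Rightarrow> complex) \<Rightarrow> 'a \<Rightarrow> complex" where
  "fourier f y = (LINT x|lborel. f x * exp (- 2 * complex_of_real pi * \<i> * complex_of_real (x \<bullet> y)))"

definition partial_derivative ::
    "'a::euclidean_space \<Rightarrow> ('a \<Rightarrow> complex) \<Rightarrow> 'a \<Rightarrow> complex" where
  "partial_derivative b f x = frechet_derivative f (at x) b"

text \<open>
  A list of basis vectors plays the role of a multi-index; differentiability of all iterated
  partial derivatives makes \<open>f\<close> smooth.
\<close>

definition schwartz :: "('a::euclidean_space \<Rightarrow> complex) \<Rightarrow> bool" where
  "schwartz f \<longleftrightarrow>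
     (\<forall>bs. set bs \<subseteq> Basis \<longrightarrow>
        (\<forall>x. foldr partial_derivative bs f differentiable (at x)) \<and>
        (\<forall>m::nat. \<exists>C. \<forall>x. norm x ^ m * norm (foldr partial_derivative bs f x) \<le> C))"

definition translation_bounded :: "'a::euclidean_space measure \<Rightarrow> bool" where
  "translation_bounded M \<longleftrightarrow> sets M = sets borel \<and>
     (\<forall>B\<in>sets borel. bounded B \<longrightarrow> (SUP x. emeasure M ((+) x ` B)) < \<infinity>)"

definition is_fourier_transform ::
    "'a::euclidean_space measure \<Rightarrow> 'a measure \<Rightarrow> bool" where
  "is_fourier_transform \<gamma> \<mu> \<longleftrightarrow> translation_bounded \<mu> \<and>
     (\<forall>f. schwartz f \<longrightarrow> integrable \<gamma> (fourier f) \<and> integral\<^sup>L \<mu> f = integral\<^sup>L \<gamma> (fourier f))"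

definition is_diffraction ::
    "'a::ordered_euclidean_space measure \<Rightarrow> 'a measure \<Rightarrow> bool" where
  "is_diffraction M \<mu> \<longleftrightarrow> (\<exists>\<gamma>. is_autocorrelation M \<gamma> \<and> is_fourier_transform \<gamma> \<mu>)"


subsection \<open>Lebesgue decomposition\<close>

definition lebesgue_decomposition ::
    "'a::euclidean_space measure \<Rightarrow> 'a measure \<Rightarrow> 'a measure \<Rightarrow> bool" where
  "lebesgue_decomposition \<mu> \<nu> \<sigma> \<longleftrightarrow>
     sets \<nu> = sets borel \<and> sets \<sigma> = sets borel \<and> \<mu> = add_measure \<nu> \<sigma> \<and>
     absolutely_continuous lborel \<nu> \<and> (\<exists>N\<in>null_sets lborel. emeasure \<sigma> (- N) = 0)"

definition ac_part :: "'a::euclidean_space measure \<Rightarrow> 'a measure" where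
  "ac_part \<mu> = (THE \<nu>. \<exists>\<sigma>. lebesgue_decomposition \<mu> \<nu> \<sigma>)"

definition equivalent_measures :: "'a measure \<Rightarrow> 'a measure \<Rightarrow> bool" where
  "equivalent_measures M N \<longleftrightarrow> null_sets M = null_sets N"

end

theory Submission
  imports Defs
begin

text \<open>
  Stationarity and continuity give \<open>K x x = 1\<close> and \<open>\<bar>K x y\<bar>\<^sup>2 = g (y - x)\<close>. Since the variance of the
  number of points in a large ball is nonnegative, \<open>g\<close> has integral at most one. By Schur's product
  theorem \<open>\<bar>K x y\<bar>\<^sup>2\<close> is a positive definite kernel, so averaging it against a character over large
  balls shows that the Fourier transform of \<open>g\<close> is nonnegative.

  Fischer's determinant inequality bounds the fourth
  correlation function by a product of second ones; hence the number of pairs of points of \<open>B\<^sub>n\<close> with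
  difference in a given bounded set has variance of the order of the volume of \<open>B\<^sub>n\<close>. The normalised
  variances are summable along squares, which together with monotonicity in \<open>n\<close> yields almost sure
  convergence simultaneously for all dyadic cubes, and this implies vague convergence. The diffraction
  measure is then obtained from Fourier inversion at the origin.
\<close>

section \<open>Positive definite kernels\<close>

text \<open>Stationarity is exploited through the expectations of
  \<open>\<omega>(A) * \<omega>(B)\<close>, and these only see \<open>\<bar>K x y\<bar>^2\<close>:
  the phase of \<open>K\<close> may still depend on both points.

  Why Fischer is needed: the square of a pair count expands into sums over four, three and two
  distinct points. The trivial bound 1 for the fourth correlation function would leave an error of
  the order of the squared volume. Bounding it by the product of two second ones makes the
  four-point term at most the square of the mean, so that only sums over three and two points remain
  in the variance, and for these the trivial bound suffices. The normalised variance is then of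
  order n^(-d), which is not summable over all n when d = 1; hence the squares.

  In the diffraction, the unit mass and Lebesgue measure exchange their roles under the transform.
  That the density \<open>1 - ghat\<close> vanishes at most at 0 rests on the continuity of
  \<open>g\<close> together with \<open>g 0 = 1\<close>.

  Moments live in \<open>ennreal\<close>, so variance inequalities are written as sums rather than
  differences.\<close>

definition schur_kernel :: "('a \<Rightarrow> 'a \<Rightarrow> complex) \<Rightarrow> 'a \<Rightarrow> 'a \<Rightarrow> 'a \<Rightarrow> complex" where
  "schur_kernel K p x y = K x y - K x p * K p y / K p p"

lemma kernel_det_cong:
  assumes "\<And>i. i < k \<Longrightarrow> x i = y i"
  shows "kernel_det K k x = kernel_det K k y"
  unfolding kernel_det_def
  by (intro arg_cong[where f = Determinant.det] cong_mat) (auto simp: assms)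

text \<open>Schur's determinant formula. Right multiplication by the unipotent matrix
  \<open>?U\<close> adds multiples of the last column to the others so that the last row vanishes
  apart from the pivot; the upper left block then is the Schur complement of the pivot.\<close>

lemma kernel_det_Suc:
  assumes nz: "K (x k) (x k) \<noteq> 0"
  shows "kernel_det K (Suc k) x = K (x k) (x k) * kernel_det (schur_kernel K (x k)) k x"
proof -
  let ?p = "x k"
  let ?M = "Matrix.mat (Suc k) (Suc k) (\<lambda>(i, j). K (x i) (x j))"
  let ?U = "four_block_mat (1\<^sub>m k) (0\<^sub>m k 1) (Matrix.mat 1 k (\<lambda>(i, j). - K ?p (x j) / K ?p ?p)) (1\<^sub>m 1)"
  let ?D = "Matrix.mat k k (\<lambda>(i, j). schur_kernel K ?p (x i) (x j))"
  let ?b = "Matrix.mat k 1 (\<lambda>(i, j). K (x i) ?p)"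
  let ?a = "Matrix.mat 1 1 (\<lambda>(i, j). K ?p ?p)"
  have M: "?M = four_block_mat (Matrix.mat k k (\<lambda>(i, j). K (x i) (x j))) ?b
      (Matrix.mat 1 k (\<lambda>(i, j). K ?p (x j))) ?a"
    by (rule eq_matI) (auto simp: less_Suc_eq)
  have MU: "?M * ?U = four_block_mat ?D ?b (0\<^sub>m 1 k) ?a"
    unfolding M
    by (subst mult_four_block_mat[where ?nr1.0=k and ?n1.0=k and ?n2.0=1 and ?nr2.0=1 and ?nc1.0=k and ?nc2.0=1])
       (auto intro!: cong_four_block_mat eq_matI
         simp: scalar_prod_def schur_kernel_def nz)
  have dU: "Determinant.det ?U = 1"
    by (subst det_four_block_mat_upper_right_zero[where n=k and m=1]) auto
  have "Determinant.det (?M * ?U) = Determinant.det ?M * Determinant.det ?U"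
    by (rule det_mult[where n = "Suc k"]) auto
  moreover have "Determinant.det (?M * ?U) = Determinant.det ?D * Determinant.det ?a"
    unfolding MU by (rule det_four_block_mat_lower_left_zero[where n=k and m=1]) auto
  moreover have "Determinant.det ?a = K ?p ?p" by (subst det_single) auto
  ultimately show ?thesis using dU by (simp add: kernel_det_def)
qed

lemma kernel_det_1: "kernel_det K 1 x = K (x 0) (x 0)"
  unfolding kernel_det_def by (subst det_single) auto

lemma kernel_det_2:
  "kernel_det K 2 x = K (x 0) (x 0) * K (x 1) (x 1) - K (x 0) (x 1) * K (x 1) (x 0)"
proof -
  define A where "A = Matrix.mat 2 2 (\<lambda>(i, j). K (x i) (x j))"
  have s2: "(\<Sum>i<2. f i) = f 0 + f 1" for f :: "nat \<Rightarrow> complex"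
    by (simp add: numeral_2_eq_2)
  have A: "A \<in> carrier_mat 2 2" by (simp add: A_def)
  have "Determinant.det A = A $$ (0,0) * cofactor A 0 0 + A $$ (1,0) * cofactor A 1 0"
    by (subst laplace_expansion_column[OF A, of 0]) (simp_all add: s2)
  moreover have "cofactor A 0 0 = K (x 1) (x 1)" "cofactor A 1 0 = - K (x 0) (x 1)"
    unfolding cofactor_def by (subst det_single; auto simp: mat_delete_def A_def)+
  ultimately show ?thesis by (simp add: kernel_det_def A_def mult.commute)
qed

locale pd_kernel =
  fixes K :: "'a \<Rightarrow> 'a \<Rightarrow> complex"
  assumes herm: "hermitian_kernel K" and pd: "positive_definite_kernel K"
begin

lemma sym: "K y x = cnj (K x y)"
  using herm unfolding hermitian_kernel_def by blast

lemma mult_sym: "K x y * K y x = complex_of_real ((cmod (K x y))\<^sup>2)"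
  unfolding sym[of y x] by (rule complex_norm_square[symmetric])

lemma diag: "K x x = complex_of_real (Re (K x x))" "0 \<le> Re (K x x)"
proof -
  have "kernel_det K 1 (\<lambda>_. x) \<in> \<real>\<^sub>\<ge>\<^sub>0" using pd by (auto simp: positive_definite_kernel_def)
  then have "K x x \<in> \<real>\<^sub>\<ge>\<^sub>0" unfolding kernel_det_1 .
  then show "K x x = complex_of_real (Re (K x x))" "0 \<le> Re (K x x)"
    by (auto simp: complex_nonneg_Reals_iff complex_eq_iff)
qed

lemma kernel_det_real: "kernel_det K k x = complex_of_real (Re (kernel_det K k x))"
  and kernel_det_nonneg: "0 \<le> Re (kernel_det K k x)"
proof -
  have "kernel_det K k x \<in> \<real>\<^sub>\<ge>\<^sub>0"
  proof (cases "k = 0")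
    case True then show ?thesis by (simp add: kernel_det_def)
  next
    case False then show ?thesis using pd by (auto simp: positive_definite_kernel_def)
  qed
  then show "kernel_det K k x = complex_of_real (Re (kernel_det K k x))" "0 \<le> Re (kernel_det K k x)"
    by (auto simp: complex_nonneg_Reals_iff complex_eq_iff)
qed

lemma Re_kernel_det_2:
  "Re (kernel_det K 2 x) = Re (K (x 0) (x 0)) * Re (K (x 1) (x 1)) - (cmod (K (x 0) (x 1)))\<^sup>2"
proof -
  have "Im (K (x 0) (x 0)) = 0" using diag(1)[of "x 0"] by (metis Im_complex_of_real)
  then show ?thesis unfolding kernel_det_2 mult_sym by simp
qed

text \<open>The Cauchy-Schwarz inequality is nonnegativity of the two-point determinant.\<close>

lemma cauchy: "(cmod (K x y))\<^sup>2 \<le> Re (K x x) * Re (K y y)"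
proof -
  define z where "z i = (if i = 0 then x else y)" for i :: nat
  have "0 \<le> Re (kernel_det K 2 z)" by (rule kernel_det_nonneg)
  then show ?thesis unfolding Re_kernel_det_2 by (simp add: z_def)
qed

text \<open>By Schur's formula a determinant of the complement is the determinant of
  \<open>K\<close> with \<open>p\<close> appended to the points, divided by \<open>K p p\<close>;
  numerator and denominator are nonnegative reals.\<close>

lemma schur_pd:
  assumes nz: "K p p \<noteq> 0"
  shows "pd_kernel (schur_kernel K p)"
proof
  show "hermitian_kernel (schur_kernel K p)"
    unfolding hermitian_kernel_def schur_kernel_def
  proof (intro allI)
    fix x y
    have "cnj (K y x - K y p * K p x / K p p) = K x y - K p y * K x p / K p p"
      using sym[of x y] sym[of p y] sym[of x p] sym[of p p] by simp
    then show "K x y - K x p * K p y / K p p = cnj (K y x - K y p * K p x / K p p)"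
      by (simp only: mult.commute)
  qed
  show "positive_definite_kernel (schur_kernel K p)"
    unfolding positive_definite_kernel_def
  proof (intro allI impI)
    fix k :: nat and x
    let ?y = "x(k := p)"
    obtain r where r: "K p p = complex_of_real r" "0 \<le> r" by (rule that[OF diag])
    obtain s where s: "kernel_det K (Suc k) ?y = complex_of_real s" "0 \<le> s"
      by (rule that[OF kernel_det_real kernel_det_nonneg])
    have "kernel_det K (Suc k) ?y = K p p * kernel_det (schur_kernel K p) k ?y"
      using kernel_det_Suc[of K ?y k] nz by simp
    moreover have "kernel_det (schur_kernel K p) k ?y = kernel_det (schur_kernel K p) k x"
      by (rule kernel_det_cong) auto
    ultimately have "kernel_det (schur_kernel K p) k x = kernel_det K (Suc k) ?y / K p p"
      using nz by simp
    also have "\<dots> = complex_of_real (s / r)" by (simp add: r s)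
    finally show "kernel_det (schur_kernel K p) k x \<in> \<real>\<^sub>\<ge>\<^sub>0"
      using r s by (simp add: nonneg_Reals_of_real_iff)
  qed
qed

lemma comp_pd: "pd_kernel (\<lambda>i j. K (x i) (x j))"
proof
  show "hermitian_kernel (\<lambda>i j. K (x i) (x j))" using herm unfolding hermitian_kernel_def by blast
  show "positive_definite_kernel (\<lambda>i j. K (x i) (x j))"
    unfolding positive_definite_kernel_def
  proof (intro allI impI)
    fix k :: nat and j assume "1 \<le> k"
    then have "kernel_det K k (x \<circ> j) \<in> \<real>\<^sub>\<ge>\<^sub>0"
      using pd unfolding positive_definite_kernel_def by blast
    then show "kernel_det (\<lambda>i j. K (x i) (x j)) k j \<in> \<real>\<^sub>\<ge>\<^sub>0"
      by (simp add: kernel_det_def)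
  qed
qed

text \<open>By \<open>cauchy\<close>. This settles the points at which no Schur complement can be
  formed.\<close>

lemma zero_diag: "K p p = 0 \<Longrightarrow> K p y = 0" "K p p = 0 \<Longrightarrow> K y p = 0"
  using cauchy[of p y] cauchy[of y p] by auto

end

text \<open>Cholesky factorisation, one point at a time. It converts the hypothesis on determinants
  into an explicit sum of squares, the form in which the entrywise product of kernels is
  manageable.\<close>

lemma pd_kernel_decomp:
  assumes "finite F" "pd_kernel K"
  shows "\<exists>(n::nat) v. \<forall>x\<in>F. \<forall>y\<in>F. K x y = (\<Sum>k<n. v k x * cnj (v k y))"
  using assms
proof (induction F arbitrary: K rule: finite_induct)
  case empty
  then show ?case by auto
next
  case (insert p F)
  interpret pd_kernel K by fact
  show ?case
  proof (cases "K p p = 0")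
    case True
    from insert.IH[OF insert.prems] obtain n :: nat and v
      where v: "\<And>x y. x \<in> F \<Longrightarrow> y \<in> F \<Longrightarrow> K x y = (\<Sum>k<n. v k x * cnj (v k y))" by blast
    let ?v = "\<lambda>k. (v k)(p := 0)"
    have "K x y = (\<Sum>k<n. ?v k x * cnj (?v k y))" if "x \<in> insert p F" "y \<in> insert p F" for x y
    proof (cases "x = p \<or> y = p")
      case True then show ?thesis using zero_diag[OF \<open>K p p = 0\<close>] by auto
    next
      case False
      then show ?thesis using that v[of x y] by simp
    qed
    then show ?thesis by (intro exI[of _ n] exI[of _ "?v"] ballI)
  next
    case False
    interpret S: pd_kernel "schur_kernel K p" by (rule schur_pd[OF False])
    have pp: "schur_kernel K p p p = 0" using False by (simp add: schur_kernel_def)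
    from insert.IH[OF S.pd_kernel_axioms] obtain n :: nat and v
      where v: "\<And>x y. x \<in> F \<Longrightarrow> y \<in> F \<Longrightarrow> schur_kernel K p x y = (\<Sum>k<n. v k x * cnj (v k y))" by blast
    define r where "r = complex_of_real (sqrt (Re (K p p)))"
    have r: "r * cnj r = K p p"
    proof -
      obtain s where s: "K p p = complex_of_real s" "0 \<le> s" by (rule that[OF diag])
      then show ?thesis by (simp add: r_def flip: of_real_mult)
    qed
    \<comment> \<open>The complement has a zero row and column at \<open>p\<close>, so the old
      vectors may be set to 0 there; the new vector restores the rank-one part that the complement
      subtracts.\<close>
    define w where "w k = (if k < n then (v k)(p := 0) else (\<lambda>x. K x p / r))" for k
    have "K x y = (\<Sum>k<Suc n. w k x * cnj (w k y))" if "x \<in> insert p F" "y \<in> insert p F" for x y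
    proof -
      have "schur_kernel K p x y = (\<Sum>k<n. w k x * cnj (w k y))"
      proof (cases "x = p \<or> y = p")
        case True then show ?thesis using S.zero_diag[OF pp] by (auto simp: w_def)
      next
        case False
        then show ?thesis using that v[of x y] by (simp add: w_def)
      qed
      moreover have "w n x * cnj (w n y) = K x p * K p y / K p p"
        using r sym[of p y] by (simp add: w_def mult.commute)
      ultimately have "K x y - K x p * K p y / K p p + K x p * K p y / K p p = (\<Sum>k<Suc n. w k x * cnj (w k y))"
        by (simp add: schur_kernel_def)
      then show ?thesis by simp
    qed
    then show ?thesis by (intro exI[of _ "Suc n"] exI[of _ w] ballI)
  qed
qed

context pd_kernel
begin

text \<open>With \<open>K\<close> a sum of \<open>v k x * cnj (v k y)\<close>, the kernel
  \<open>\<bar>K x y\<bar>^2\<close> is the sum over \<open>k\<close>, \<open>l\<close> of the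
  rank-one kernels built from \<open>v k x * cnj (v l x)\<close>. The quadratic form is therefore a
  sum of squared moduli.\<close>

lemma schur_product:
  assumes "finite F"
  shows "0 \<le> Re (\<Sum>x\<in>F. \<Sum>y\<in>F. c x * cnj (c y) * complex_of_real ((cmod (K x y))\<^sup>2))"
proof -
  from pd_kernel_decomp[OF assms pd_kernel_axioms] obtain n :: nat and v
    where v: "\<And>x y. x \<in> F \<Longrightarrow> y \<in> F \<Longrightarrow> K x y = (\<Sum>k<n. v k x * cnj (v k y))" by blast
  have "(\<Sum>x\<in>F. \<Sum>y\<in>F. c x * cnj (c y) * complex_of_real ((cmod (K x y))\<^sup>2))
    = (\<Sum>x\<in>F. \<Sum>y\<in>F. \<Sum>k<n. \<Sum>l<n. (c x * v k x * cnj (v l x)) * cnj (c y * v k y * cnj (v l y)))"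
  proof (intro sum.cong refl)
    fix x y assume xy: "x \<in> F" "y \<in> F"
    have "complex_of_real ((cmod (K x y))\<^sup>2) = K x y * cnj (K x y)" by (rule complex_norm_square)
    also have "\<dots> = (\<Sum>k<n. v k x * cnj (v k y)) * (\<Sum>l<n. cnj (v l x * cnj (v l y)))"
      by (simp only: v[OF xy] cnj_sum)
    also have "\<dots> = (\<Sum>k<n. \<Sum>l<n. (v k x * cnj (v k y)) * cnj (v l x * cnj (v l y)))"
      by (rule sum_product)
    finally have "c x * cnj (c y) * complex_of_real ((cmod (K x y))\<^sup>2) =
        (\<Sum>k<n. \<Sum>l<n. c x * cnj (c y) * ((v k x * cnj (v k y)) * cnj (v l x * cnj (v l y))))"
      by (simp only: sum_distrib_left)
    then show "c x * cnj (c y) * complex_of_real ((cmod (K x y))\<^sup>2) =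
        (\<Sum>k<n. \<Sum>l<n. (c x * v k x * cnj (v l x)) * cnj (c y * v k y * cnj (v l y)))"
      by (simp add: mult_ac)
  qed
  also have "\<dots> = (\<Sum>k<n. \<Sum>l<n. \<Sum>x\<in>F. \<Sum>y\<in>F. (c x * v k x * cnj (v l x)) * cnj (c y * v k y * cnj (v l y)))"
    (is "_ = ?R")
  proof -
    let ?h = "\<lambda>x y k l. (c x * v k x * cnj (v l x)) * cnj (c y * v k y * cnj (v l y))"
    have "(\<Sum>x\<in>F. \<Sum>y\<in>F. \<Sum>k<n. \<Sum>l<n. ?h x y k l) = (\<Sum>x\<in>F. \<Sum>k<n. \<Sum>y\<in>F. \<Sum>l<n. ?h x y k l)"
      by (intro sum.cong refl sum.swap)
    also have "\<dots> = (\<Sum>k<n. \<Sum>x\<in>F. \<Sum>y\<in>F. \<Sum>l<n. ?h x y k l)" by (rule sum.swap)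
    also have "\<dots> = (\<Sum>k<n. \<Sum>x\<in>F. \<Sum>l<n. \<Sum>y\<in>F. ?h x y k l)"
      by (intro sum.cong refl sum.swap)
    also have "\<dots> = ?R" by (intro sum.cong refl sum.swap)
    finally show ?thesis .
  qed
  also have "\<dots> = (\<Sum>k<n. \<Sum>l<n. (\<Sum>x\<in>F. c x * v k x * cnj (v l x)) * cnj (\<Sum>x\<in>F. c x * v k x * cnj (v l x)))"
    by (simp add: sum_product)
  also have "\<dots> = (\<Sum>k<n. \<Sum>l<n. complex_of_real ((cmod (\<Sum>x\<in>F. c x * v k x * cnj (v l x)))\<^sup>2))"
    by (simp only: complex_norm_square)
  finally show ?thesis by (simp add: sum_nonneg)
qed

text \<open>With \<open>S\<close> the complement, \<open>K\<close> is \<open>S\<close> plus a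
  rank-one kernel with values \<open>a\<close>, \<open>b\<close> at the two points. Expanding both
  determinants, the mixed terms have the right sign by \<open>cauchy\<close> for \<open>S\<close>
  and the arithmetic-geometric mean inequality. This is the step behind all Fischer-type bounds
  below.\<close>

lemma det2_schur_le:
  assumes nz: "K p p \<noteq> 0"
  shows "Re (kernel_det (schur_kernel K p) 2 x) \<le> Re (kernel_det K 2 x)"
proof -
  interpret S: pd_kernel "schur_kernel K p" by (rule schur_pd[OF nz])
  let ?S = "schur_kernel K p"
  let ?x = "x 0" and ?y = "x 1"
  obtain s where s: "K p p = complex_of_real s" "0 \<le> s" by (rule that[OF diag])
  define r where "r = sqrt s"
  have r: "r > 0" using nz s by (simp add: r_def)
  have Kpp: "K p p = complex_of_real (r\<^sup>2)" using s by (simp add: r_def)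
  define a where "a = K ?x p / r"
  define b where "b = K ?y p / r"
  have K: "K u v = ?S u v + (K u p / r) * cnj (K v p / r)" for u v
    using r sym[of p v] by (simp add: schur_kernel_def Kpp power2_eq_square)
  have dx: "Re (K ?x ?x) = Re (?S ?x ?x) + (cmod a)\<^sup>2"
    by (simp only: K[of ?x ?x] a_def[symmetric] complex_norm_square[symmetric] plus_complex.sel Re_complex_of_real)
  have dy: "Re (K ?y ?y) = Re (?S ?y ?y) + (cmod b)\<^sup>2"
    by (simp only: K[of ?y ?y] b_def[symmetric] complex_norm_square[symmetric] plus_complex.sel Re_complex_of_real)
  have dxy: "K ?x ?y = ?S ?x ?y + a * cnj b"
    by (simp only: K[of ?x ?y] a_def b_def)
  have "cmod (K ?x ?y) \<le> cmod (?S ?x ?y) + cmod a * cmod b"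
    unfolding dxy by (metis norm_triangle_ineq norm_mult complex_mod_cnj)
  then have "(cmod (K ?x ?y))\<^sup>2 \<le> (cmod (?S ?x ?y) + cmod a * cmod b)\<^sup>2"
    by (rule power_mono) simp
  also have "(cmod (?S ?x ?y) + cmod a * cmod b)\<^sup>2
     = (cmod (?S ?x ?y))\<^sup>2 + (cmod a)\<^sup>2 * (cmod b)\<^sup>2 + 2 * (cmod (?S ?x ?y) * (cmod a * cmod b))"
    by (simp add: power2_eq_square algebra_simps)
  \<comment> \<open>The geometric mean of the two terms on the right dominates the cross term,
    because \<open>cmod (?S ?x ?y)\<close> is at most the product of the square roots
    \<open>?s\<close> and \<open>?t\<close>.\<close>
  also have "2 * (cmod (?S ?x ?y) * (cmod a * cmod b)) \<le> Re (?S ?x ?x) * (cmod b)\<^sup>2 + Re (?S ?y ?y) * (cmod a)\<^sup>2"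
  proof -
    let ?s = "sqrt (Re (?S ?x ?x))" and ?t = "sqrt (Re (?S ?y ?y))"
    have "cmod (?S ?x ?y) \<le> ?s * ?t"
      using S.cauchy[of ?x ?y] by (metis norm_ge_zero real_le_rsqrt real_sqrt_mult)
    then have "cmod (?S ?x ?y) * (cmod a * cmod b) \<le> ?s * ?t * (cmod a * cmod b)"
      by (rule mult_right_mono) simp
    moreover have "0 \<le> (?s * cmod b - ?t * cmod a)\<^sup>2" by simp
    then have "2 * (?s * ?t * (cmod a * cmod b)) \<le> ?s\<^sup>2 * (cmod b)\<^sup>2 + ?t\<^sup>2 * (cmod a)\<^sup>2"
      by (simp add: power2_eq_square algebra_simps)
    ultimately show ?thesis using S.diag(2)[of ?x] S.diag(2)[of ?y] by simp
  qed
  finally show ?thesis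
    unfolding Re_kernel_det_2 S.Re_kernel_det_2 dx dy by (simp add: algebra_simps)
qed

text \<open>Splitting off the third point with pivot 1 leaves a two-point determinant of a
  complement. It is at most that of \<open>K\<close>, which is 1 minus a square.\<close>

lemma fischer3:
  assumes one: "\<And>x. K x x = 1"
  shows "Re (kernel_det K 3 x) \<le> 1"
proof -
  have "kernel_det K 3 x = kernel_det (schur_kernel K (x 2)) 2 x"
    using kernel_det_Suc[of K x 2] one by simp
  then show ?thesis
    using det2_schur_le[of "x 2" x] Re_kernel_det_2[of x] one by simp
      (smt (verit) zero_le_power2)
qed

text \<open>Splitting off \<open>x 3\<close> and then \<open>x 2\<close> produces two pivots whose
  product is the two-point determinant of \<open>x 2\<close>, \<open>x 3\<close>. The factor left
  over is the two-point determinant of \<open>x 0\<close>, \<open>x 1\<close> for the twice reduced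
  kernel, and each reduction only lowers it.\<close>

lemma fischer4:
  assumes one: "\<And>x. K x x = 1"
  shows "Re (kernel_det K 4 x) \<le> Re (kernel_det K 2 x) * Re (kernel_det K 2 (\<lambda>i. x (i + 2)))"
proof -
  let ?S = "schur_kernel K (x 3)"
  interpret S: pd_kernel ?S by (rule schur_pd) (simp add: one)
  have e4: "kernel_det K 4 x = kernel_det ?S 3 x"
    using kernel_det_Suc[of K x 3] one by simp
  have e2: "Re (kernel_det K 2 (\<lambda>i. x (i + 2))) = Re (?S (x 2) (x 2))"
  proof -
    have "(0::nat) + 2 = 2" "(1::nat) + 2 = 3" by simp_all
    then show ?thesis
      using mult_sym[of "x 2" "x 3"]
      by (simp only: Re_kernel_det_2 schur_kernel_def one minus_complex.sel one_complex.sel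
          Re_complex_of_real mult_1 div_by_1)
  qed
  show ?thesis
  proof (cases "?S (x 2) (x 2) = 0")
    case True
    \<comment> \<open>A zero pivot rules out a second use of Schur's formula. The row of
      \<open>x 2\<close> in the remaining matrix is then zero, so both sides of the inequality
      vanish.\<close>
    define M where "M = Matrix.mat 3 3 (\<lambda>(i, j). ?S (x i) (x j))"
    have "kernel_det ?S 3 x = 0"
    proof -
      have "M \<in> carrier_mat 3 3" by (simp add: M_def)
      then have "Determinant.det M = 0"
        by (subst laplace_expansion_row[where i = 2 and n = 3])
           (auto simp: M_def S.zero_diag[OF True])
      then show ?thesis by (simp add: kernel_det_def M_def)
    qed
    then show ?thesis unfolding e4 e2 True by simp
  next
    case False
    have e3: "kernel_det ?S 3 x = ?S (x 2) (x 2) * kernel_det (schur_kernel ?S (x 2)) 2 x"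
      using kernel_det_Suc[of ?S x 2] False by simp
    have "Re (kernel_det K 4 x) = Re (?S (x 2) (x 2)) * Re (kernel_det (schur_kernel ?S (x 2)) 2 x)"
    proof -
      obtain s where s: "?S (x 2) (x 2) = complex_of_real s" by (rule that[OF S.diag(1)])
      show ?thesis unfolding e4 e3 s by simp
    qed
    also have "\<dots> \<le> Re (?S (x 2) (x 2)) * Re (kernel_det K 2 x)"
      using S.det2_schur_le[OF False, of x] det2_schur_le[of "x 3" x] one
      by (intro mult_left_mono S.diag(2)) auto
    finally show ?thesis unfolding e2 by (simp add: mult.commute)
  qed
qed

end

section \<open>Fourier transforms and Lebesgue decomposition\<close>

lemma sets_add_measure [simp, measurable_cong]: "sets (add_measure M N) = sets M"
  and space_add_measure [simp]: "space (add_measure M N) = space M"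
  by (simp_all add: add_measure_def)

lemma emeasure_add_measure:
  assumes "sets N = sets M" "A \<in> sets M"
  shows "emeasure (add_measure M N) A = emeasure M A + emeasure N A"
  unfolding add_measure_def
proof (rule emeasure_measure_of_sigma[OF sets.sigma_algebra_axioms _ _ assms(2)])
  show "positive (sets M) (\<lambda>A. emeasure M A + emeasure N A)" by (simp add: positive_def)
  show "countably_additive (sets M) (\<lambda>A. emeasure M A + emeasure N A)"
  proof (rule countably_additiveI)
    fix A :: "nat \<Rightarrow> _" assume A: "range A \<subseteq> sets M" "disjoint_family A"
    have "(\<Sum>i. emeasure M (A i) + emeasure N (A i)) = (\<Sum>i. emeasure M (A i)) + (\<Sum>i. emeasure N (A i))"
      by (intro suminf_add[symmetric]) auto
    also have "\<dots> = emeasure M (\<Union>i. A i) + emeasure N (\<Union>i. A i)"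
      using A assms(1) by (simp add: suminf_emeasure)
    finally show "(\<Sum>i. emeasure M (A i) + emeasure N (A i)) = emeasure M (\<Union>i. A i) + emeasure N (\<Union>i. A i)" .
  qed
qed

lemma nn_integral_add_measure:
  assumes s: "sets N = sets M" and f: "f \<in> borel_measurable M"
  shows "(\<integral>\<^sup>+x. f x \<partial>add_measure M N) = (\<integral>\<^sup>+x. f x \<partial>M) + (\<integral>\<^sup>+x. f x \<partial>N)"
  using f
proof (induction f rule: borel_measurable_induct)
  case (cong f g)
  have "space N = space M" using s by (rule sets_eq_imp_space_eq)
  then have "(\<integral>\<^sup>+x. f x \<partial>N) = (\<integral>\<^sup>+x. g x \<partial>N)" "(\<integral>\<^sup>+x. f x \<partial>M) = (\<integral>\<^sup>+x. g x \<partial>M)"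
    "(\<integral>\<^sup>+x. f x \<partial>add_measure M N) = (\<integral>\<^sup>+x. g x \<partial>add_measure M N)"
    using cong(3) by (auto intro!: nn_integral_cong)
  then show ?case using cong by simp
next
  case (set A)
  then show ?case using s by (simp add: emeasure_add_measure)
next
  case (mult u c)
  then have "u \<in> borel_measurable N" "u \<in> borel_measurable (add_measure M N)"
    using s by (auto cong: measurable_cong_sets)
  then show ?case using mult by (simp add: nn_integral_cmult distrib_left)
next
  case (add u v)
  then have "u \<in> borel_measurable N" "u \<in> borel_measurable (add_measure M N)"
    "v \<in> borel_measurable N" "v \<in> borel_measurable (add_measure M N)"
    using s by (auto cong: measurable_cong_sets)
  then show ?case using add by (simp add: nn_integral_add add_ac)
next
  case (seq U)
  note inc = \<open>incseq U\<close> and mU = \<open>\<And>i. U i \<in> borel_measurable M\<close>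
  have m: "U i \<in> borel_measurable N" "U i \<in> borel_measurable (add_measure M N)" for i
    using s mU by (auto cong: measurable_cong_sets)
  have "(\<integral>\<^sup>+x. (SUP i. U i) x \<partial>add_measure M N) = (SUP i. \<integral>\<^sup>+x. U i x \<partial>add_measure M N)"
    unfolding SUP_apply by (rule nn_integral_monotone_convergence_SUP[OF inc m(2)])
  also have "\<dots> = (SUP i. (\<integral>\<^sup>+x. U i x \<partial>M) + (\<integral>\<^sup>+x. U i x \<partial>N))" by (simp add: seq.IH)
  also have "\<dots> = (SUP i. \<integral>\<^sup>+x. U i x \<partial>M) + (SUP i. \<integral>\<^sup>+x. U i x \<partial>N)"
    using inc by (intro ennreal_SUP_add) (auto simp: mono_def le_fun_def intro!: nn_integral_mono)
  also have "\<dots> = (\<integral>\<^sup>+x. (SUP i. U i) x \<partial>M) + (\<integral>\<^sup>+x. (SUP i. U i) x \<partial>N)"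
    unfolding SUP_apply
    by (simp add: nn_integral_monotone_convergence_SUP[OF inc mU] nn_integral_monotone_convergence_SUP[OF inc m(1)])
  finally show ?case using seq by simp
qed

lemma integrable_add_measure:
  fixes f :: "'a \<Rightarrow> 'b::{banach, second_countable_topology}"
  assumes s: "sets N = sets M"
  shows "integrable (add_measure M N) f \<longleftrightarrow> integrable M f \<and> integrable N f"
proof -
  have "f \<in> borel_measurable (add_measure M N) \<longleftrightarrow> f \<in> borel_measurable M"
    "f \<in> borel_measurable N \<longleftrightarrow> f \<in> borel_measurable M"
    using s by (auto cong: measurable_cong_sets)
  then show ?thesis
    unfolding integrable_iff_bounded
    by (auto simp: nn_integral_add_measure[OF s] less_top ennreal_add_eq_top)
qed

lemma integral_add_measure:
  fixes f :: "'a \<Rightarrow> 'b::{banach, second_countable_topology}"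
  assumes s: "sets N = sets M" and f: "integrable M f" "integrable N f"
  shows "integral\<^sup>L (add_measure M N) f = integral\<^sup>L M f + integral\<^sup>L N f"
proof -
  have "integrable (add_measure M N) f" using f by (simp add: integrable_add_measure[OF s])
  then show ?thesis
  proof (induction rule: integrable_induct)
    case (base A c)
    have sp: "space N = space M" using s by (rule sets_eq_imp_space_eq)
    have A: "A \<in> sets M" "A \<in> sets N" using base s by auto
    have fin: "emeasure M A < \<infinity>" "emeasure N A < \<infinity>"
      using base A by (auto simp: emeasure_add_measure[OF s] less_top ennreal_add_eq_top)
    have "measure (add_measure M N) A = measure M A + measure N A"
      using fin A by (auto simp: measure_def emeasure_add_measure[OF s] less_top intro!: enn2real_plus)
    then show ?case
      using A fin base by (simp add: scaleR_add_left sp less_top[symmetric])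
  next
    case (add f g)
    then show ?case by (simp add: integrable_add_measure[OF s])
  next
    case (lim f u)
    have sp: "space N = space M" using s by (rule sets_eq_imp_space_eq)
    have i: "integrable M (u i)" "integrable N (u i)" for i
      using lim(1)[of i] by (auto simp: integrable_add_measure[OF s])
    have j: "integrable M f" "integrable N f"
      using lim by (auto simp: integrable_add_measure[OF s])
    note m = i[THEN borel_measurable_integrable] j[THEN borel_measurable_integrable]
    note w = j[THEN integrable_norm, THEN integrable_mult_right]
    have A: "(\<lambda>i. integral\<^sup>L (add_measure M N) (u i)) \<longlonglongrightarrow> integral\<^sup>L (add_measure M N) f"
      by (rule integral_dominated_convergence[where w = "\<lambda>x. 2 * norm (f x)"]) (use lim in auto)
    have B: "(\<lambda>i. integral\<^sup>L M (u i)) \<longlonglongrightarrow> integral\<^sup>L M f"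
      by (rule integral_dominated_convergence[where w = "\<lambda>x. 2 * norm (f x)", OF m(3,1) w(1)])
        (use lim in auto)
    have C: "(\<lambda>i. integral\<^sup>L N (u i)) \<longlonglongrightarrow> integral\<^sup>L N f"
      by (rule integral_dominated_convergence[where w = "\<lambda>x. 2 * norm (f x)", OF m(4,2) w(2)])
        (use lim sp in auto)
    from tendsto_add[OF B C] have "(\<lambda>i. integral\<^sup>L (add_measure M N) (u i)) \<longlonglongrightarrow> integral\<^sup>L M f + integral\<^sup>L N f"
      by (simp only: lim.IH)
    with A show ?case by (rule LIMSEQ_unique)
  qed
qed

section \<open>Lebesgue integrals of product functions, translations and dilations\<close>

lemma integrable_lborel_prod:
  fixes f :: "'a::euclidean_space \<Rightarrow> real \<Rightarrow> 'b::{real_normed_field,banach,second_countable_topology}"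
  assumes f: "\<And>b. b \<in> Basis \<Longrightarrow> integrable lborel (f b)"
  shows "integrable lborel (\<lambda>x. \<Prod>b\<in>Basis. f b (inner x b))"
    and "(\<integral>x. (\<Prod>b\<in>Basis. f b (inner x b)) \<partial>lborel) = (\<Prod>b\<in>Basis. \<integral>x. f b x \<partial>lborel)"
proof -
  interpret product_sigma_finite "\<lambda>_::'a. lborel :: real measure" ..
  have m[measurable]: "f b \<in> borel_measurable borel" if "b \<in> Basis" for b
    using f[OF that] by (simp add: integrable_iff_bounded)
  have T: "(\<lambda>x. \<Sum>b\<in>Basis. x b *\<^sub>R b) \<in> (\<Pi>\<^sub>M b\<in>Basis. lborel) \<rightarrow>\<^sub>M (borel :: 'a measure)" by measurable
  have F: "(\<lambda>x::'a. \<Prod>b\<in>Basis. f b (inner x b)) \<in> borel_measurable borel" by measurable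
  have e: "(\<Prod>b\<in>Basis. f b (inner (\<Sum>c\<in>Basis. x c *\<^sub>R c) b)) = (\<Prod>b\<in>Basis. f b (x b))" for x :: "'a \<Rightarrow> real"
    by (intro prod.cong refl) (simp add: inner_sum_left_Basis)
  show "integrable lborel (\<lambda>x. \<Prod>b\<in>Basis. f b (inner x b))"
    by (subst lborel_eq, subst integrable_distr_eq[OF T F], unfold e)
       (intro product_integrable_prod f finite_Basis)
  show "(\<integral>x. (\<Prod>b\<in>Basis. f b (inner x b)) \<partial>lborel) = (\<Prod>b\<in>Basis. \<integral>x. f b x \<partial>lborel)"
    by (subst lborel_eq, subst integral_distr[OF T F], unfold e)
       (intro product_integral_prod f finite_Basis)
qed

lemma lborel_translate:
  fixes f :: "'a::euclidean_space \<Rightarrow> 'b::{banach,second_countable_topology}"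
  assumes "integrable lborel f"
  shows "integrable lborel (\<lambda>x. f (x + c))" "(\<integral>x. f (x + c) \<partial>lborel) = (\<integral>x. f x \<partial>lborel)"
proof -
  have m: "f \<in> borel_measurable borel" using assms by (simp add: integrable_iff_bounded)
  have "integrable (distr lborel borel ((+) c)) f" using assms by (simp add: lborel_distr_plus)
  then show "integrable lborel (\<lambda>x. f (x + c))"
    using m by (simp add: integrable_distr_eq add.commute)
  have "(\<integral>x. f x \<partial>lborel) = (\<integral>x. f x \<partial>distr lborel borel ((+) c))" by (simp add: lborel_distr_plus)
  also have "\<dots> = (\<integral>x. f (x + c) \<partial>lborel)" using m by (simp add: integral_distr add.commute)
  finally show "(\<integral>x. f (x + c) \<partial>lborel) = (\<integral>x. f x \<partial>lborel)" ..
qed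

lemma lborel_scale:
  fixes f :: "'a::euclidean_space \<Rightarrow> 'b::{banach,second_countable_topology}"
  assumes m: "f \<in> borel_measurable borel" and c: "c > 0"
  shows "integrable lborel (\<lambda>x. f (c *\<^sub>R x)) \<longleftrightarrow> integrable lborel f"
    "(\<integral>x. f x \<partial>lborel) = c ^ DIM('a) *\<^sub>R (\<integral>x. f (c *\<^sub>R x) \<partial>lborel)"
proof -
  have l: "lborel = density (distr lborel borel (\<lambda>x::'a. c *\<^sub>R x)) (\<lambda>_. c ^ DIM('a))"
    using lborel_affine[of c "0::'a"] c by simp
  have T: "(\<lambda>x::'a. c *\<^sub>R x) \<in> borel \<rightarrow>\<^sub>M borel" by measurable
  show "(\<integral>x. f x \<partial>lborel) = c ^ DIM('a) *\<^sub>R (\<integral>x. f (c *\<^sub>R x) \<partial>lborel)"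
    by (subst l, subst integral_density) (use m c T in \<open>auto simp: integral_distr\<close>)
  have "integrable lborel f \<longleftrightarrow> integrable (density (distr lborel borel (\<lambda>x::'a. c *\<^sub>R x)) (\<lambda>_. c ^ DIM('a))) f"
    by (subst l) simp
  also have "\<dots> \<longleftrightarrow> integrable lborel (\<lambda>x. f (c *\<^sub>R x))"
  proof (subst integrable_density)
    have "integrable lborel (\<lambda>x. c ^ DIM('a) *\<^sub>R f (c *\<^sub>R x)) \<longleftrightarrow> integrable lborel (\<lambda>x. f (c *\<^sub>R x))"
      using c integrable_scaleR_right[of "inverse (c ^ DIM('a))" lborel "\<lambda>x. c ^ DIM('a) *\<^sub>R f (c *\<^sub>R x)"] by auto
    then show "integrable (distr lborel borel ((*\<^sub>R) c)) (\<lambda>x. c ^ DIM('a) *\<^sub>R f x) \<longleftrightarrow> integrable lborel (\<lambda>x. f (c *\<^sub>R x))"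
      using m T by (subst integrable_distr_eq) auto
  qed (use m c in auto)
  finally show "integrable lborel (\<lambda>x. f (c *\<^sub>R x)) \<longleftrightarrow> integrable lborel f" ..
qed

section \<open>Fourier transforms of integrable functions\<close>

definition wave :: "'a::euclidean_space \<Rightarrow> 'a \<Rightarrow> complex" where
  "wave x y = exp (- 2 * complex_of_real pi * \<i> * complex_of_real (inner x y))"

lemma fourier_wave: "fourier f y = (\<integral>x. f x * wave x y \<partial>lborel)"
  by (simp add: fourier_def wave_def)

lemma wave_iexp: "wave x y = exp (\<i> * complex_of_real (- 2 * pi * inner x y))"
  by (simp add: wave_def algebra_simps)

lemma wave_cis: "wave x y = cis (- 2 * pi * inner x y)"
  unfolding wave_iexp cis_conv_exp ..

lemma norm_wave [simp]: "norm (wave x y) = 1"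
  by (simp add: wave_cis)

lemma wave_measurable [measurable]: "(\<lambda>(x, y). wave x y) \<in> borel_measurable (borel \<Otimes>\<^sub>M borel)"
  unfolding wave_def by measurable

lemma wave_measurable' [measurable]:
  assumes [measurable]: "f \<in> M \<rightarrow>\<^sub>M borel" "g \<in> M \<rightarrow>\<^sub>M borel"
  shows "(\<lambda>x. wave (f x) (g x)) \<in> borel_measurable M"
  unfolding wave_def by measurable

lemma wave_scale: "wave (c *\<^sub>R x) y = wave x (c *\<^sub>R y)"
  by (simp add: wave_def)

lemma wave_commute: "wave x y = wave y x"
  by (simp add: wave_def inner_commute)

lemma integrable_wave:
  assumes "integrable lborel f"
  shows "integrable lborel (\<lambda>x. f x * wave x y)"
proof (rule Bochner_Integration.integrable_bound[OF assms])
  have [measurable]: "f \<in> borel_measurable borel" using assms by (simp add: integrable_iff_bounded)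
  show "(\<lambda>x. f x * wave x y) \<in> borel_measurable lborel" by measurable
qed (simp add: norm_mult)

lemma norm_fourier_le:
  assumes "integrable lborel f"
  shows "norm (fourier f y) \<le> (\<integral>x. norm (f x) \<partial>lborel)"
  unfolding fourier_wave
  by (rule order_trans[OF integral_norm_bound]) (simp add: norm_mult)

lemma fourier_measurable [measurable]:
  assumes [measurable]: "f \<in> borel_measurable borel"
  shows "fourier f \<in> borel_measurable borel"
proof -
  have "(\<lambda>y. \<integral>x. f x * wave x y \<partial>lborel) \<in> borel_measurable borel" by measurable
  then show ?thesis by (simp add: fourier_wave[abs_def])
qed

text \<open>Fubini, together with the symmetry of \<open>wave\<close> in its two arguments. It later
  moves the transform from a test function to \<open>g\<close> and from a Gaussian to a test
  function.\<close>

lemma fourier_multiplication: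
  assumes f: "integrable lborel f" and g: "integrable lborel g"
  shows "(\<integral>y. fourier f y * g y \<partial>lborel) = (\<integral>x. f x * fourier g x \<partial>lborel)"
proof -
  have [measurable]: "f \<in> borel_measurable borel" "g \<in> borel_measurable borel"
    using f g by (auto simp: integrable_iff_bounded)
  have e: "f x * wave x y * g y = f x * (g y * wave y x)" for x y
    by (simp only: wave_commute[of x y] mult.assoc mult.commute[of "wave y x"])
  have i: "integrable (lborel \<Otimes>\<^sub>M lborel) (\<lambda>(x, y). f x * wave x y * g y)"
  proof (rule lborel_pair.Fubini_integrable)
    show "(\<lambda>(x, y). f x * wave x y * g y) \<in> borel_measurable (lborel \<Otimes>\<^sub>M lborel)" by measurable
    show "integrable lborel (\<lambda>x. \<integral>y. norm (case (x, y) of (x, y) \<Rightarrow> f x * wave x y * g y) \<partial>lborel)"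
      using f by (simp add: norm_mult)
    show "AE x in lborel. integrable lborel (\<lambda>y. case (x, y) of (x, y) \<Rightarrow> f x * wave x y * g y)"
      unfolding prod.case e using integrable_wave[OF g] by (intro AE_I2 integrable_mult_right)
  qed
  have "(\<integral>y. fourier f y * g y \<partial>lborel) = (\<integral>y. (\<integral>x. f x * wave x y * g y \<partial>lborel) \<partial>lborel)"
    by (simp add: fourier_wave)
  also have "\<dots> = (\<integral>x. (\<integral>y. f x * wave x y * g y \<partial>lborel) \<partial>lborel)"
    by (rule lborel_pair.Fubini_integral[OF i])
  also have "\<dots> = (\<integral>x. f x * fourier g x \<partial>lborel)"
    by (simp only: e fourier_wave integral_mult_right_zero)
  finally show ?thesis .
qed


section \<open>Integrability of Schwartz functions and of their Fourier transforms\<close>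

lemma integrable_Cauchy_1: "integrable lborel (\<lambda>x::real. 1 / (1 + x\<^sup>2))"
proof -
  have "set_integrable lborel (einterval (-\<infinity>) \<infinity>) (\<lambda>x. inverse (1 + x^2) :: real)"
    by (rule integrable_inverse_1_plus_square)
  then show ?thesis by (simp add: set_integrable_def einterval_def inverse_eq_divide)
qed

text \<open>A product of one-dimensional Cauchy weights is integrable in every dimension. It serves
  as the dominating function both for Schwartz functions and for their transforms.\<close>

definition cauchy_prod :: "'a::euclidean_space \<Rightarrow> real" where
  "cauchy_prod x = (\<Prod>b\<in>Basis. 1 / (1 + (inner x b)\<^sup>2))"

lemma integrable_cauchy_prod: "integrable lborel cauchy_prod"
  unfolding cauchy_prod_def by (rule integrable_lborel_prod(1)) (rule integrable_Cauchy_1)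

lemma schwartz_partial:
  assumes "schwartz f" "b \<in> Basis"
  shows "schwartz (partial_derivative b f)"
  unfolding schwartz_def
proof (intro allI impI)
  fix bs :: "'a list" assume "set bs \<subseteq> Basis"
  then have "set (bs @ [b]) \<subseteq> Basis" using assms by auto
  then have "(\<forall>x. foldr partial_derivative (bs @ [b]) f differentiable (at x)) \<and>
        (\<forall>m::nat. \<exists>C. \<forall>x. norm x ^ m * norm (foldr partial_derivative (bs @ [b]) f x) \<le> C)"
    using assms(1) unfolding schwartz_def by blast
  then show "(\<forall>x. foldr partial_derivative bs (partial_derivative b f) differentiable (at x)) \<and>
        (\<forall>m::nat. \<exists>C. \<forall>x. norm x ^ m * norm (foldr partial_derivative bs (partial_derivative b f) x) \<le> C)"
    by simp
qed

lemma schwartz_differentiable: "schwartz f \<Longrightarrow> f differentiable (at x)"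
  unfolding schwartz_def by (drule spec[of _ "[]"]) auto

lemma schwartz_continuous: "schwartz f \<Longrightarrow> continuous_on A f"
  by (meson schwartz_differentiable differentiable_imp_continuous_within continuous_at_imp_continuous_on)

lemma schwartz_measurable: "schwartz f \<Longrightarrow> f \<in> borel_measurable borel"
  by (rule borel_measurable_continuous_onI) (rule schwartz_continuous)

lemma schwartz_bound: "schwartz f \<Longrightarrow> \<exists>C. \<forall>x. norm x ^ m * norm (f x) \<le> C"
  unfolding schwartz_def by (drule spec[of _ "[]"]) auto

text \<open>Translates decay in powers of the norm, as in \<open>schwartz\<close>, into decay
  against \<open>cauchy_prod\<close>. The factor \<open>2 ^ DIM('a)\<close> comes from bounding
  \<open>1 + (norm x)^2\<close> by twice the larger summand.\<close>

lemma prod_le_power_norm: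
  "(\<Prod>b\<in>(Basis::'a::euclidean_space set). 1 + (inner x b)\<^sup>2) \<le> 2 ^ DIM('a) * (1 + norm x ^ (2 * DIM('a)))"
proof -
  have "(\<Prod>b\<in>(Basis::'a set). 1 + (inner x b)\<^sup>2) \<le> (\<Prod>b\<in>(Basis::'a set). 1 + (norm x)\<^sup>2)"
  proof (intro prod_mono conjI)
    fix b :: 'a assume "b \<in> Basis"
    then have "\<bar>inner x b\<bar> \<le> norm x" by (rule Basis_le_norm)
    then have "\<bar>inner x b\<bar>\<^sup>2 \<le> (norm x)\<^sup>2" by (intro power_mono) auto
    then show "1 + (inner x b)\<^sup>2 \<le> 1 + (norm x)\<^sup>2" by simp
  qed simp
  also have "\<dots> = (1 + (norm x)\<^sup>2) ^ DIM('a)" by simp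
  also have "\<dots> \<le> 2 ^ DIM('a) * (1 + norm x ^ (2 * DIM('a)))"
  proof (cases "norm x \<le> 1")
    case True
    then have "(norm x)\<^sup>2 \<le> 1" by (simp add: power_le_one)
    then have "(1 + (norm x)\<^sup>2) ^ DIM('a) \<le> 2 ^ DIM('a) * 1" by (simp add: power_mono)
    also have "\<dots> \<le> 2 ^ DIM('a) * (1 + norm x ^ (2 * DIM('a)))" by (intro mult_left_mono) auto
    finally show ?thesis .
  next
    case False
    then have "1 + (norm x)\<^sup>2 \<le> 2 * (norm x)\<^sup>2" by (simp add: one_le_power)
    then have "(1 + (norm x)\<^sup>2) ^ DIM('a) \<le> (2 * (norm x)\<^sup>2) ^ DIM('a)" by (intro power_mono) auto
    also have "\<dots> = 2 ^ DIM('a) * norm x ^ (2 * DIM('a))" by (simp add: power_mult_distrib power_mult)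
    also have "\<dots> \<le> 2 ^ DIM('a) * (1 + norm x ^ (2 * DIM('a)))" by (intro mult_left_mono) auto
    finally show ?thesis .
  qed
  finally show ?thesis .
qed

lemma cauchy_prod_pos: "0 < cauchy_prod x"
  unfolding cauchy_prod_def by (intro prod_pos) (simp add: add_pos_nonneg)

lemma prod_mult_cauchy_prod: "(\<Prod>b\<in>Basis. 1 + (inner x b)\<^sup>2) * cauchy_prod x = 1"
  unfolding cauchy_prod_def prod.distrib[symmetric]
  by (intro prod.neutral ballI) (simp, metis add_pos_nonneg less_numeral_extra(1,3) zero_le_power2)

lemma le_cauchy_prod:
  assumes "(\<Prod>b\<in>Basis. 1 + (inner x b)\<^sup>2) * r \<le> C"
  shows "r \<le> C * cauchy_prod x"
proof -
  have "(\<Prod>b\<in>Basis. 1 + (inner x b)\<^sup>2) * r * cauchy_prod x \<le> C * cauchy_prod x"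
    using assms cauchy_prod_pos[of x] by (intro mult_right_mono) auto
  also have "(\<Prod>b\<in>Basis. 1 + (inner x b)\<^sup>2) * r * cauchy_prod x
      = r * ((\<Prod>b\<in>Basis. 1 + (inner x b)\<^sup>2) * cauchy_prod x)" by (simp only: mult_ac)
  finally show ?thesis by (simp only: prod_mult_cauchy_prod mult_1_right)
qed

lemma schwartz_integrable:
  fixes f :: "'a::euclidean_space \<Rightarrow> complex"
  assumes f: "schwartz f"
  shows "integrable lborel f"
proof -
  obtain C0 where C0: "\<And>x. norm (f x) \<le> C0" using schwartz_bound[OF f, of 0] by auto
  obtain C1 where C1: "\<And>x. norm x ^ (2 * DIM('a)) * norm (f x) \<le> C1"
    using schwartz_bound[OF f, of "2 * DIM('a)"] by auto
  have b: "norm (f x) \<le> 2 ^ DIM('a) * (C0 + C1) * cauchy_prod x" for x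
  proof (rule le_cauchy_prod)
    have "(\<Prod>b\<in>Basis. 1 + (inner x b)\<^sup>2) * norm (f x) \<le> 2 ^ DIM('a) * (1 + norm x ^ (2 * DIM('a))) * norm (f x)"
      by (intro mult_right_mono prod_le_power_norm) simp
    also have "\<dots> = 2 ^ DIM('a) * (norm (f x) + norm x ^ (2 * DIM('a)) * norm (f x))"
      by (simp add: algebra_simps)
    also have "\<dots> \<le> 2 ^ DIM('a) * (C0 + C1)"
      by (intro mult_left_mono add_mono C0 C1) simp
    finally show "(\<Prod>b\<in>Basis. 1 + (inner x b)\<^sup>2) * norm (f x) \<le> 2 ^ DIM('a) * (C0 + C1)" .
  qed
  show ?thesis
  proof (rule Bochner_Integration.integrable_bound)
    show "integrable lborel (\<lambda>x::'a. 2 ^ DIM('a) * (C0 + C1) * cauchy_prod x)"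
      by (intro integrable_mult_right integrable_cauchy_prod)
    show "f \<in> borel_measurable lborel" using schwartz_measurable[OF f] by simp
    show "AE x in lborel. norm (f x) \<le> norm (2 ^ DIM('a) * (C0 + C1) * cauchy_prod x)"
      using b by (intro AE_I2) (metis abs_ge_self order_trans real_norm_def)
  qed
qed

text \<open>The difference \<open>h (x + b) - h x\<close> has integral zero by translation
  invariance. It is also the integral of \<open>h'\<close> over the segment from \<open>x\<close> to
  \<open>x + b\<close>, and by Fubini the average over the segment parameter equals the integral of
  \<open>h'\<close>. This integration by parts needs no boundary terms at infinity.\<close>

lemma integral_directional_derivative:
  fixes h h' :: "'a::euclidean_space \<Rightarrow> complex"
  assumes h: "integrable lborel h" and h': "integrable lborel h'" and c: "continuous_on UNIV h'"
    and d: "\<And>x s. ((\<lambda>s. h (x + s *\<^sub>R b)) has_vector_derivative h' (x + s *\<^sub>R b)) (at s)"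
  shows "(\<integral>x. h' x \<partial>lborel) = 0"
proof -
  have [measurable]: "h' \<in> borel_measurable borel" using h' by (simp add: integrable_iff_bounded)
  have FTC: "(\<integral>s. indicator {0..1} s *\<^sub>R h' (x + s *\<^sub>R b) \<partial>lborel) = h (x + b) - h x" for x
  proof -
    have "(\<integral>s. indicator {0..1} s *\<^sub>R h' (x + s *\<^sub>R b) \<partial>lborel) = h (x + 1 *\<^sub>R b) - h (x + 0 *\<^sub>R b)"
    proof (rule integral_FTC_Icc)
      show "((\<lambda>s. h (x + s *\<^sub>R b)) has_vector_derivative h' (x + s *\<^sub>R b)) (at s within {0..1})" for s :: real
        using d has_vector_derivative_at_within by blast
      show "continuous_on {0..1} (\<lambda>s::real. h' (x + s *\<^sub>R b))"
        by (intro continuous_on_compose2[OF c] continuous_intros) auto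
    qed simp
    then show ?thesis by simp
  qed
  have i: "integrable (lborel \<Otimes>\<^sub>M lborel) (\<lambda>(s::real, x). indicator {0..1} s *\<^sub>R h' (x + s *\<^sub>R b))"
  proof (rule lborel_pair.Fubini_integrable)
    show "(\<lambda>(s::real, x). indicator {0..1} s *\<^sub>R h' (x + s *\<^sub>R b)) \<in> borel_measurable (lborel \<Otimes>\<^sub>M lborel)"
      by measurable
    have "(\<integral>x. norm (case (s, x) of (s, x) \<Rightarrow> indicator {0..1} s *\<^sub>R h' (x + s *\<^sub>R b)) \<partial>lborel)
      = indicator {0..1} s *\<^sub>R (\<integral>x. norm (h' x) \<partial>lborel)" for s :: real
      using lborel_translate(2)[of "\<lambda>x. norm (h' x)" "s *\<^sub>R b"] h' by simp
    then show "integrable lborel (\<lambda>s::real. \<integral>x. norm (case (s, x) of (s, x) \<Rightarrow> indicator {0..1} s *\<^sub>R h' (x + s *\<^sub>R b)) \<partial>lborel)"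
      by (simp only:) simp
    show "AE s in lborel. integrable lborel (\<lambda>x. case (s, x) of (s::real, x) \<Rightarrow> indicator {0..1} s *\<^sub>R h' (x + s *\<^sub>R b))"
      using lborel_translate(1)[OF h'] by (intro AE_I2) simp
  qed
  have "0 = (\<integral>x. h (x + b) - h x \<partial>lborel)"
    using lborel_translate[OF h, of b] h by simp
  also have "\<dots> = (\<integral>x. (\<integral>s. indicator {0..1} s *\<^sub>R h' (x + s *\<^sub>R b) \<partial>lborel) \<partial>lborel)"
    by (simp only: FTC)
  also have "\<dots> = (\<integral>s. (\<integral>x. indicator {0..1::real} s *\<^sub>R h' (x + s *\<^sub>R b) \<partial>lborel) \<partial>lborel)"
    by (rule lborel_pair.Fubini_integral[OF i])
  also have "\<dots> = (\<integral>s. indicator {0..1::real} s *\<^sub>R (\<integral>x. h' x \<partial>lborel) \<partial>lborel)"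
    using lborel_translate(2)[OF h'] by simp
  also have "\<dots> = (\<integral>x. h' x \<partial>lborel)" by simp
  finally show ?thesis ..
qed

lemma has_vector_derivative_partial:
  assumes "f differentiable (at (x + s *\<^sub>R b))"
  shows "((\<lambda>s. f (x + s *\<^sub>R b)) has_vector_derivative partial_derivative b f (x + s *\<^sub>R b)) (at s)"
proof -
  let ?D = "frechet_derivative f (at (x + s *\<^sub>R b))"
  have D: "(f has_derivative ?D) (at (x + s *\<^sub>R b))" using assms by (simp add: frechet_derivative_works)
  have "((\<lambda>s. x + s *\<^sub>R b) has_derivative (\<lambda>r. r *\<^sub>R b)) (at s)"
    by (auto intro!: derivative_eq_intros)
  from diff_chain_at[OF this D] have "((\<lambda>s. f (x + s *\<^sub>R b)) has_derivative (\<lambda>r. ?D (r *\<^sub>R b))) (at s)"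
    by (simp add: o_def)
  then show ?thesis
    unfolding has_vector_derivative_def partial_derivative_def
    by (simp add: linear_scale[OF has_derivative_linear[OF D]])
qed

text \<open>The directional derivative of \<open>f\<close> times the character has integral zero;
  the product rule turns this into the stated identity.\<close>

lemma fourier_partial:
  assumes f: "schwartz f" and b: "b \<in> Basis"
  shows "fourier (partial_derivative b f) y = 2 * complex_of_real pi * \<i> * complex_of_real (inner y b) * fourier f y"
proof -
  let ?c = "- 2 * complex_of_real pi * \<i> * complex_of_real (inner b y)"
  let ?h = "\<lambda>x. f x * wave x y"
  let ?h' = "\<lambda>x. f x * (?c * wave x y) + partial_derivative b f x * wave x y"
  note f' = schwartz_partial[OF f b]
  have wc: "continuous_on UNIV (\<lambda>x. wave x y)" unfolding wave_def by (intro continuous_intros)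
  have i1: "integrable lborel (\<lambda>x. f x * (?c * wave x y))"
    using integrable_mult_right[OF integrable_wave[OF schwartz_integrable[OF f]], of ?c y] by (simp add: mult_ac)
  have i2: "integrable lborel (\<lambda>x. partial_derivative b f x * wave x y)"
    by (intro integrable_wave schwartz_integrable f')
  have "(\<integral>x. ?h' x \<partial>lborel) = 0"
  proof (rule integral_directional_derivative[where h = ?h and b = b])
    show "integrable lborel ?h" by (intro integrable_wave schwartz_integrable f)
    show "integrable lborel ?h'" by (intro Bochner_Integration.integrable_add i1 i2)
    show "continuous_on UNIV ?h'"
      by (intro continuous_intros wc schwartz_continuous f f')
    fix x s
    have "((\<lambda>s. wave (x + s *\<^sub>R b) y) has_vector_derivative ?c * wave (x + s *\<^sub>R b) y) (at s)"
      unfolding wave_def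
      by (auto intro!: derivative_eq_intros has_vector_derivative_real_field
          simp: has_field_derivative_def inner_add_left has_vector_derivative_def[symmetric] algebra_simps)
    then show "((\<lambda>s. f (x + s *\<^sub>R b) * wave (x + s *\<^sub>R b) y) has_vector_derivative ?h' (x + s *\<^sub>R b)) (at s)"
      by (intro has_vector_derivative_mult has_vector_derivative_partial schwartz_differentiable f)
  qed
  then have "(\<integral>x. f x * (?c * wave x y) \<partial>lborel) + fourier (partial_derivative b f) y = 0"
    using i1 i2 by (simp add: fourier_wave)
  moreover have "(\<integral>x. f x * (?c * wave x y) \<partial>lborel) = ?c * fourier f y"
    by (simp only: fourier_wave integral_mult_right_zero[symmetric] mult.left_commute)
  ultimately show ?thesis by (simp add: inner_commute add_eq_0_iff2)
qed

text \<open>Induction over the coordinates: two derivatives in direction \<open>b\<close> multiply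
  the transform by a number of modulus at least \<open>(inner y b)^2\<close> and keep the function
  Schwartz, so the induction hypothesis is needed for \<open>f\<close> and for its second
  derivative.\<close>

lemma fourier_decay:
  assumes "schwartz f" "finite B" "B \<subseteq> Basis"
  shows "\<exists>C. \<forall>y. (\<Prod>b\<in>B. 1 + (inner y b)\<^sup>2) * norm (fourier f y) \<le> C"
  using assms(2,3,1)
proof (induction B arbitrary: f rule: finite_induct)
  case empty
  then show ?case using norm_fourier_le[OF schwartz_integrable[OF empty.prems(2)]] by auto
next
  case (insert b B)
  have b: "b \<in> Basis" and B: "B \<subseteq> Basis" using insert.prems by auto
  let ?g = "partial_derivative b (partial_derivative b f)"
  have g: "schwartz ?g" using insert.prems b by (intro schwartz_partial)
  obtain C1 where C1: "\<And>y. (\<Prod>b\<in>B. 1 + (inner y b)\<^sup>2) * norm (fourier f y) \<le> C1"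
    using insert.IH[OF B insert.prems(2)] by blast
  obtain C2 where C2: "\<And>y. (\<Prod>b\<in>B. 1 + (inner y b)\<^sup>2) * norm (fourier ?g y) \<le> C2"
    using insert.IH[OF B g] by blast
  have "(\<Prod>b\<in>insert b B. 1 + (inner y b)\<^sup>2) * norm (fourier f y) \<le> C1 + C2" for y
  proof -
    have "norm (fourier ?g y) = (2 * pi * \<bar>inner y b\<bar>) * ((2 * pi * \<bar>inner y b\<bar>) * norm (fourier f y))"
      using insert.prems b
      by (simp add: fourier_partial schwartz_partial norm_mult)
    also have "\<dots> = (2 * pi)\<^sup>2 * ((inner y b)\<^sup>2 * norm (fourier f y))"
      by (simp add: power2_eq_square)
    also have "\<dots> \<ge> 1 * ((inner y b)\<^sup>2 * norm (fourier f y))"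
      using pi_gt3 by (intro mult_right_mono one_le_power) auto
    finally have "(1 + (inner y b)\<^sup>2) * norm (fourier f y) \<le> norm (fourier f y) + norm (fourier ?g y)"
      by (simp add: algebra_simps)
    then have "(\<Prod>b\<in>B. 1 + (inner y b)\<^sup>2) * ((1 + (inner y b)\<^sup>2) * norm (fourier f y))
       \<le> (\<Prod>b\<in>B. 1 + (inner y b)\<^sup>2) * (norm (fourier f y) + norm (fourier ?g y))"
      by (intro mult_left_mono prod_nonneg) auto
    also have "\<dots> \<le> C1 + C2" using C1[of y] C2[of y] by (simp add: distrib_left)
    finally show ?thesis using insert.hyps by (simp add: mult_ac)
  qed
  then show ?case by blast
qed

lemma integrable_fourier_schwartz:
  assumes f: "schwartz f"
  shows "integrable lborel (fourier f)"
proof -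
  obtain C where "\<And>y. (\<Prod>b\<in>Basis. 1 + (inner y b)\<^sup>2) * norm (fourier f y) \<le> C"
    using fourier_decay[OF f finite_Basis subset_refl] by blast
  then have b: "norm (fourier f y) \<le> C * cauchy_prod y" for y by (rule le_cauchy_prod)
  show ?thesis
  proof (rule Bochner_Integration.integrable_bound)
    show "integrable lborel (\<lambda>x::'a. C * cauchy_prod x)"
      by (intro integrable_mult_right integrable_cauchy_prod)
    show "fourier f \<in> borel_measurable lborel"
      using fourier_measurable[OF schwartz_measurable[OF f]] by simp
    show "AE x in lborel. norm (fourier f x) \<le> norm (C * cauchy_prod x)"
      using b by (intro AE_I2) (metis abs_ge_self order_trans real_norm_def)
  qed
qed


section \<open>Gaussian regularisation and Fourier inversion at the origin\<close>

text \<open>Coordinate by coordinate this is the characteristic function of the standard normal law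
  at \<open>-2 * pi * inner x b\<close>. Writing the result as a normal density of standard
  deviation \<open>1 / (2 * pi)\<close> makes it evident that the transform has integral
  one.\<close>

lemma fourier_gaussian:
  fixes x :: "'a::euclidean_space"
  shows "integrable lborel (\<lambda>y::'a. complex_of_real (\<Prod>b\<in>Basis. exp (- (inner y b)\<^sup>2 / 2)))"
    and "fourier (\<lambda>y. complex_of_real (\<Prod>b\<in>Basis. exp (- (inner y b)\<^sup>2 / 2))) x
      = complex_of_real (\<Prod>b\<in>Basis. normal_density 0 (1 / (2 * pi)) (inner x b))"
proof -
  have i: "integrable lborel (\<lambda>t::real. exp (- t\<^sup>2 / 2))"
    using integrable_mult_right[OF integrable_normal_density[of 1 0], of "sqrt (2 * pi)"]
    by (simp add: std_normal_density_def)
  then have ic: "integrable lborel (\<lambda>t::real. complex_of_real (exp (- t\<^sup>2 / 2)))"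
    by (rule integrable_of_real)
  then show "integrable lborel (\<lambda>y::'a. complex_of_real (\<Prod>b\<in>Basis. exp (- (inner y b)\<^sup>2 / 2)))"
    unfolding of_real_prod by (intro integrable_lborel_prod)
  have one: "(\<integral>t. complex_of_real (exp (- t\<^sup>2 / 2)) * exp (\<i> * complex_of_real (s * t)) \<partial>lborel)
     = complex_of_real (sqrt (2 * pi) * exp (- s\<^sup>2 / 2))"
    and ione: "integrable lborel (\<lambda>t. complex_of_real (exp (- t\<^sup>2 / 2)) * exp (\<i> * complex_of_real (s * t)))" for s
  proof -
    have "char std_normal_distribution s = (\<integral>t. std_normal_density t *\<^sub>R exp (\<i> * complex_of_real (s * t)) \<partial>lborel)"
      unfolding char_def by (subst integral_density) auto
    also have "\<dots> = (\<integral>t. complex_of_real (1 / sqrt (2 * pi)) * (complex_of_real (exp (- t\<^sup>2 / 2)) * exp (\<i> * complex_of_real (s * t))) \<partial>lborel)"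
      by (simp add: std_normal_density_def scaleR_conv_of_real mult.assoc)
    also have "\<dots> = complex_of_real (1 / sqrt (2 * pi)) * (\<integral>t. complex_of_real (exp (- t\<^sup>2 / 2)) * exp (\<i> * complex_of_real (s * t)) \<partial>lborel)"
      by (rule integral_mult_right_zero)
    finally have e: "complex_of_real (exp (- s\<^sup>2 / 2)) = complex_of_real (1 / sqrt (2 * pi)) * (\<integral>t. complex_of_real (exp (- t\<^sup>2 / 2)) * exp (\<i> * complex_of_real (s * t)) \<partial>lborel)"
      by (simp add: char_std_normal_distribution)
    have "complex_of_real (sqrt (2 * pi)) * complex_of_real (1 / sqrt (2 * pi)) = 1"
      by (simp flip: of_real_mult)
    then show "(\<integral>t. complex_of_real (exp (- t\<^sup>2 / 2)) * exp (\<i> * complex_of_real (s * t)) \<partial>lborel)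
     = complex_of_real (sqrt (2 * pi) * exp (- s\<^sup>2 / 2))"
      unfolding of_real_mult e mult.assoc[symmetric] by simp
    show "integrable lborel (\<lambda>t. complex_of_real (exp (- t\<^sup>2 / 2)) * exp (\<i> * complex_of_real (s * t)))"
      by (rule Bochner_Integration.integrable_bound[OF ic]) (auto simp: norm_mult)
  qed
  have split: "complex_of_real (\<Prod>b\<in>Basis. exp (- (inner y b)\<^sup>2 / 2)) * wave y x
    = (\<Prod>b\<in>Basis. complex_of_real (exp (- (inner y b)\<^sup>2 / 2)) * exp (\<i> * complex_of_real ((- 2 * pi * inner x b) * inner y b)))" for y
  proof -
    have "wave y x = exp (\<Sum>b\<in>Basis. \<i> * complex_of_real ((- 2 * pi * inner x b) * inner y b))"
      unfolding wave_iexp sum_distrib_left[symmetric] of_real_sum[symmetric]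
      by (subst euclidean_inner[of y x]) (simp add: sum_distrib_left mult_ac sum_negf)
    then show ?thesis by (simp add: exp_sum prod.distrib)
  qed
  have nd: "sqrt (2 * pi) * exp (- (- 2 * pi * t)\<^sup>2 / 2) = normal_density 0 (1 / (2 * pi)) t" for t
  proof -
    have "1 / sqrt (2 * pi * (1 / (2 * pi))\<^sup>2) = sqrt (2 * pi)"
    proof -
      have "2 * pi * (1 / (2 * pi))\<^sup>2 = 1 / (2 * pi)" by (simp add: power2_eq_square)
      then show ?thesis by (simp add: real_sqrt_divide)
    qed
    then show ?thesis by (simp add: normal_density_def power_mult_distrib power_divide)
  qed
  have "fourier (\<lambda>y. complex_of_real (\<Prod>b\<in>Basis. exp (- (inner y b)\<^sup>2 / 2))) x
     = (\<integral>y. (\<Prod>b\<in>Basis. complex_of_real (exp (- (inner y b)\<^sup>2 / 2)) * exp (\<i> * complex_of_real ((- 2 * pi * inner x b) * inner y b))) \<partial>lborel)"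
    unfolding fourier_wave split ..
  also have "\<dots> = (\<Prod>b\<in>Basis. \<integral>t. complex_of_real (exp (- t\<^sup>2 / 2)) * exp (\<i> * complex_of_real ((- 2 * pi * inner x b) * t)) \<partial>lborel)"
    by (rule integrable_lborel_prod(2)) (rule ione)
  also have "\<dots> = complex_of_real (\<Prod>b\<in>Basis. normal_density 0 (1 / (2 * pi)) (inner x b))"
    unfolding one nd of_real_prod ..
  finally show "fourier (\<lambda>y. complex_of_real (\<Prod>b\<in>Basis. exp (- (inner y b)\<^sup>2 / 2))) x
      = complex_of_real (\<Prod>b\<in>Basis. normal_density 0 (1 / (2 * pi)) (inner x b))" .
qed

text \<open>Substitution of \<open>c *\<^sub>R x\<close> for \<open>x\<close>. It is applied with
  \<open>y\<close> divided by \<open>c\<close>, which leaves a single dilation by \<open>c\<close>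
  on the right.\<close>

lemma fourier_scale:
  fixes f :: "'a::euclidean_space \<Rightarrow> complex"
  assumes m: "f \<in> borel_measurable borel" and c: "c > 0"
  shows "fourier f (c *\<^sub>R y) = c ^ DIM('a) *\<^sub>R fourier (\<lambda>x. f (c *\<^sub>R x)) (c *\<^sub>R c *\<^sub>R y)"
  unfolding fourier_wave
  by (subst lborel_scale(2)[OF _ c]) (use m in \<open>simp_all add: wave_scale\<close>)

text \<open>The integral of the Fourier transform is regularised by a Gaussian.\<close>

lemma integral_fourier_schwartz:
  fixes f :: "'a::euclidean_space \<Rightarrow> complex"
  assumes f: "schwartz f"
  shows "(\<integral>y. fourier f y \<partial>lborel) = f 0"
proof -
  define G where "G y = complex_of_real (\<Prod>b\<in>Basis. exp (- (inner y b)\<^sup>2 / 2))" for y :: 'a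
  define H where "H x = (\<Prod>b\<in>Basis. normal_density 0 (1 / (2 * pi)) (inner x b))" for x :: 'a
  note Gi = fourier_gaussian(1)[where 'a = 'a, folded G_def]
  have GH: "fourier G x = complex_of_real (H x)" for x
    using fourier_gaussian(2)[of x] by (simp add: G_def[abs_def] H_def)
  have [measurable]: "f \<in> borel_measurable borel" by (rule schwartz_measurable[OF f])
  have [measurable]: "G \<in> borel_measurable borel" using Gi by (simp add: integrable_iff_bounded)
  have iH: "integrable lborel H" "(\<integral>x. H x \<partial>lborel) = 1"
    unfolding H_def
    using integrable_lborel_prod[where 'a = 'a, of "\<lambda>_. normal_density 0 (1 / (2 * pi))"] by auto
  obtain C where C: "\<And>x. norm (f x) \<le> C" using schwartz_bound[OF f, of 0] by auto
  have nG: "norm (G y) \<le> 1" for y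
    unfolding G_def norm_of_real by (simp add: abs_prod) (intro prod_le_1; simp)
  define s :: "nat \<Rightarrow> real" where "s n = 1 / real (Suc n)" for n
  have s0: "s \<longlonglongrightarrow> 0" unfolding s_def by (rule LIMSEQ_Suc[OF lim_1_over_n])
  have spos: "s n > 0" for n by (simp add: s_def)
  \<comment> \<open>The multiplication formula applied to the dilated \<open>f\<close> and the
    Gaussian \<open>G\<close>, followed by a dilation of the \<open>y\<close> integral. As
    \<open>s n\<close> tends to 0, the Gaussian flattens on the left while \<open>f\<close>
    concentrates at the origin on the right.\<close>
  have eq: "(\<integral>y. fourier f y * G (s n *\<^sub>R y) \<partial>lborel) = (\<integral>u. f (s n *\<^sub>R u) * complex_of_real (H u) \<partial>lborel)" for n
  proof -
    let ?c = "s n"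
    have i: "integrable lborel (\<lambda>x. f (?c *\<^sub>R x))"
      using schwartz_integrable[OF f] spos[of n] by (simp add: lborel_scale(1))
    have d: "(1 / ?c) ^ DIM('a) *\<^sub>R (?c ^ DIM('a) *\<^sub>R v) = v" for v :: complex
      using spos[of n] by (simp add: power_divide)
    have sc: "?c ^ DIM('a) *\<^sub>R fourier (\<lambda>x. f (?c *\<^sub>R x)) (?c *\<^sub>R y) = fourier f y" for y
      using fourier_scale[OF _ spos[of n], of f "(1 / ?c) *\<^sub>R y"] spos[of n] by simp
    have "(\<integral>u. f (?c *\<^sub>R u) * complex_of_real (H u) \<partial>lborel) = (\<integral>y. fourier (\<lambda>x. f (?c *\<^sub>R x)) y * G y \<partial>lborel)"
      unfolding GH[symmetric] by (rule fourier_multiplication[symmetric, OF i Gi])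
    also have "\<dots> = ?c ^ DIM('a) *\<^sub>R (\<integral>y. fourier (\<lambda>x. f (?c *\<^sub>R x)) (?c *\<^sub>R y) * G (?c *\<^sub>R y) \<partial>lborel)"
      by (rule lborel_scale(2)[OF _ spos]) measurable
    also have "\<dots> = (\<integral>y. (?c ^ DIM('a) *\<^sub>R fourier (\<lambda>x. f (?c *\<^sub>R x)) (?c *\<^sub>R y)) * G (?c *\<^sub>R y) \<partial>lborel)"
      by (simp flip: integral_scaleR_right)
    finally show ?thesis by (simp only: sc)
  qed
  \<comment> \<open>Dominated by the integrable transform of \<open>f\<close>; the limit is its
    plain integral because \<open>G 0 = 1\<close>.\<close>
  have "(\<lambda>n. \<integral>y. fourier f y * G (s n *\<^sub>R y) \<partial>lborel) \<longlonglongrightarrow> (\<integral>y. fourier f y * G (0 *\<^sub>R y) \<partial>lborel)"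
  proof (rule integral_dominated_convergence)
    show "integrable lborel (\<lambda>y. norm (fourier f y))"
      by (intro integrable_norm integrable_fourier_schwartz f)
    show "AE y in lborel. (\<lambda>n. fourier f y * G (s n *\<^sub>R y)) \<longlonglongrightarrow> fourier f y * G (0 *\<^sub>R y)"
      unfolding G_def by (intro AE_I2 tendsto_intros s0) auto
    show "AE y in lborel. norm (fourier f y * G (s n *\<^sub>R y)) \<le> norm (fourier f y)" for n
      unfolding norm_mult by (intro AE_I2 mult_left_le nG norm_ge_zero)
  qed (measurable)
  then have L1: "(\<lambda>n. \<integral>y. fourier f y * G (s n *\<^sub>R y) \<partial>lborel) \<longlonglongrightarrow> (\<integral>y. fourier f y \<partial>lborel)"
    by (simp add: G_def)
  \<comment> \<open>Dominated by a bound of \<open>f\<close> times \<open>H\<close>; the limit is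
    \<open>f 0\<close> because \<open>H\<close> has integral one.\<close>
  have L2: "(\<lambda>n. \<integral>u. f (s n *\<^sub>R u) * complex_of_real (H u) \<partial>lborel) \<longlonglongrightarrow> (\<integral>u. f (0 *\<^sub>R u) * complex_of_real (H u) \<partial>lborel)"
  proof (rule integral_dominated_convergence)
    have [measurable]: "H \<in> borel_measurable borel" using iH(1) by (simp add: integrable_iff_bounded)
    show "(\<lambda>u. f (s n *\<^sub>R u) * complex_of_real (H u)) \<in> borel_measurable lborel" for n by measurable
    show "(\<lambda>u. f (0 *\<^sub>R u) * complex_of_real (H u)) \<in> borel_measurable lborel" by measurable
    show "integrable lborel (\<lambda>u. C * \<bar>H u\<bar>)" using iH by (intro integrable_mult_right integrable_abs)
    have "continuous (at 0) f"
      using schwartz_continuous[OF f, of UNIV] by (simp add: continuous_on_eq_continuous_at)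
    then have "(\<lambda>n. f (s n *\<^sub>R u)) \<longlonglongrightarrow> f (0 *\<^sub>R u)" for u
    proof -
      have "(\<lambda>n. s n *\<^sub>R u) \<longlonglongrightarrow> 0 *\<^sub>R u" by (intro tendsto_intros s0)
      then show ?thesis using \<open>continuous (at 0) f\<close> by (auto intro: isCont_tendsto_compose)
    qed
    then show "AE u in lborel. (\<lambda>n. f (s n *\<^sub>R u) * complex_of_real (H u)) \<longlonglongrightarrow> f (0 *\<^sub>R u) * complex_of_real (H u)"
      by (intro AE_I2 tendsto_mult tendsto_const)
    show "AE u in lborel. norm (f (s n *\<^sub>R u) * complex_of_real (H u)) \<le> C * \<bar>H u\<bar>" for n
      by (intro AE_I2) (simp add: norm_mult C mult_right_mono)
  qed
  have "(\<integral>u. f (0 *\<^sub>R u) * complex_of_real (H u) \<partial>lborel) = f 0"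
    using iH by simp
  then show ?thesis
    using LIMSEQ_unique[OF L1[unfolded eq] L2] by simp
qed

section \<open>Transform and Lebesgue decomposition of a unit mass plus a density\<close>

lemma emeasure_lborel_translate:
  fixes x :: "'a::euclidean_space"
  assumes B: "B \<in> sets borel"
  shows "(+) x ` B \<in> sets borel" "emeasure lborel ((+) x ` B) = emeasure lborel B"
proof -
  have e: "(+) x ` B = (\<lambda>y. - x + y) -` B \<inter> space (borel :: 'a measure)"
  proof (intro equalityI subsetI)
    fix y assume "y \<in> (\<lambda>y. - x + y) -` B \<inter> space (borel :: 'a measure)"
    then have "y = x + (- x + y)" "- x + y \<in> B" by simp_all
    then show "y \<in> (+) x ` B" by (rule image_eqI)
  next
    fix y assume "y \<in> (+) x ` B"
    then show "y \<in> (\<lambda>y. - x + y) -` B \<inter> space (borel :: 'a measure)" by auto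
  qed
  have m: "(\<lambda>y. - x + y) \<in> borel \<rightarrow>\<^sub>M borel" by measurable
  show "(+) x ` B \<in> sets borel" unfolding e by (rule measurable_sets[OF m B])
  have "emeasure lborel B = emeasure (distr lborel borel ((+) (- x))) B" by (simp only: lborel_distr_plus)
  also have "\<dots> = emeasure lborel ((+) x ` B)" unfolding e using B m by (subst emeasure_distr) auto
  finally show "emeasure lborel ((+) x ` B) = emeasure lborel B" ..
qed

lemma delta_density_integral:
  fixes f :: "'a::euclidean_space \<Rightarrow> complex"
  assumes [measurable]: "h \<in> borel_measurable borel" and h: "\<And>x. 0 \<le> h x" "\<And>x. h x \<le> 1"
    and f: "integrable lborel f"
  defines "\<mu> \<equiv> add_measure (return borel 0) (density lborel (\<lambda>x. ennreal (h x)))"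
  shows "integrable \<mu> f" "integral\<^sup>L \<mu> f = f 0 + (\<integral>x. complex_of_real (h x) * f x \<partial>lborel)"
proof -
  have [measurable]: "f \<in> borel_measurable borel" using f by (simp add: integrable_iff_bounded)
  have "integrable lborel (\<lambda>x. h x *\<^sub>R f x)"
  proof (rule Bochner_Integration.integrable_bound[OF f])
    show "AE x in lborel. norm (h x *\<^sub>R f x) \<le> norm (f x)"
      using h by (intro AE_I2) (simp add: mult_left_le_one_le)
  qed measurable
  then have i2: "integrable (density lborel (\<lambda>x. ennreal (h x))) f"
    using h by (subst integrable_density) auto
  have i1: "integrable (return borel 0) f"
    by (simp add: integrable_iff_bounded nn_integral_return)
  have s: "sets (density lborel (\<lambda>x. ennreal (h x))) = sets (return borel (0::'a))" by simp
  show "integrable \<mu> f" using i1 i2 by (simp add: \<mu>_def integrable_add_measure[OF s])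
  show "integral\<^sup>L \<mu> f = f 0 + (\<integral>x. complex_of_real (h x) * f x \<partial>lborel)"
    unfolding \<mu>_def integral_add_measure[OF s i1 i2]
    using h by (simp add: integral_return integral_density scaleR_conv_of_real)
qed

text \<open>Three contributions: the unit mass evaluates the transform of \<open>f\<close> at 0,
  which is the Lebesgue integral of \<open>f\<close>; Lebesgue measure integrates that transform to
  \<open>f 0\<close> by inversion; the density \<open>g\<close> is handled by the multiplication
  formula. The bounds between 0 and 1 keep \<open>ennreal\<close> from truncating the densities and
  make the right-hand measure translation bounded.\<close>

lemma is_fourier_transform_delta_density:
  fixes g :: "'a::euclidean_space \<Rightarrow> real" and G :: "'a \<Rightarrow> real"
  assumes g: "integrable lborel g" "\<And>x. 0 \<le> g x" "\<And>x. g x \<le> 1"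
    and G: "\<And>t. fourier (\<lambda>x. complex_of_real (g x)) t = complex_of_real (G t)" "\<And>t. 0 \<le> G t" "\<And>t. G t \<le> 1"
  shows "is_fourier_transform (add_measure (return borel 0) (density lborel (\<lambda>x. ennreal (1 - g x))))
    (add_measure (return borel 0) (density lborel (\<lambda>t. ennreal (1 - G t))))"
proof -
  have [measurable]: "g \<in> borel_measurable borel" using g by (simp add: integrable_iff_bounded)
  have "(\<lambda>t. Re (fourier (\<lambda>x. complex_of_real (g x)) t)) \<in> borel_measurable borel" by measurable
  then have [measurable]: "G \<in> borel_measurable borel" by (simp add: G)
  let ?\<mu> = "add_measure (return borel (0::'a)) (density lborel (\<lambda>t. ennreal (1 - G t)))"
  show ?thesis
    unfolding is_fourier_transform_def
  proof (intro conjI allI impI)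
    show "translation_bounded ?\<mu>"
      unfolding translation_bounded_def
    proof (intro conjI ballI impI)
      fix B :: "'a set" assume B: "B \<in> sets borel" "bounded B"
      have "(SUP x. emeasure ?\<mu> ((+) x ` B)) \<le> 1 + emeasure lborel B"
      proof (rule SUP_least)
        fix x :: 'a
        have "emeasure (density lborel (\<lambda>t. ennreal (1 - G t))) ((+) x ` B) \<le> emeasure lborel ((+) x ` B)"
        proof -
          have "emeasure (density lborel (\<lambda>t. ennreal (1 - G t))) ((+) x ` B)
            = (\<integral>\<^sup>+t. ennreal (1 - G t) * indicator ((+) x ` B) t \<partial>lborel)"
            using emeasure_lborel_translate(1)[OF B(1)] by (subst emeasure_density) auto
          also have "\<dots> \<le> (\<integral>\<^sup>+t. indicator ((+) x ` B) t \<partial>lborel)"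
            using G by (intro nn_integral_mono) (auto split: split_indicator)
          finally show ?thesis using emeasure_lborel_translate(1)[OF B(1)] by simp
        qed
        moreover have "emeasure (return borel (0::'a)) ((+) x ` B) \<le> 1"
          using emeasure_lborel_translate(1)[OF B(1)] by (simp add: indicator_def)
        ultimately show "emeasure ?\<mu> ((+) x ` B) \<le> 1 + emeasure lborel B"
          using emeasure_lborel_translate[OF B(1)]
          by (subst emeasure_add_measure) (auto intro!: add_mono)
      qed
      also have "\<dots> < \<infinity>" using emeasure_bounded_finite[OF B(2)] by (simp add: less_top)
      finally show "(SUP x. emeasure ?\<mu> ((+) x ` B)) < \<infinity>" .
    qed simp
  next
    fix f :: "'a \<Rightarrow> complex" assume f: "schwartz f"
    have i: "integrable lborel f" "integrable lborel (fourier f)"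
      using f by (auto intro: schwartz_integrable integrable_fourier_schwartz)
    have gc: "integrable lborel (\<lambda>x. complex_of_real (g x))" using g by (intro integrable_of_real)
    have gf: "integrable lborel (\<lambda>x. complex_of_real (g x) * h x)" if "integrable lborel h" for h
      using that
    proof (rule Bochner_Integration.integrable_bound)
      have [measurable]: "h \<in> borel_measurable borel" using that by (simp add: integrable_iff_bounded)
      show "(\<lambda>x. complex_of_real (g x) * h x) \<in> borel_measurable lborel" by measurable
      show "AE x in lborel. norm (complex_of_real (g x) * h x) \<le> norm (h x)"
        using g by (intro AE_I2) (simp add: norm_mult mult_left_le_one_le)
    qed
    have Gf: "integrable lborel (\<lambda>x. complex_of_real (G x) * h x)" if "integrable lborel h" for h
      using that
    proof (rule Bochner_Integration.integrable_bound)
      have [measurable]: "h \<in> borel_measurable borel" using that by (simp add: integrable_iff_bounded)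
      show "(\<lambda>x. complex_of_real (G x) * h x) \<in> borel_measurable lborel" by measurable
      show "AE x in lborel. norm (complex_of_real (G x) * h x) \<le> norm (h x)"
        using G by (intro AE_I2) (simp add: norm_mult mult_left_le_one_le)
    qed
    have f0: "fourier f 0 = (\<integral>x. f x \<partial>lborel)" by (simp add: fourier_wave wave_def)
    have "(\<integral>x. complex_of_real (g x) * fourier f x \<partial>lborel) = (\<integral>x. fourier f x * complex_of_real (g x) \<partial>lborel)"
      by (simp only: mult.commute)
    also have "\<dots> = (\<integral>x. f x * complex_of_real (G x) \<partial>lborel)"
      unfolding fourier_multiplication[OF i(1) gc] G(1) ..
    also have "\<dots> = (\<integral>x. complex_of_real (G x) * f x \<partial>lborel)" by (simp only: mult.commute)
    finally have e: "(\<integral>x. complex_of_real (g x) * fourier f x \<partial>lborel) = (\<integral>x. complex_of_real (G x) * f x \<partial>lborel)" .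
    show "integrable (add_measure (return borel 0) (density lborel (\<lambda>x. ennreal (1 - g x)))) (fourier f)"
      by (rule delta_density_integral(1)) (use g i in auto)
    have "integral\<^sup>L (add_measure (return borel 0) (density lborel (\<lambda>x. ennreal (1 - g x)))) (fourier f)
      = fourier f 0 + (\<integral>x. complex_of_real (1 - g x) * fourier f x \<partial>lborel)"
      by (rule delta_density_integral(2)) (use g i in auto)
    also have "\<dots> = fourier f 0 + ((\<integral>x. fourier f x \<partial>lborel) - (\<integral>x. complex_of_real (g x) * fourier f x \<partial>lborel))"
      using i gf[OF i(2)] by (simp add: left_diff_distrib)
    also have "\<dots> = f 0 + ((\<integral>x. f x \<partial>lborel) - (\<integral>x. complex_of_real (G x) * f x \<partial>lborel))"
      by (simp add: f0 e integral_fourier_schwartz[OF f])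
    also have "\<dots> = f 0 + (\<integral>x. complex_of_real (1 - G x) * f x \<partial>lborel)"
      using i Gf[OF i(1)] by (simp add: left_diff_distrib)
    also have "\<dots> = integral\<^sup>L ?\<mu> f"
      by (rule delta_density_integral(2)[symmetric]) (use G i in auto)
    finally show "integral\<^sup>L ?\<mu> f = integral\<^sup>L (add_measure (return borel 0) (density lborel (\<lambda>x. ennreal (1 - g x)))) (fourier f)" ..
  qed
qed

text \<open>\<open>ac_part\<close> is a definite description, so uniqueness is part of the claim. If
  \<open>N\<close> is a null set carrying the singular part of another decomposition, then off
  \<open>N\<close> and the origin neither singular part has mass, so the absolutely continuous parts
  agree there; and both ignore the null set that was removed.\<close>

lemma ac_part_delta_density:
  fixes h :: "'a::euclidean_space \<Rightarrow> ennreal"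
  assumes [measurable]: "h \<in> borel_measurable borel"
  shows "ac_part (add_measure (return borel 0) (density lborel h)) = density lborel h"
proof -
  let ?\<mu> = "add_measure (return borel (0::'a)) (density lborel h)"
  have em: "emeasure ?\<mu> A = indicator A 0 + emeasure (density lborel h) A" if "A \<in> sets borel" for A
    using that by (subst emeasure_add_measure) auto
  have ex: "lebesgue_decomposition ?\<mu> (density lborel h) (return borel 0)"
    unfolding lebesgue_decomposition_def
  proof (intro conjI)
    show "?\<mu> = add_measure (density lborel h) (return borel 0)"
    proof (rule measure_eqI)
      show "sets ?\<mu> = sets (add_measure (density lborel h) (return borel (0::'a)))" by simp
      fix A assume "A \<in> sets ?\<mu>"
      then have "A \<in> sets borel" by simp
      then show "emeasure ?\<mu> A = emeasure (add_measure (density lborel h) (return borel 0)) A"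
        by (subst em, assumption, subst emeasure_add_measure) (simp_all add: add.commute)
    qed
    show "absolutely_continuous lborel (density lborel h)"
      by (rule absolutely_continuousI_density) simp
    show "\<exists>N\<in>null_sets lborel. emeasure (return borel (0::'a)) (- N) = 0"
      by (intro bexI[of _ "{0}"]) (auto simp: emeasure_return)
  qed simp_all
  have uniq: "\<nu> = density lborel h" if dec: "lebesgue_decomposition ?\<mu> \<nu> \<sigma>" for \<nu> \<sigma>
  proof (rule measure_eqI)
    have s: "sets \<nu> = sets borel" "sets \<sigma> = sets borel" using dec by (auto simp: lebesgue_decomposition_def)
    then show "sets \<nu> = sets (density lborel h)" by simp
    fix A assume "A \<in> sets \<nu>"
    then have A: "A \<in> sets borel" by (simp add: s)
    obtain N where N: "N \<in> null_sets lborel" "emeasure \<sigma> (- N) = 0"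
      using dec by (auto simp: lebesgue_decomposition_def)
    have ac: "absolutely_continuous lborel \<nu>" using dec by (simp add: lebesgue_decomposition_def)
    have "{0::'a} \<in> null_sets lborel" by (simp add: null_sets_def)
    with N have Z: "insert 0 N \<in> null_sets lborel" using null_sets.Un[of "{0}" lborel N] by simp
    let ?N = "insert 0 N"
    have Zb: "?N \<in> sets borel" "N \<in> sets borel" using Z N by (auto simp: null_sets_def)
    have AE_eq: "emeasure \<rho> A = emeasure \<rho> (A - ?N)" if "absolutely_continuous lborel \<rho>" "sets \<rho> = sets borel" for \<rho>
      using that Z A by (intro emeasure_Diff_null_set[symmetric]) (auto simp: absolutely_continuous_def)
    have "emeasure \<nu> A = emeasure \<nu> (A - ?N)" by (rule AE_eq[OF ac s(1)])
    also have "\<dots> = emeasure \<nu> (A - ?N) + emeasure \<sigma> (A - ?N)"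
    proof -
      have "emeasure \<sigma> (A - ?N) \<le> emeasure \<sigma> (- N)" using Zb s A by (intro emeasure_mono) auto
      then show ?thesis using N by simp
    qed
    also have "\<dots> = emeasure (add_measure \<nu> \<sigma>) (A - ?N)"
      using A Zb s by (subst emeasure_add_measure) auto
    also have "add_measure \<nu> \<sigma> = ?\<mu>" using dec by (simp add: lebesgue_decomposition_def)
    also have "emeasure ?\<mu> (A - ?N) = emeasure (density lborel h) (A - ?N)"
      using A Zb by (subst em) auto
    also have "\<dots> = emeasure (density lborel h) A"
      by (rule AE_eq[symmetric]) (auto intro: absolutely_continuousI_density)
    finally show "emeasure \<nu> A = emeasure (density lborel h) A" .
  qed
  show ?thesis
    unfolding ac_part_def
  proof (rule the_equality)
    show "\<exists>\<sigma>. lebesgue_decomposition ?\<mu> (density lborel h) \<sigma>" by (rule exI, rule ex)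
    fix \<nu> assume "\<exists>\<sigma>. lebesgue_decomposition ?\<mu> \<nu> \<sigma>"
    then obtain \<sigma> where "lebesgue_decomposition ?\<mu> \<nu> \<sigma>" ..
    then show "\<nu> = density lborel h" by (rule uniq)
  qed
qed

section \<open>Counting measures and Campbell's formula\<close>

lemma counting_measuresD:
  assumes "M \<in> counting_measures"
  shows "sets M = sets borel" "space M = UNIV"
    "\<And>A. A \<in> sets borel \<Longrightarrow> bounded A \<Longrightarrow> emeasure M A < \<infinity>"
    "\<And>A. A \<in> sets borel \<Longrightarrow> emeasure M A \<in> insert \<infinity> (range of_nat)"
proof -
  show s: "sets M = sets borel" using assms by (auto simp: counting_measures_def locally_finite_def)
  show "space M = UNIV" using sets_eq_imp_space_eq[OF s] by simp
  show "A \<in> sets borel \<Longrightarrow> bounded A \<Longrightarrow> emeasure M A < \<infinity>"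
    "A \<in> sets borel \<Longrightarrow> emeasure M A \<in> insert \<infinity> (range of_nat)" for A
    using assms by (auto simp: counting_measures_def locally_finite_def)
qed

text \<open>The measures of shrinking punctured balls tend to 0 and are integers, so one of them is
  already 0.\<close>

lemma counting_measure_isolated:
  fixes M :: "'a::euclidean_space measure"
  assumes M: "M \<in> counting_measures"
  shows "\<exists>r>0. emeasure M (ball x r - {x}) = 0"
proof -
  note D = counting_measuresD[OF M]
  define A where "A n = ball x (1 / real (Suc n)) - {x}" for n
  have Am: "A n \<in> sets borel" and Ab: "bounded (A n)" for n
    by (auto simp: A_def intro: bounded_subset[OF bounded_ball])
  have "decseq A"
    unfolding A_def decseq_def
    by (intro allI impI Diff_mono subset_refl subset_ball) (simp add: frac_le)
  have "(\<Inter>n. A n) = {}"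
  proof -
    have "y \<notin> (\<Inter>n. A n)" for y
    proof (cases "y = x")
      case False
      then obtain n where "1 / real (Suc n) < dist x y" using nat_approx_posE[of "dist x y"] by auto
      then have "y \<notin> A n" by (simp add: A_def)
      then show ?thesis by auto
    qed (simp add: A_def)
    then show ?thesis by auto
  qed
  moreover have "(\<lambda>n. emeasure M (A n)) \<longlonglongrightarrow> emeasure M (\<Inter>n. A n)"
    using \<open>decseq A\<close> Am D(1) D(3)[OF Am Ab] by (intro Lim_emeasure_decseq) (auto simp: less_top)
  ultimately have "(\<lambda>n. emeasure M (A n)) \<longlonglongrightarrow> 0" by simp
  then have "eventually (\<lambda>n. emeasure M (A n) < 1) sequentially" by (rule order_tendstoD) simp
  then obtain n where n: "emeasure M (A n) < 1" by (auto simp: eventually_sequentially)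
  from D(4)[OF Am, of n] n have "emeasure M (A n) = 0"
    by auto
  then show ?thesis by (intro exI[of _ "1 / real (Suc n)"]) (simp add: A_def)
qed

text \<open>By Lindelof, countably many of the balls with empty punctured part cover the space.
  Their centres form \<open>S\<close>, and the complement of \<open>S\<close> lies in the union of
  the countably many punctured balls, a null set.\<close>

lemma counting_measure_atomic:
  fixes M :: "'a::euclidean_space measure"
  assumes M: "M \<in> counting_measures"
  shows "\<exists>S. countable S \<and> (\<forall>A\<in>sets borel. emeasure M A = emeasure M (A \<inter> S))"
proof -
  note D = counting_measuresD[OF M]
  obtain r where r: "\<And>x. r x > 0" "\<And>x. emeasure M (ball x (r x) - {x}) = 0"
    using counting_measure_isolated[OF M] by metis
  obtain F where F: "F \<subseteq> range (\<lambda>x. ball x (r x))" "countable F" "\<Union>F = \<Union>(range (\<lambda>x. ball x (r x)))"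
    by (rule Lindelof[of "range (\<lambda>x. ball x (r x))"]) auto
  obtain S where S: "countable S" "F = (\<lambda>x. ball x (r x)) ` S"
    using F by (metis countable_subset_image)
  have "\<Union>(range (\<lambda>x. ball x (r x))) = UNIV" using r(1) by auto
  with F S have cov: "(\<Union>x\<in>S. ball x (r x)) = UNIV" by simp
  have "(\<Union>x\<in>S. ball x (r x) - {x}) \<in> null_sets M"
    using r D S by (intro null_sets_UN' null_setsI) auto
  moreover have "- S \<subseteq> (\<Union>x\<in>S. ball x (r x) - {x})"
  proof
    fix y assume y: "y \<in> - S"
    have "y \<in> (\<Union>x\<in>S. ball x (r x))" unfolding cov by simp
    then obtain x where x: "x \<in> S" "y \<in> ball x (r x)" by (rule UN_E)
    moreover have "y \<noteq> x" using x(1) y by auto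
    ultimately show "y \<in> (\<Union>x\<in>S. ball x (r x) - {x})" by (intro UN_I[OF x(1)] DiffI) simp_all
  qed
  moreover have "S \<in> sets borel" by (rule sets.countable[OF _ S(1)]) simp
  ultimately have N: "- S \<in> null_sets M"
  proof -
    assume a: "(\<Union>x\<in>S. ball x (r x) - {x}) \<in> null_sets M" "- S \<subseteq> (\<Union>x\<in>S. ball x (r x) - {x})" "S \<in> sets borel"
    have "- S \<in> sets M" using borel_comp[OF a(3)] D(1) by simp
    then show ?thesis using a by (intro null_sets_subset[OF a(1)])
  qed
  have "emeasure M A = emeasure M (A \<inter> S)" if "A \<in> sets borel" for A
  proof -
    have "emeasure M A = emeasure M (A - (- S))"
      using N that D(1) by (intro emeasure_Diff_null_set[symmetric]) auto
    then show ?thesis by (simp add: Diff_Compl)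
  qed
  with S show ?thesis by auto
qed

text \<open>An atom \<open>x\<close> of mass \<open>m x\<close> receives the labels
  \<open>(x, 0), ..., (x, m x - 1)\<close>; the countable set of all labels is then coded by natural
  numbers. This shows that the choice inside \<open>factorial_power\<close> is satisfiable.\<close>

lemma counting_measure_representation:
  fixes M :: "'a::euclidean_space measure"
  assumes M: "M \<in> counting_measures"
  shows "\<exists>(I :: nat set) x. M = distr (count_space I) borel x"
proof -
  note D = counting_measuresD[OF M]
  obtain S where S: "countable S" "\<And>A. A \<in> sets borel \<Longrightarrow> emeasure M A = emeasure M (A \<inter> S)"
    using counting_measure_atomic[OF M] by blast
  have "\<exists>m. emeasure M {x} = of_nat m" for x
    using D(3,4)[of "{x}"] by auto
  then obtain m :: "'a \<Rightarrow> nat" where m: "\<And>x. emeasure M {x} = of_nat (m x)" by metis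
  define J where "J = Sigma S (\<lambda>x. {..<m x})"
  have cJ: "countable J" unfolding J_def using S by auto
  define I where "I = to_nat_on J ` J"
  have bij: "bij_betw (from_nat_into J) I J"
    unfolding I_def using cJ by (intro bij_betwI[where g = "to_nat_on J"]) auto
  have "M = distr (count_space I) borel (\<lambda>i. fst (from_nat_into J i))"
  proof (rule measure_eqI)
    show "sets M = sets (distr (count_space I) borel (\<lambda>i. fst (from_nat_into J i)))" using D by simp
    fix A assume "A \<in> sets M"
    then have A: "A \<in> sets borel" using D by simp
    have "emeasure (distr (count_space I) borel (\<lambda>i. fst (from_nat_into J i))) A
       = emeasure (count_space I) ((\<lambda>i. fst (from_nat_into J i)) -` A \<inter> I)"
      using A by (subst emeasure_distr) auto
    also have "\<dots> = (\<integral>\<^sup>+i. indicator ((\<lambda>i. fst (from_nat_into J i)) -` A \<inter> I) i \<partial>count_space I)"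
      by simp
    also have "\<dots> = (\<integral>\<^sup>+i. indicator A (fst (from_nat_into J i)) \<partial>count_space I)"
      by (intro nn_integral_cong) (auto split: split_indicator)
    also have "\<dots> = (\<integral>\<^sup>+j. indicator A (fst j) \<partial>count_space J)"
      by (rule nn_integral_bij_count_space[OF bij])
    also have "\<dots> = (\<integral>\<^sup>+j. indicator {j\<in>J. fst j \<in> A} j \<partial>count_space J)"
      by (intro nn_integral_cong) (auto split: split_indicator)
    also have "\<dots> = emeasure (count_space J) {j\<in>J. fst j \<in> A}" by simp
    also have "{j\<in>J. fst j \<in> A} = (\<Union>x\<in>A \<inter> S. {x} \<times> {..<m x})" unfolding J_def by auto
    also have "emeasure (count_space J) \<dots> = (\<integral>\<^sup>+x. emeasure (count_space J) ({x} \<times> {..<m x}) \<partial>count_space (A \<inter> S))"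
      using S by (intro emeasure_UN_countable) (auto simp: disjoint_family_on_def J_def)
    also have "\<dots> = (\<integral>\<^sup>+x. emeasure M {x} \<partial>count_space (A \<inter> S))"
    proof (intro nn_integral_cong)
      fix x assume "x \<in> space (count_space (A \<inter> S))"
      then have "{x} \<times> {..<m x} \<subseteq> J" by (auto simp: J_def)
      then have "emeasure (count_space J) ({x} \<times> {..<m x}) = of_nat (card ({x} \<times> {..<m x}))"
        by (subst emeasure_count_space_finite) auto
      then show "emeasure (count_space J) ({x} \<times> {..<m x}) = emeasure M {x}" by (simp add: m)
    qed
    also have "\<dots> = emeasure M (A \<inter> S)"
      using S D by (intro emeasure_countable_singleton[symmetric]) auto
    finally show "emeasure M A = emeasure (distr (count_space I) borel (\<lambda>i. fst (from_nat_into J i))) A"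
      using S(2)[OF A] by simp
  qed
  then show ?thesis by blast
qed

text \<open>The very choice made inside \<open>factorial_power\<close>, under a name of its own, so
  that statements about different tuple lengths refer to the same labelling.\<close>

definition enumeration :: "'a::euclidean_space measure \<Rightarrow> nat set \<times> (nat \<Rightarrow> 'a)" where
  "enumeration M = (SOME (I, x). M = distr (count_space I) borel x)"

abbreviation "idx M \<equiv> fst (enumeration M)"
abbreviation "pos M \<equiv> snd (enumeration M)"

lemma counting_measure_distr:
  assumes "M \<in> counting_measures"
  shows "M = distr (count_space (idx M)) borel (pos M)"
proof -
  obtain I :: "nat set" and x where "M = distr (count_space I) borel x"
    using counting_measure_representation[OF assms] by blast
  then have "case (I, x) of (I, x) \<Rightarrow> M = distr (count_space I) borel x" by simp
  then have "case enumeration M of (I, x) \<Rightarrow> M = distr (count_space I) borel x"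
    unfolding enumeration_def by (rule someI)
  then show ?thesis by (simp add: case_prod_beta)
qed

lemma nn_integral_counting_measure:
  assumes "M \<in> counting_measures" "f \<in> borel_measurable borel"
  shows "(\<integral>\<^sup>+x. f x \<partial>M) = (\<integral>\<^sup>+i. f (pos M i) \<partial>count_space (idx M))"
  by (subst counting_measure_distr[OF assms(1)], subst nn_integral_distr) (use assms in auto)

lemma sets_factorial_power [simp]: "sets (factorial_power k M) = sets (\<Pi>\<^sub>M i\<in>{..<k}. borel)"
  by (simp add: factorial_power_def Let_def case_prod_beta)

text \<open>The distinctness of the indices sits in the integrand, so that iterated sums apply.\<close>

definition tuple_sum :: "nat \<Rightarrow> 'a::euclidean_space measure \<Rightarrow> ((nat \<Rightarrow> 'a) \<Rightarrow> ennreal) \<Rightarrow> ennreal" where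
  "tuple_sum k M h = (\<integral>\<^sup>+j. indicator {j. inj_on j {..<k}} j * h (\<lambda>i\<in>{..<k}. pos M (j i))
     \<partial>count_space (PiE {..<k} (\<lambda>_. idx M)))"

lemma nn_integral_factorial_power:
  fixes M :: "'a::euclidean_space measure"
  assumes h: "h \<in> borel_measurable (\<Pi>\<^sub>M i\<in>{..<k}. borel)"
  shows "(\<integral>\<^sup>+x. h x \<partial>factorial_power k M) = tuple_sum k M h"
proof -
  let ?J = "{j \<in> {..<k} \<rightarrow>\<^sub>E idx M. inj_on j {..<k}}"
  have "factorial_power k M = distr (count_space ?J) (\<Pi>\<^sub>M i\<in>{..<k}. borel) (\<lambda>j. \<lambda>i\<in>{..<k}. pos M (j i))"
    by (simp add: factorial_power_def enumeration_def Let_def case_prod_beta)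
  then have "(\<integral>\<^sup>+x. h x \<partial>factorial_power k M) = (\<integral>\<^sup>+j. h (\<lambda>i\<in>{..<k}. pos M (j i)) \<partial>count_space ?J)"
    using h by (simp, subst nn_integral_distr) (auto simp: space_PiM)
  also have "\<dots> = (\<integral>\<^sup>+j. h (\<lambda>i\<in>{..<k}. pos M (j i)) * indicator ?J j \<partial>count_space UNIV)"
    by (rule nn_integral_count_space_indicator) simp
  also have "\<dots> = (\<integral>\<^sup>+j. (indicator {j. inj_on j {..<k}} j * h (\<lambda>i\<in>{..<k}. pos M (j i))) * indicator (PiE {..<k} (\<lambda>_. idx M)) j \<partial>count_space UNIV)"
    by (intro nn_integral_cong) (auto split: split_indicator)
  also have "\<dots> = tuple_sum k M h"
    unfolding tuple_sum_def by (rule nn_integral_count_space_indicator[symmetric]) simp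
  finally show ?thesis .
qed

lemma nn_integral_count_space_PiE:
  fixes I :: "nat set"
  shows "(\<integral>\<^sup>+j. f j \<partial>count_space (PiE {..<Suc k} (\<lambda>_. I)))
    = (\<integral>\<^sup>+j. \<integral>\<^sup>+i. f (j(k := i)) \<partial>count_space I \<partial>count_space (PiE {..<k} (\<lambda>_. I)))"
proof -
  interpret product_sigma_finite "\<lambda>_::nat. count_space I"
    unfolding product_sigma_finite_def by (intro allI sigma_finite_measure_count_space_countable) simp
  have P: "count_space (PiE A (\<lambda>_. I)) = PiM A (\<lambda>_. count_space I)" if "finite A" for A :: "nat set"
    using that by (intro count_space_PiM_finite[symmetric]) auto
  have "f \<in> borel_measurable (PiM (insert k {..<k}) (\<lambda>_. count_space I))"
    by (subst P[symmetric]) auto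
  then show ?thesis
    by (simp only: lessThan_Suc P finite_insert finite_lessThan) (rule product_nn_integral_insert; simp)
qed

lemma nn_integral_count_space_PiE_0:
  fixes I :: "nat set"
  shows "(\<integral>\<^sup>+j. f j \<partial>count_space (PiE {..<0::nat} (\<lambda>_. I))) = f (\<lambda>_. undefined)"
  by (simp add: nn_integral_count_space_finite)

lemma inj_on_fun_upd_lessThan:
  "inj_on (j(k := i)) {..<Suc k} \<longleftrightarrow> inj_on j {..<k} \<and> i \<notin> j ` {..<k}"
  by (auto simp: lessThan_Suc inj_on_def)

lemma tuple_sum_Suc:
  "tuple_sum (Suc k) M h = (\<integral>\<^sup>+j. indicator {j. inj_on j {..<k}} j *
     (\<integral>\<^sup>+i. indicator (- j ` {..<k}) i * h ((\<lambda>l\<in>{..<k}. pos M (j l))(k := pos M i)) \<partial>count_space (idx M))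
     \<partial>count_space (PiE {..<k} (\<lambda>_. idx M)))"
proof -
  have e: "(\<lambda>l\<in>{..<Suc k}. pos M ((j(k := i)) l)) = (\<lambda>l\<in>{..<k}. pos M (j l))(k := pos M i)" for j i
    by (auto simp: fun_eq_iff restrict_def)
  show ?thesis
    unfolding tuple_sum_def nn_integral_count_space_PiE e
  proof (rule nn_integral_cong)
    fix j :: "nat \<Rightarrow> nat"
    let ?h = "\<lambda>i. h ((\<lambda>l\<in>{..<k}. pos M (j l))(k := pos M i))"
    have "(\<integral>\<^sup>+i. indicator {j. inj_on j {..<Suc k}} (j(k := i)) * ?h i \<partial>count_space (idx M))
      = (\<integral>\<^sup>+i. indicator {j. inj_on j {..<k}} j * (indicator (- j ` {..<k}) i * ?h i) \<partial>count_space (idx M))"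
      by (rule nn_integral_cong) (simp add: inj_on_fun_upd_lessThan indicator_def del: fun_upd_apply)
    also have "\<dots> = indicator {j. inj_on j {..<k}} j * (\<integral>\<^sup>+i. indicator (- j ` {..<k}) i * ?h i \<partial>count_space (idx M))"
      by (rule nn_integral_cmult) simp
    finally show "(\<integral>\<^sup>+i. indicator {j. inj_on j {..<Suc k}} (j(k := i)) * ?h i \<partial>count_space (idx M)) = \<dots>" .
  qed
qed

text \<open>Excluding finitely many indices becomes a subtraction, which in \<open>ennreal\<close>
  is meaningful because the removed terms are finite.\<close>

lemma nn_integral_count_space_remove:
  fixes f :: "nat \<Rightarrow> ennreal"
  assumes R: "finite R" "R \<subseteq> I" and f: "\<And>i. i \<in> R \<Longrightarrow> f i < \<infinity>"
  shows "(\<integral>\<^sup>+i. indicator (- R) i * f i \<partial>count_space I) = (\<integral>\<^sup>+i. f i \<partial>count_space I) - (\<Sum>i\<in>R. f i)"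
proof -
  have "(\<integral>\<^sup>+i. f i \<partial>count_space I) = (\<integral>\<^sup>+i. indicator (- R) i * f i + indicator R i * f i \<partial>count_space I)"
    by (intro nn_integral_cong) (auto split: split_indicator)
  also have "\<dots> = (\<integral>\<^sup>+i. indicator (- R) i * f i \<partial>count_space I) + (\<integral>\<^sup>+i. indicator R i * f i \<partial>count_space I)"
    by (rule nn_integral_add) auto
  also have "(\<integral>\<^sup>+i. indicator R i * f i \<partial>count_space I) = (\<Sum>i\<in>R. indicator R i * f i)"
    using R by (intro nn_integral_count_space') auto
  also have "\<dots> = (\<Sum>i\<in>R. f i)" by (intro sum.cong) auto
  finally have e: "(\<integral>\<^sup>+i. f i \<partial>count_space I)
    = (\<integral>\<^sup>+i. indicator (- R) i * f i \<partial>count_space I) + (\<Sum>i\<in>R. f i)" .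
  have "(\<Sum>i\<in>R. f i) < \<infinity>" using f R(1) by simp
  then show ?thesis unfolding e by (simp add: less_top)
qed

text \<open>Library results on measurable kernels concern subprobability measures. Restricting
  \<open>N q\<close> to the ball \<open>B n\<close> and dividing by \<open>c n q\<close> gives such
  a kernel; the integral is recovered by undoing the normalisation and letting the balls exhaust the
  space.\<close>

lemma measurable_nn_integral_counting_kernel:
  fixes N :: "'q \<Rightarrow> 'a::euclidean_space measure"
  assumes N: "\<And>q. q \<in> space Q \<Longrightarrow> N q \<in> counting_measures"
    and mN: "\<And>A. A \<in> sets borel \<Longrightarrow> (\<lambda>q. emeasure (N q) A) \<in> borel_measurable Q"
    and f[measurable]: "(\<lambda>(q, y). f q y) \<in> borel_measurable (Q \<Otimes>\<^sub>M borel)"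
  shows "(\<lambda>q. \<integral>\<^sup>+y. f q y \<partial>N q) \<in> borel_measurable Q"
proof -
  note D = counting_measuresD[OF N]
  define B where "B n = ball (0::'a) (real n)" for n
  have [measurable]: "B n \<in> sets borel" for n by (simp add: B_def)
  \<comment> \<open>The summand 1 keeps the normalising constant away from 0 when the ball contains
    no points.\<close>
  define c where "c n q = 1 + emeasure (N q) (B n)" for n q
  have c: "c n q < \<infinity>" "c n q \<noteq> 0" if "q \<in> space Q" for n q
    using D(3)[OF that, of "B n"] by (auto simp: c_def B_def)
  have mc[measurable]: "c n \<in> borel_measurable Q" for n
    unfolding c_def using mN[of "B n"] by measurable
  define L where "L n q = density (N q) (\<lambda>y. indicator (B n) y / c n q)" for n q
  have mf: "f q \<in> borel_measurable (N q)" if "q \<in> space Q" for q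
    using measurable_Pair2[OF f that] D(1)[OF that] by (simp cong: measurable_cong_sets)
  have mb: "(\<lambda>y. indicator (B n) y / c n q) \<in> borel_measurable (N q)" if "q \<in> space Q" for n q
    using D(1)[OF that] by (simp cong: measurable_cong_sets)
  have eL: "emeasure (L n q) A = emeasure (N q) (A \<inter> B n) / c n q" if "q \<in> space Q" "A \<in> sets borel" for n q A
  proof -
    have "emeasure (L n q) A = (\<integral>\<^sup>+y. indicator (B n) y / c n q * indicator A y \<partial>N q)"
      unfolding L_def using mb[OF that(1)] that D(1) by (subst emeasure_density) auto
    also have "\<dots> = (\<integral>\<^sup>+y. indicator (A \<inter> B n) y / c n q \<partial>N q)"
      by (intro nn_integral_cong) (auto split: split_indicator)
    also have "\<dots> = emeasure (N q) (A \<inter> B n) / c n q"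
      using that D(1)[OF that(1)] by (subst nn_integral_divide) auto
    finally show ?thesis .
  qed
  have mL: "L n \<in> Q \<rightarrow>\<^sub>M subprob_algebra borel" for n
  proof (rule measurable_subprob_algebra)
    fix q assume q: "q \<in> space Q"
    show "sets (L n q) = sets borel" unfolding L_def using D(1)[OF q] by simp
    show "subprob_space (L n q)"
    proof
      have "emeasure (N q) (B n) / c n q \<le> 1"
        using c[OF q, of n] by (intro divide_le_posI_ennreal) (auto simp: c_def zero_less_iff_neq_zero)
      then show "emeasure (L n q) (space (L n q)) \<le> 1"
        using eL[OF q, of UNIV n] D(2)[OF q] by (simp add: L_def)
      show "space (L n q) \<noteq> {}" using D(2)[OF q] by (simp add: L_def)
    qed
  next
    fix A :: "'a set" assume A: "A \<in> sets borel"
    have "(\<lambda>q. emeasure (N q) (A \<inter> B n) / c n q) \<in> borel_measurable Q"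
      using mN[of "A \<inter> B n"] A by measurable
    then show "(\<lambda>q. emeasure (L n q) A) \<in> borel_measurable Q"
      using eL[OF _ A] by (simp cong: measurable_cong)
  qed
  have eq: "(\<integral>\<^sup>+y. f q y \<partial>N q) = (SUP n. c n q * (\<integral>\<^sup>+y. f q y \<partial>L n q))" if q: "q \<in> space Q" for q
  proof -
    have "c n q * (\<integral>\<^sup>+y. f q y \<partial>L n q) = (\<integral>\<^sup>+y. f q y * indicator (B n) y \<partial>N q)" for n
    proof -
      have "(\<integral>\<^sup>+y. f q y \<partial>L n q) = (\<integral>\<^sup>+y. indicator (B n) y / c n q * f q y \<partial>N q)"
        unfolding L_def using mb[OF q] mf[OF q] by (subst nn_integral_density) auto
      also have "\<dots> = (\<integral>\<^sup>+y. f q y * indicator (B n) y / c n q \<partial>N q)"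
        by (simp add: divide_ennreal_def mult_ac)
      also have "\<dots> = (\<integral>\<^sup>+y. f q y * indicator (B n) y \<partial>N q) / c n q"
        using mf[OF q] D(1)[OF q] by (intro nn_integral_divide) auto
      finally show ?thesis
        using c[OF q, of n] by (simp add: ennreal_times_divide mult_divide_eq_ennreal mult.commute[of "c n q"] less_top)
    qed
    moreover have "(SUP n. \<integral>\<^sup>+y. f q y * indicator (B n) y \<partial>N q) = (\<integral>\<^sup>+y. (SUP n. f q y * indicator (B n) y) \<partial>N q)"
    proof (rule nn_integral_monotone_convergence_SUP[symmetric])
      show "incseq (\<lambda>n y. f q y * indicator (B n) y)"
        by (auto simp: incseq_def le_fun_def B_def split: split_indicator)
      show "(\<lambda>y. f q y * indicator (B n) y) \<in> borel_measurable (N q)" for n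
        using mf[OF q] D(1)[OF q] by auto
    qed
    moreover have "(SUP n. f q y * indicator (B n) y) = f q y" for y
    proof (rule antisym)
      show "(SUP n. f q y * indicator (B n) y) \<le> f q y" by (intro SUP_least) (auto split: split_indicator)
      obtain n where "norm y < real n" using reals_Archimedean2 by blast
      then have "f q y = f q y * indicator (B n) y" by (simp add: B_def)
      also have "\<dots> \<le> (SUP n. f q y * indicator (B n) y)" by (rule SUP_upper) simp
      finally show "f q y \<le> (SUP n. f q y * indicator (B n) y)" .
    qed
    ultimately show ?thesis by simp
  qed
  have "(\<lambda>q. \<integral>\<^sup>+y. f q y \<partial>L n q) \<in> borel_measurable Q" for n
    by (rule nn_integral_measurable_subprob_algebra2[OF f mL])
  then have "(\<lambda>q. SUP n. c n q * (\<integral>\<^sup>+y. f q y \<partial>L n q)) \<in> borel_measurable Q" by measurable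
  then show ?thesis using eq by (simp cong: measurable_cong)
qed

lemma space_counting_space: "space counting_space = counting_measures"
  unfolding counting_space_def by (rule space_measure_of) auto

lemma measurable_emeasure_counting:
  assumes A: "A \<in> sets borel"
  shows "(\<lambda>M. emeasure M A) \<in> borel_measurable counting_space"
proof (rule measurableI)
  fix B :: "ennreal set" assume B: "B \<in> sets borel"
  have "(\<lambda>M. emeasure M A) -` B \<inter> space counting_space = {M \<in> counting_measures. emeasure M A \<in> B}"
    by (auto simp: space_counting_space)
  also have "\<dots> \<in> sets counting_space"
    unfolding counting_space_def using A B by (subst sets_measure_of) (auto intro!: sigma_sets.Basic)
  finally show "(\<lambda>M. emeasure M A) -` B \<inter> space counting_space \<in> sets counting_space" .
qed simp

lemma measurable_fun_upd_comp:
  assumes h: "(\<lambda>(w, x). h w x) \<in> borel_measurable (P \<Otimes>\<^sub>M (\<Pi>\<^sub>M i\<in>{..<Suc k}. borel))"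
    and f: "f \<in> Q \<rightarrow>\<^sub>M P" and g: "g \<in> Q \<rightarrow>\<^sub>M (\<Pi>\<^sub>M i\<in>{..<k}. borel)" and y: "y \<in> borel_measurable Q"
  shows "(\<lambda>q. h (f q) ((g q)(k := y q))) \<in> borel_measurable Q"
proof -
  have "(\<lambda>q. (\<lambda>(f, y). f(k := y)) (g q, y q)) \<in> Q \<rightarrow>\<^sub>M (\<Pi>\<^sub>M i\<in>insert k {..<k}. borel)"
    by (rule measurable_compose[OF measurable_Pair[OF g y] measurable_add_dim])
  from measurable_compose[OF measurable_Pair[OF f this] h[unfolded lessThan_Suc]] show ?thesis by simp
qed

locale counting_process = prob_space P for P :: "'w measure" +
  fixes \<omega> :: "'w \<Rightarrow> 'a::euclidean_space measure"
  assumes \<omega>_measurable: "\<omega> \<in> P \<rightarrow>\<^sub>M counting_space"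
begin

lemma \<omega>_counting: "w \<in> space P \<Longrightarrow> \<omega> w \<in> counting_measures"
  using measurable_space[OF \<omega>_measurable] by (simp add: space_counting_space)

lemma emeasure_\<omega>_measurable: "A \<in> sets borel \<Longrightarrow> (\<lambda>w. emeasure (\<omega> w) A) \<in> borel_measurable P"
  using measurable_compose[OF \<omega>_measurable measurable_emeasure_counting] .

lemma nn_integral_\<omega>_measurable:
  assumes f: "(\<lambda>(w, y). f w y) \<in> borel_measurable (P \<Otimes>\<^sub>M borel)"
  shows "(\<lambda>w. \<integral>\<^sup>+y. f w y \<partial>\<omega> w) \<in> borel_measurable P"
  using \<omega>_counting emeasure_\<omega>_measurable f by (rule measurable_nn_integral_counting_kernel)

lemma tuple_sum_Suc_eq:
  assumes w: "w \<in> space P"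
    and m: "\<And>x. x \<in> space (\<Pi>\<^sub>M i\<in>{..<k}. borel) \<Longrightarrow> (\<lambda>y. h (x(k := y))) \<in> borel_measurable borel"
    and fin: "\<And>x. h x < \<infinity>"
  shows "tuple_sum (Suc k) (\<omega> w) h
    = tuple_sum k (\<omega> w) (\<lambda>x. (\<integral>\<^sup>+y. h (x(k := y)) \<partial>\<omega> w) - (\<Sum>l<k. h (x(k := x l))))"
  unfolding tuple_sum_Suc unfolding tuple_sum_def
proof (rule nn_integral_cong)
  fix j assume "j \<in> space (count_space (PiE {..<k} (\<lambda>_. idx (\<omega> w))))"
  then have j: "j \<in> PiE {..<k} (\<lambda>_. idx (\<omega> w))" by simp
  let ?x = "\<lambda>l\<in>{..<k}. pos (\<omega> w) (j l)"
  let ?L = "\<integral>\<^sup>+i. indicator (- j ` {..<k}) i * h (?x(k := pos (\<omega> w) i)) \<partial>count_space (idx (\<omega> w))"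
  let ?R = "(\<integral>\<^sup>+y. h (?x(k := y)) \<partial>\<omega> w) - (\<Sum>l<k. h (?x(k := ?x l)))"
  have "?L = ?R" if inj: "inj_on j {..<k}"
  proof -
    have "?L = (\<integral>\<^sup>+i. h (?x(k := pos (\<omega> w) i)) \<partial>count_space (idx (\<omega> w))) - (\<Sum>i\<in>j ` {..<k}. h (?x(k := pos (\<omega> w) i)))"
      using j fin by (intro nn_integral_count_space_remove) (auto simp: PiE_def Pi_def)
    also have "(\<Sum>i\<in>j ` {..<k}. h (?x(k := pos (\<omega> w) i))) = (\<Sum>l<k. h (?x(k := pos (\<omega> w) (j l))))"
      using inj by (simp add: sum.reindex)
    also have "\<dots> = (\<Sum>l<k. h (?x(k := ?x l)))" by (intro sum.cong) auto
    also have "(\<integral>\<^sup>+i. h (?x(k := pos (\<omega> w) i)) \<partial>count_space (idx (\<omega> w))) = (\<integral>\<^sup>+y. h (?x(k := y)) \<partial>\<omega> w)"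
      by (rule nn_integral_counting_measure[symmetric, OF \<omega>_counting[OF w] m]) (simp add: space_PiM)
    finally show ?thesis .
  qed
  then show "indicator {j. inj_on j {..<k}} j * ?L = indicator {j. inj_on j {..<k}} j * ?R"
    by (cases "inj_on j {..<k}") simp_all
qed

text \<open>Induction on the tuple length by \<open>tuple_sum_Suc_eq\<close>. Integrating out a
  point makes the summand depend on \<open>w\<close> and multiplies its bound by the random mass of
  the ball, which is why both \<open>h\<close> and \<open>c\<close> carry the argument
  \<open>w\<close>. Bounded support keeps all terms finite, as the subtraction requires.\<close>

lemma tuple_sum_measurable_aux:
  assumes "(\<lambda>(w, x). h w x) \<in> borel_measurable (P \<Otimes>\<^sub>M (\<Pi>\<^sub>M i\<in>{..<k}. borel))"
    and "\<And>w. c w < \<infinity>"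
    and "\<And>w x. h w x \<le> c w * indicator {x. \<forall>i<k. x i \<in> ball 0 r} x"
  shows "(\<lambda>w. tuple_sum k (\<omega> w) (h w)) \<in> borel_measurable P"
  using assms
proof (induction k arbitrary: h c)
  case 0
  have "tuple_sum 0 M f = f (\<lambda>_. undefined)" for M :: "'a measure" and f
    unfolding tuple_sum_def nn_integral_count_space_PiE_0 by (simp add: restrict_def)
  moreover have "(\<lambda>w. h w (\<lambda>_. undefined)) \<in> borel_measurable P"
  proof -
    have u: "(\<lambda>_. undefined) \<in> space (\<Pi>\<^sub>M i\<in>{..<0::nat}. borel :: 'a measure)" by (simp add: space_PiM)
    show ?thesis using measurable_compose[OF measurable_Pair2'[OF u] 0(1)] by simp
  qed
  ultimately show ?case by simp
next
  case (Suc k)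
  let ?N = "\<Pi>\<^sub>M i\<in>{..<k}. borel :: 'a measure"
  note upd = measurable_fun_upd_comp[OF Suc.prems(1)]
  \<comment> \<open>The value 0 outside \<open>space P\<close> makes the bounds of the induction
    hypothesis hold for every \<open>w\<close>, since counting measures are only guaranteed inside
    the space.\<close>
  define h' where "h' w x = (if w \<in> space P then (\<integral>\<^sup>+y. h w (x(k := y)) \<partial>\<omega> w) - (\<Sum>l<k. h w (x(k := x l))) else 0)" for w x
  define c' where "c' w = (if w \<in> space P then c w * emeasure (\<omega> w) (ball 0 r) else 0)" for w
  have fin: "h w x < \<infinity>" for w x
  proof -
    have "h w x \<le> c w * indicator {x. \<forall>i<Suc k. x i \<in> ball 0 r} x" by (rule Suc.prems(3))
    also have "\<dots> \<le> c w" by (auto split: split_indicator)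
    also have "\<dots> < \<infinity>" by (rule Suc.prems(2))
    finally show ?thesis .
  qed
  have "(\<lambda>w. tuple_sum k (\<omega> w) (h' w)) \<in> borel_measurable P"
  proof (rule Suc.IH[of h' c'])
    show "c' w < \<infinity>" for w
      using counting_measuresD(3)[OF \<omega>_counting, of w "ball 0 r"] Suc.prems(2)[of w]
      by (simp add: c'_def ennreal_mult_less_top)
    show "h' w x \<le> c' w * indicator {x. \<forall>i<k. x i \<in> ball 0 r} x" for w x
    proof (cases "w \<in> space P")
      case True
      have s: "ball 0 r \<in> sets (\<omega> w)" using counting_measuresD(1)[OF \<omega>_counting[OF True]] by simp
      have "h' w x \<le> (\<integral>\<^sup>+y. h w (x(k := y)) \<partial>\<omega> w)" using True by (simp add: h'_def diff_le_self_ennreal)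
      also have "\<dots> \<le> (\<integral>\<^sup>+y. (c w * indicator {x. \<forall>i<k. x i \<in> ball 0 r} x) * indicator (ball 0 r) y \<partial>\<omega> w)"
      proof (rule nn_integral_mono)
        fix y
        have "h w (x(k := y)) \<le> c w * indicator {x. \<forall>i<Suc k. x i \<in> ball 0 r} (x(k := y))" by (rule Suc.prems(3))
        also have "\<dots> \<le> (c w * indicator {x. \<forall>i<k. x i \<in> ball 0 r} x) * indicator (ball 0 r) y"
        proof (cases "\<forall>i<Suc k. (x(k := y)) i \<in> ball 0 r")
          case True
          have "y \<in> ball 0 r" using True[rule_format, of k] by simp
          moreover have "\<forall>i<k. x i \<in> ball 0 r"
          proof (intro allI impI)
            fix i assume "i < k" then show "x i \<in> ball 0 r" using True[rule_format, of i] by simp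
          qed
          ultimately show ?thesis by (simp add: indicator_def)
        next
          case False
          then show ?thesis by (simp only: indicator_simps mem_Collect_eq not_False_eq_True mult_zero_right zero_le)
        qed
        finally show "h w (x(k := y)) \<le> (c w * indicator {x. \<forall>i<k. x i \<in> ball 0 r} x) * indicator (ball 0 r) y" .
      qed
      also have "\<dots> = c' w * indicator {x. \<forall>i<k. x i \<in> ball 0 r} x"
        using True s by (subst nn_integral_cmult) (simp_all add: c'_def mult_ac)
      finally show ?thesis .
    next
      case False then show ?thesis by (simp add: h'_def)
    qed
    have "(\<lambda>q. (\<integral>\<^sup>+y. h (fst q) ((snd q)(k := y)) \<partial>\<omega> (fst q))) \<in> borel_measurable (P \<Otimes>\<^sub>M ?N)"
    proof (rule measurable_nn_integral_counting_kernel)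
      show "\<omega> (fst q) \<in> counting_measures" if "q \<in> space (P \<Otimes>\<^sub>M ?N)" for q
        using that by (intro \<omega>_counting) (auto simp: space_pair_measure)
      show "(\<lambda>q. emeasure (\<omega> (fst q)) A) \<in> borel_measurable (P \<Otimes>\<^sub>M ?N)" if "A \<in> sets borel" for A
        using measurable_compose[OF measurable_fst emeasure_\<omega>_measurable[OF that]] .
      have "(\<lambda>q. h (fst (fst q)) ((snd (fst q))(k := snd q))) \<in> borel_measurable ((P \<Otimes>\<^sub>M ?N) \<Otimes>\<^sub>M borel)"
        by (rule upd) measurable
      then show "(\<lambda>(q, y). h (fst q) ((snd q)(k := y))) \<in> borel_measurable ((P \<Otimes>\<^sub>M ?N) \<Otimes>\<^sub>M borel)"
        by (simp add: case_prod_beta)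
    qed
    moreover have "(\<lambda>q. h (fst q) ((snd q)(k := snd q l))) \<in> borel_measurable (P \<Otimes>\<^sub>M ?N)" if "l \<in> {..<k}" for l
    proof (rule upd)
      show "(\<lambda>q. snd q l) \<in> borel_measurable (P \<Otimes>\<^sub>M ?N)"
        using measurable_compose[OF measurable_snd measurable_component_singleton[OF that]] .
    qed measurable
    ultimately have "(\<lambda>q. (\<integral>\<^sup>+y. h (fst q) ((snd q)(k := y)) \<partial>\<omega> (fst q)) - (\<Sum>l<k. h (fst q) ((snd q)(k := snd q l))))
      \<in> borel_measurable (P \<Otimes>\<^sub>M ?N)"
      by (intro borel_measurable_minus_ennreal borel_measurable_sum) auto
    also have "?this \<longleftrightarrow> (\<lambda>(w, x). h' w x) \<in> borel_measurable (P \<Otimes>\<^sub>M ?N)"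
      by (intro measurable_cong) (auto simp: h'_def space_pair_measure)
    finally show "(\<lambda>(w, x). h' w x) \<in> borel_measurable (P \<Otimes>\<^sub>M ?N)" .
  qed
  also have "?this \<longleftrightarrow> (\<lambda>w. tuple_sum (Suc k) (\<omega> w) (h w)) \<in> borel_measurable P"
  proof (rule measurable_cong)
    fix w assume w: "w \<in> space P"
    have "tuple_sum (Suc k) (\<omega> w) (h w)
      = tuple_sum k (\<omega> w) (\<lambda>x. (\<integral>\<^sup>+y. h w (x(k := y)) \<partial>\<omega> w) - (\<Sum>l<k. h w (x(k := x l))))"
      by (rule tuple_sum_Suc_eq[OF w _ fin], rule upd) (use w in auto)
    moreover have "h' w = (\<lambda>x. (\<integral>\<^sup>+y. h w (x(k := y)) \<partial>\<omega> w) - (\<Sum>l<k. h w (x(k := x l))))"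
      using w by (simp add: fun_eq_iff h'_def)
    ultimately show "tuple_sum k (\<omega> w) (h' w) = tuple_sum (Suc k) (\<omega> w) (h w)"
      by simp
  qed
  finally show ?case .
qed

text \<open>Truncation to products of balls supplies the bounded support that the induction demands;
  the truncated values increase to the full one.\<close>

lemma emeasure_factorial_power_measurable:
  assumes A: "A \<in> sets (\<Pi>\<^sub>M i\<in>{..<k}. borel)"
  shows "(\<lambda>w. emeasure (factorial_power k (\<omega> w)) A) \<in> borel_measurable P"
proof -
  define B :: "nat \<Rightarrow> (nat \<Rightarrow> 'a) set" where "B n = PiE {..<k} (\<lambda>_. ball 0 (real n))" for n
  have B: "B n \<in> sets (\<Pi>\<^sub>M i\<in>{..<k}. borel)" for n unfolding B_def by (intro sets_PiM_I_finite) auto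
  have "(\<lambda>w. tuple_sum k (\<omega> w) (indicator (A \<inter> B n))) \<in> borel_measurable P" for n
  proof (rule tuple_sum_measurable_aux[where c = "\<lambda>_. 1" and r = "real n"])
    show "(\<lambda>(w, x). indicator (A \<inter> B n) x :: ennreal) \<in> borel_measurable (P \<Otimes>\<^sub>M (\<Pi>\<^sub>M i\<in>{..<k}. borel))"
      using A B by measurable
    show "indicator (A \<inter> B n) x \<le> (1::ennreal) * indicator {x. \<forall>i<k. x i \<in> ball 0 (real n)} x" for x
      unfolding mult_1
    proof (rule indicator_leI)
      assume "x \<in> A \<inter> B n"
      then show "x \<in> {x. \<forall>i<k. x i \<in> ball 0 (real n)}" unfolding B_def PiE_def Pi_def by blast
    qed
  qed simp
  moreover have "tuple_sum k M (indicator (A \<inter> B n)) = emeasure (factorial_power k M) (A \<inter> B n)" for n and M :: "'a measure"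
    using A B by (subst nn_integral_factorial_power[symmetric]) auto
  ultimately have "(\<lambda>w. SUP n. emeasure (factorial_power k (\<omega> w)) (A \<inter> B n)) \<in> borel_measurable P"
    by simp
  moreover have "(SUP n. emeasure (factorial_power k M) (A \<inter> B n)) = emeasure (factorial_power k M) A" for M :: "'a measure"
  proof -
    have "incseq (\<lambda>n. A \<inter> B n)"
      unfolding incseq_def B_def by (intro allI impI Int_mono subset_refl PiE_mono subset_ball) simp
    then have "(SUP n. emeasure (factorial_power k M) (A \<inter> B n)) = emeasure (factorial_power k M) (\<Union>n. A \<inter> B n)"
      using A B by (intro SUP_emeasure_incseq) auto
    also have "(\<Union>n. A \<inter> B n) = A"
    proof (intro equalityI subsetI)
      fix x assume x: "x \<in> A"
      then have e: "x \<in> extensional {..<k}" using sets.sets_into_space[OF A] by (auto simp: space_PiM PiE_def)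
      obtain n where n: "(\<Sum>i<k. norm (x i)) < real n" using reals_Archimedean2 by blast
      have "norm (x i) < real n" if "i < k" for i
        using member_le_sum[of i "{..<k}" "\<lambda>i. norm (x i)"] that n by simp
      then have "x \<in> B n" using e by (simp add: B_def PiE_def Pi_def)
      with x show "x \<in> (\<Union>n. A \<inter> B n)" by blast
    qed blast
    finally show ?thesis .
  qed
  ultimately show ?thesis by simp
qed

text \<open>\<open>measure_of\<close> returns the prescribed values only for a countably additive
  set function. Exchanging the sum with the expectation is where the measurability just obtained
  enters.\<close>

lemma emeasure_factorial_moment_measure:
  assumes A: "A \<in> sets (\<Pi>\<^sub>M i\<in>{..<k}. borel)"
  shows "emeasure (factorial_moment_measure P \<omega> k) A = (\<integral>\<^sup>+w. emeasure (factorial_power k (\<omega> w)) A \<partial>P)"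
  unfolding factorial_moment_measure_def
proof (rule emeasure_measure_of_sigma[OF sets.sigma_algebra_axioms _ _ A])
  let ?S = "sets (\<Pi>\<^sub>M i\<in>{..<k}. borel :: 'a measure)"
  show "positive ?S (\<lambda>A. \<integral>\<^sup>+w. emeasure (factorial_power k (\<omega> w)) A \<partial>P)"
    by (simp add: positive_def)
  show "countably_additive ?S (\<lambda>A. \<integral>\<^sup>+w. emeasure (factorial_power k (\<omega> w)) A \<partial>P)"
  proof (rule countably_additiveI)
    fix A :: "nat \<Rightarrow> _" assume A: "range A \<subseteq> ?S" "disjoint_family A"
    have "(\<Sum>i. \<integral>\<^sup>+w. emeasure (factorial_power k (\<omega> w)) (A i) \<partial>P)
      = (\<integral>\<^sup>+w. (\<Sum>i. emeasure (factorial_power k (\<omega> w)) (A i)) \<partial>P)"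
      using A by (intro nn_integral_suminf[symmetric] emeasure_factorial_power_measurable) auto
    also have "\<dots> = (\<integral>\<^sup>+w. emeasure (factorial_power k (\<omega> w)) (\<Union>i. A i) \<partial>P)"
      using A by (intro nn_integral_cong suminf_emeasure) auto
    finally show "(\<Sum>i. \<integral>\<^sup>+w. emeasure (factorial_power k (\<omega> w)) (A i) \<partial>P)
      = (\<integral>\<^sup>+w. emeasure (factorial_power k (\<omega> w)) (\<Union>i. A i) \<partial>P)" .
  qed
qed

lemma campbell:
  assumes h: "h \<in> borel_measurable (\<Pi>\<^sub>M i\<in>{..<k}. borel)"
  shows "(\<lambda>w. tuple_sum k (\<omega> w) h) \<in> borel_measurable P"
    and "(\<integral>\<^sup>+w. tuple_sum k (\<omega> w) h \<partial>P) = (\<integral>\<^sup>+x. h x \<partial>factorial_moment_measure P \<omega> k)"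
proof -
  let ?F = "\<lambda>w. factorial_power k (\<omega> w)"
  let ?M = "factorial_moment_measure P \<omega> k"
  have sM: "sets ?M = sets (\<Pi>\<^sub>M i\<in>{..<k}. borel)"
    unfolding factorial_moment_measure_def by (rule sets.sets_measure_of_eq)
  have spF: "space (?F w) = space (\<Pi>\<^sub>M i\<in>{..<k}. borel)" for w by (rule sets_eq_imp_space_eq) simp
  have spM: "space ?M = space (\<Pi>\<^sub>M i\<in>{..<k}. borel)" by (rule sets_eq_imp_space_eq) (rule sM)
  have "(\<lambda>w. \<integral>\<^sup>+x. h x \<partial>?F w) \<in> borel_measurable P \<and>
    (\<integral>\<^sup>+w. \<integral>\<^sup>+x. h x \<partial>?F w \<partial>P) = (\<integral>\<^sup>+x. h x \<partial>?M)"
    using h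
  proof (induction h rule: borel_measurable_induct)
    case (cong f g)
    have "(\<integral>\<^sup>+x. f x \<partial>?F w) = (\<integral>\<^sup>+x. g x \<partial>?F w)" for w
      by (rule nn_integral_cong) (use cong(3) spF in auto)
    moreover have "(\<integral>\<^sup>+x. f x \<partial>?M) = (\<integral>\<^sup>+x. g x \<partial>?M)"
      by (rule nn_integral_cong) (use cong(3) spM in auto)
    ultimately show ?case using cong by simp
  next
    case (set A)
    then show ?case
      using emeasure_factorial_power_measurable[OF set] emeasure_factorial_moment_measure[OF set] sM
      by simp
  next
    case (mult u c)
    have m: "u \<in> borel_measurable (?F w)" "u \<in> borel_measurable ?M" for w
      using mult(2) sM by (simp_all cong: measurable_cong_sets)
    show ?case using mult m by (auto simp: nn_integral_cmult intro!: borel_measurable_times)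
  next
    case (add u v)
    have m: "u \<in> borel_measurable (?F w)" "u \<in> borel_measurable ?M" "v \<in> borel_measurable (?F w)" "v \<in> borel_measurable ?M" for w
      using add(1,3) sM by (simp_all cong: measurable_cong_sets)
    show ?case using add m by (auto simp: nn_integral_add intro!: borel_measurable_add)
  next
    case (seq U)
    note inc = \<open>incseq U\<close> and mU = \<open>\<And>i. U i \<in> borel_measurable (\<Pi>\<^sub>M i\<in>{..<k}. borel)\<close>
    have m: "U i \<in> borel_measurable (?F w)" "U i \<in> borel_measurable ?M" for w i
      using mU sM by (simp_all cong: measurable_cong_sets)
    have eF: "(\<integral>\<^sup>+x. (SUP i. U i) x \<partial>?F w) = (SUP i. \<integral>\<^sup>+x. U i x \<partial>?F w)" for w
      unfolding SUP_apply by (rule nn_integral_monotone_convergence_SUP[OF inc m(1)])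
    have eM: "(\<integral>\<^sup>+x. (SUP i. U i) x \<partial>?M) = (SUP i. \<integral>\<^sup>+x. U i x \<partial>?M)"
      unfolding SUP_apply by (rule nn_integral_monotone_convergence_SUP[OF inc m(2)])
    have mm: "(\<lambda>w. \<integral>\<^sup>+x. U i x \<partial>?F w) \<in> borel_measurable P" for i using seq.IH by simp
    have i2: "incseq (\<lambda>i w. \<integral>\<^sup>+x. U i x \<partial>?F w)"
      unfolding incseq_def le_fun_def
      using inc by (intro allI impI nn_integral_mono) (simp add: incseq_def le_fun_def)
    have "(\<integral>\<^sup>+w. (SUP i. \<integral>\<^sup>+x. U i x \<partial>?F w) \<partial>P) = (SUP i. \<integral>\<^sup>+w. \<integral>\<^sup>+x. U i x \<partial>?F w \<partial>P)"
      by (rule nn_integral_monotone_convergence_SUP[OF i2 mm])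
    then have "(\<integral>\<^sup>+w. (\<integral>\<^sup>+x. (SUP i. U i) x \<partial>?F w) \<partial>P) = (\<integral>\<^sup>+x. (SUP i. U i) x \<partial>?M)"
      unfolding eF eM using seq.IH by simp
    moreover have "(\<lambda>w. \<integral>\<^sup>+x. (SUP i. U i) x \<partial>?F w) \<in> borel_measurable P"
      unfolding eF using mm by measurable
    ultimately show ?case using seq by simp
  qed
  then show "(\<lambda>w. tuple_sum k (\<omega> w) h) \<in> borel_measurable P"
    "(\<integral>\<^sup>+w. tuple_sum k (\<omega> w) h \<partial>P) = (\<integral>\<^sup>+x. h x \<partial>?M)"
    by (simp_all add: nn_integral_factorial_power[OF h])
qed

lemma campbell_determinantal:
  fixes K :: "'a \<Rightarrow> 'a \<Rightarrow> complex"
  assumes K: "determinantal P \<omega> K" "k \<ge> 1"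
    and h: "h \<in> borel_measurable (\<Pi>\<^sub>M i\<in>{..<k}. borel)"
  shows "(\<integral>\<^sup>+w. tuple_sum k (\<omega> w) h \<partial>P)
    = (\<integral>\<^sup>+x. ennreal (Re (kernel_det K k x)) * h x \<partial>(\<Pi>\<^sub>M i\<in>{..<k}. lborel))"
proof -
  obtain \<rho> where \<rho>: "correlation_function P \<omega> k \<rho>"
    "AE x in (\<Pi>\<^sub>M i\<in>{..<k}. lborel). complex_of_real (\<rho> x) = kernel_det K k x"
  proof -
    have "\<exists>\<rho>. correlation_function P \<omega> k \<rho> \<and>
        (AE x in (\<Pi>\<^sub>M i\<in>{..<k}. lborel). complex_of_real (\<rho> x) = kernel_det K k x)"
      using K unfolding determinantal_def by simp
    then show ?thesis by (elim exE conjE) (rule that)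
  qed
  have s: "sets (\<Pi>\<^sub>M i\<in>{..<k}. borel :: 'a measure) = sets (\<Pi>\<^sub>M i\<in>{..<k}. lborel)"
    by (rule sets_PiM_cong) simp_all
  have hl: "h \<in> borel_measurable (\<Pi>\<^sub>M i\<in>{..<k}. lborel)"
    using h s by (simp cong: measurable_cong_sets)
  note c = \<rho>(1)[unfolded correlation_function_def, THEN conjunct2]
  note m = c[THEN conjunct1] and d = c[THEN conjunct2, THEN conjunct2]
  have "(\<integral>\<^sup>+w. tuple_sum k (\<omega> w) h \<partial>P) = (\<integral>\<^sup>+x. ennreal (\<rho> x) * h x \<partial>(\<Pi>\<^sub>M i\<in>{..<k}. lborel))"
    unfolding campbell(2)[OF h] d by (rule nn_integral_density[OF measurable_compose[OF m measurable_ennreal] hl])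
  also have "\<dots> = (\<integral>\<^sup>+x. ennreal (Re (kernel_det K k x)) * h x \<partial>(\<Pi>\<^sub>M i\<in>{..<k}. lborel))"
  proof (rule nn_integral_cong_AE)
    show "AE x in (\<Pi>\<^sub>M i\<in>{..<k}. lborel). ennreal (\<rho> x) * h x = ennreal (Re (kernel_det K k x)) * h x"
      using \<rho>(2)
    proof eventually_elim
      case (elim x)
      from arg_cong[OF this, of Re] show ?case by simp
    qed
  qed
  finally show ?thesis .
qed

end

section \<open>Tuple sums and product integrals for one to four points as iterated sums and
  integrals\<close>

lemma tuple_sum_1:
  "tuple_sum 1 M (\<lambda>x. f (x 0)) = (\<integral>\<^sup>+i. f (pos M i) \<partial>count_space (idx M))"
  unfolding One_nat_def tuple_sum_def nn_integral_count_space_PiE nn_integral_count_space_PiE_0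
  by (simp add: lessThan_Suc)

lemma tuple_sum_2:
  "tuple_sum 2 M (\<lambda>x. f (x 0) (x 1)) =
    (\<integral>\<^sup>+i. \<integral>\<^sup>+j. indicator {(i, j). i \<noteq> j} (i, j) * f (pos M i) (pos M j)
      \<partial>count_space (idx M) \<partial>count_space (idx M))"
  unfolding numeral_2_eq_2 One_nat_def tuple_sum_def nn_integral_count_space_PiE nn_integral_count_space_PiE_0
  by (intro nn_integral_cong arg_cong2[where f = "(*)"])
     (simp_all add: indicator_def inj_on_fun_upd_lessThan lessThan_Suc del: fun_upd_apply, simp_all)

lemma nn_integral_PiM_lborel_Suc:
  fixes f :: "(nat \<Rightarrow> 'a::euclidean_space) \<Rightarrow> ennreal"
  assumes f: "f \<in> borel_measurable (\<Pi>\<^sub>M i\<in>{..<Suc k}. borel)"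
  shows "(\<integral>\<^sup>+x. f x \<partial>(\<Pi>\<^sub>M i\<in>{..<Suc k}. lborel))
    = (\<integral>\<^sup>+x. \<integral>\<^sup>+y. f (x(k := y)) \<partial>lborel \<partial>(\<Pi>\<^sub>M i\<in>{..<k}. lborel))"
proof -
  interpret product_sigma_finite "\<lambda>_::nat. lborel :: 'a measure" ..
  have s: "sets (\<Pi>\<^sub>M i\<in>{..<Suc k}. borel :: 'a measure) = sets (\<Pi>\<^sub>M i\<in>{..<Suc k}. lborel)"
    by (rule sets_PiM_cong) simp_all
  have "f \<in> borel_measurable (\<Pi>\<^sub>M i\<in>{..<Suc k}. lborel)"
    using f s by (simp cong: measurable_cong_sets)
  then have "f \<in> borel_measurable (\<Pi>\<^sub>M i\<in>insert k {..<k}. lborel)"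
    unfolding lessThan_Suc .
  then show ?thesis unfolding lessThan_Suc by (intro product_nn_integral_insert) auto
qed

lemma nn_integral_PiM_lborel_0:
  fixes f :: "(nat \<Rightarrow> 'a::euclidean_space) \<Rightarrow> ennreal"
  shows "(\<integral>\<^sup>+x. f x \<partial>(\<Pi>\<^sub>M i\<in>{..<0::nat}. lborel)) = f (\<lambda>_. undefined)"
proof -
  interpret product_sigma_finite "\<lambda>_::nat. lborel :: 'a measure" ..
  show ?thesis unfolding lessThan_0 by (rule nn_integral_empty) simp
qed

lemma tuple_sum_3:
  "tuple_sum 3 M (\<lambda>x. f (x 0) (x 1) (x 2)) =
    (\<integral>\<^sup>+i. \<integral>\<^sup>+j. \<integral>\<^sup>+k. indicator {(i, j, k). distinct [i, j, k]} (i, j, k) * f (pos M i) (pos M j) (pos M k)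
      \<partial>count_space (idx M) \<partial>count_space (idx M) \<partial>count_space (idx M))"
  unfolding numeral_3_eq_3 numeral_2_eq_2 One_nat_def tuple_sum_def nn_integral_count_space_PiE nn_integral_count_space_PiE_0
  by (intro nn_integral_cong arg_cong2[where f = "(*)"])
     (simp_all add: indicator_def inj_on_fun_upd_lessThan lessThan_Suc del: fun_upd_apply, auto)

lemma tuple_sum_4:
  "tuple_sum 4 M (\<lambda>x. f (x 0) (x 1) (x 2) (x 3)) =
    (\<integral>\<^sup>+i. \<integral>\<^sup>+j. \<integral>\<^sup>+k. \<integral>\<^sup>+l. indicator {(i, j, k, l). distinct [i, j, k, l]} (i, j, k, l) * f (pos M i) (pos M j) (pos M k) (pos M l)
      \<partial>count_space (idx M) \<partial>count_space (idx M) \<partial>count_space (idx M) \<partial>count_space (idx M))"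
proof -
  have 4: "(4::nat) = Suc (Suc (Suc (Suc 0)))" by simp
  show ?thesis
  unfolding 4 numeral_3_eq_3 numeral_2_eq_2 One_nat_def tuple_sum_def nn_integral_count_space_PiE nn_integral_count_space_PiE_0
  by (intro nn_integral_cong arg_cong2[where f = "(*)"])
     (simp_all add: indicator_def inj_on_fun_upd_lessThan lessThan_Suc del: fun_upd_apply, auto)
qed


lemma measurable_component_lessThan:
  "i < k \<Longrightarrow> (\<lambda>x. x i) \<in> (\<Pi>\<^sub>M i\<in>{..<k}. N) \<rightarrow>\<^sub>M N" for i k :: nat
  by (rule measurable_component_singleton) simp

lemma measurable_PiM_2:
  assumes "(\<lambda>(x, y). f x y) \<in> borel_measurable (borel \<Otimes>\<^sub>M borel)"
  shows "(\<lambda>x. f (x 0) (x 1)) \<in> borel_measurable (\<Pi>\<^sub>M i\<in>{..<2::nat}. borel)"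
  using measurable_compose[OF measurable_Pair[OF measurable_component_lessThan[of 0 2]
      measurable_component_lessThan[of 1 2]] assms] by simp

lemma measurable_PiM_3:
  assumes "(\<lambda>(x, y, z). f x y z) \<in> borel_measurable (borel \<Otimes>\<^sub>M borel \<Otimes>\<^sub>M borel)"
  shows "(\<lambda>x. f (x 0) (x 1) (x 2)) \<in> borel_measurable (\<Pi>\<^sub>M i\<in>{..<3::nat}. borel)"
  using measurable_compose[OF measurable_Pair[OF measurable_component_lessThan[of 0 3]
      measurable_Pair[OF measurable_component_lessThan[of 1 3] measurable_component_lessThan[of 2 3]]] assms]
  by simp

lemma measurable_PiM_4:
  assumes "(\<lambda>(x, y, z, u). f x y z u) \<in> borel_measurable (borel \<Otimes>\<^sub>M borel \<Otimes>\<^sub>M borel \<Otimes>\<^sub>M borel)"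
  shows "(\<lambda>x. f (x 0) (x 1) (x 2) (x 3)) \<in> borel_measurable (\<Pi>\<^sub>M i\<in>{..<4::nat}. borel)"
  using measurable_compose[OF measurable_Pair[OF measurable_component_lessThan[of 0 4]
      measurable_Pair[OF measurable_component_lessThan[of 1 4]
        measurable_Pair[OF measurable_component_lessThan[of 2 4] measurable_component_lessThan[of 3 4]]]] assms]
  by simp

lemma nn_integral_PiM_lborel_1:
  fixes f :: "'a::euclidean_space \<Rightarrow> ennreal"
  assumes f: "f \<in> borel_measurable borel"
  shows "(\<integral>\<^sup>+x. f (x 0) \<partial>(\<Pi>\<^sub>M i\<in>{..<1::nat}. lborel)) = (\<integral>\<^sup>+x. f x \<partial>lborel)"
  unfolding One_nat_def
  by (subst nn_integral_PiM_lborel_Suc[OF measurable_compose[OF measurable_component_lessThan f]])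
     (simp_all only: nn_integral_PiM_lborel_0 fun_upd_same zero_less_Suc)

lemma nn_integral_PiM_lborel_2:
  fixes f :: "'a::euclidean_space \<Rightarrow> 'a \<Rightarrow> ennreal"
  assumes f[measurable]: "(\<lambda>(x, y). f x y) \<in> borel_measurable (borel \<Otimes>\<^sub>M borel)"
  shows "(\<integral>\<^sup>+x. f (x 0) (x 1) \<partial>(\<Pi>\<^sub>M i\<in>{..<2::nat}. lborel)) = (\<integral>\<^sup>+x. \<integral>\<^sup>+y. f x y \<partial>lborel \<partial>lborel)"
proof -
  have 2: "2 = Suc 1" by simp
  have "(\<integral>\<^sup>+x. f (x 0) (x 1) \<partial>(\<Pi>\<^sub>M i\<in>{..<2::nat}. lborel))
    = (\<integral>\<^sup>+x. \<integral>\<^sup>+y. f (x 0) y \<partial>lborel \<partial>(\<Pi>\<^sub>M i\<in>{..<1::nat}. lborel))"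
    using nn_integral_PiM_lborel_Suc[OF measurable_PiM_2[OF f, unfolded 2]] unfolding 2[symmetric] by simp
  also have "\<dots> = (\<integral>\<^sup>+x. \<integral>\<^sup>+y. f x y \<partial>lborel \<partial>lborel)"
    by (rule nn_integral_PiM_lborel_1) measurable
  finally show ?thesis .
qed

lemma nn_integral_PiM_lborel_3:
  fixes f :: "'a::euclidean_space \<Rightarrow> 'a \<Rightarrow> 'a \<Rightarrow> ennreal"
  assumes f[measurable]: "(\<lambda>(x, y, z). f x y z) \<in> borel_measurable (borel \<Otimes>\<^sub>M borel \<Otimes>\<^sub>M borel)"
  shows "(\<integral>\<^sup>+x. f (x 0) (x 1) (x 2) \<partial>(\<Pi>\<^sub>M i\<in>{..<3::nat}. lborel))
    = (\<integral>\<^sup>+x. \<integral>\<^sup>+y. \<integral>\<^sup>+z. f x y z \<partial>lborel \<partial>lborel \<partial>lborel)"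
proof -
  have 3: "3 = Suc 2" by simp
  have "(\<integral>\<^sup>+x. f (x 0) (x 1) (x 2) \<partial>(\<Pi>\<^sub>M i\<in>{..<3::nat}. lborel))
    = (\<integral>\<^sup>+x. \<integral>\<^sup>+z. f (x 0) (x 1) z \<partial>lborel \<partial>(\<Pi>\<^sub>M i\<in>{..<2::nat}. lborel))"
    using nn_integral_PiM_lborel_Suc[OF measurable_PiM_3[OF f, unfolded 3]] unfolding 3[symmetric] by simp
  also have "\<dots> = (\<integral>\<^sup>+x. \<integral>\<^sup>+y. \<integral>\<^sup>+z. f x y z \<partial>lborel \<partial>lborel \<partial>lborel)"
  proof (rule nn_integral_PiM_lborel_2)
    have "(\<lambda>p. (fst (fst p), snd (fst p), snd p)) \<in> (borel \<Otimes>\<^sub>M borel) \<Otimes>\<^sub>M borel \<rightarrow>\<^sub>M (borel \<Otimes>\<^sub>M borel \<Otimes>\<^sub>M borel :: ('a \<times> 'a \<times> 'a) measure)"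
      by measurable
    from measurable_compose[OF this f]
    have "(\<lambda>(p, z). f (fst p) (snd p) z) \<in> borel_measurable ((borel \<Otimes>\<^sub>M borel) \<Otimes>\<^sub>M lborel)"
      by (simp add: case_prod_beta)
    from lborel.borel_measurable_nn_integral[OF this]
    show "(\<lambda>(x, y). \<integral>\<^sup>+z. f x y z \<partial>lborel) \<in> borel_measurable (borel \<Otimes>\<^sub>M borel)"
      by (simp add: case_prod_beta)
  qed
  finally show ?thesis .
qed

lemma nn_integral_PiM_lborel_4:
  fixes f :: "'a::euclidean_space \<Rightarrow> 'a \<Rightarrow> 'a \<Rightarrow> 'a \<Rightarrow> ennreal"
  assumes f[measurable]: "(\<lambda>(x, y, z, u). f x y z u) \<in> borel_measurable (borel \<Otimes>\<^sub>M borel \<Otimes>\<^sub>M borel \<Otimes>\<^sub>M borel)"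
  shows "(\<integral>\<^sup>+x. f (x 0) (x 1) (x 2) (x 3) \<partial>(\<Pi>\<^sub>M i\<in>{..<4::nat}. lborel))
    = (\<integral>\<^sup>+x. \<integral>\<^sup>+y. \<integral>\<^sup>+z. \<integral>\<^sup>+u. f x y z u \<partial>lborel \<partial>lborel \<partial>lborel \<partial>lborel)"
proof -
  have 4: "4 = Suc 3" by simp
  have "(\<integral>\<^sup>+x. f (x 0) (x 1) (x 2) (x 3) \<partial>(\<Pi>\<^sub>M i\<in>{..<4::nat}. lborel))
    = (\<integral>\<^sup>+x. \<integral>\<^sup>+u. f (x 0) (x 1) (x 2) u \<partial>lborel \<partial>(\<Pi>\<^sub>M i\<in>{..<3::nat}. lborel))"
    using nn_integral_PiM_lborel_Suc[OF measurable_PiM_4[OF f, unfolded 4]] unfolding 4[symmetric] by simp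
  also have "\<dots> = (\<integral>\<^sup>+x. \<integral>\<^sup>+y. \<integral>\<^sup>+z. \<integral>\<^sup>+u. f x y z u \<partial>lborel \<partial>lborel \<partial>lborel \<partial>lborel)"
  proof (rule nn_integral_PiM_lborel_3)
    have "(\<lambda>p. (fst (fst p), fst (snd (fst p)), snd (snd (fst p)), snd p))
      \<in> (borel \<Otimes>\<^sub>M borel \<Otimes>\<^sub>M borel) \<Otimes>\<^sub>M borel \<rightarrow>\<^sub>M (borel \<Otimes>\<^sub>M borel \<Otimes>\<^sub>M borel \<Otimes>\<^sub>M borel :: ('a \<times> 'a \<times> 'a \<times> 'a) measure)"
      by measurable
    from measurable_compose[OF this f]
    have "(\<lambda>(p, u). f (fst p) (fst (snd p)) (snd (snd p)) u) \<in> borel_measurable ((borel \<Otimes>\<^sub>M borel \<Otimes>\<^sub>M borel) \<Otimes>\<^sub>M lborel)"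
      by (simp add: case_prod_beta)
    from lborel.borel_measurable_nn_integral[OF this]
    show "(\<lambda>(x, y, z). \<integral>\<^sup>+u. f x y z u \<partial>lborel) \<in> borel_measurable (borel \<Otimes>\<^sub>M borel \<Otimes>\<^sub>M borel)"
      by (simp add: case_prod_beta)
  qed
  finally show ?thesis .
qed

lemma emeasure_lborel_ball_pos:
  fixes a :: "'a::euclidean_space"
  assumes "0 < r"
  shows "0 < emeasure lborel (ball a r)"
  using assms unit_ball_vol_pos[of "real DIM('a)"] by (simp add: emeasure_ball)

text \<open>This passes from densities, which are fixed only almost everywhere, to values at points.
  If \<open>u\<close> exceeded \<open>v\<close> at \<open>(a, b)\<close>, it would do so with a
  uniform gap on a product of small balls. Negative values of \<open>u\<close> are truncated by
  \<open>ennreal\<close>, harmlessly because \<open>v\<close> is nonnegative.\<close>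

lemma continuous_le_of_ball_integrals:
  fixes u v :: "'a::euclidean_space \<Rightarrow> 'a \<Rightarrow> real"
  assumes cu: "continuous_on UNIV (\<lambda>(x, y). u x y)" and cv: "continuous_on UNIV (\<lambda>(x, y). v x y)"
    and v0: "\<And>x y. 0 \<le> v x y"
    and I: "\<And>a b r. (\<integral>\<^sup>+x. \<integral>\<^sup>+y. ennreal (u x y) * (indicator (ball a r) x * indicator (ball b r) y) \<partial>lborel \<partial>lborel)
      \<le> (\<integral>\<^sup>+x. \<integral>\<^sup>+y. ennreal (v x y) * (indicator (ball a r) x * indicator (ball b r) y) \<partial>lborel \<partial>lborel)"
  shows "u a b \<le> v a b"
proof (rule ccontr)
  assume "\<not> u a b \<le> v a b"
  then have uv: "v a b < u a b" by simp
  \<comment> \<open>Two levels strictly between \<open>v a b\<close> and \<open>u a b\<close>: both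
    strict inequalities persist near \<open>(a, b)\<close>, and the gap between \<open>c\<close> and
    \<open>d\<close> gives the contradiction after integration.\<close>
  define c where "c = (u a b + v a b) / 2"
  define d where "d = (c + u a b) / 2"
  have vc: "v a b < c" "c < d" "d < u a b" "0 \<le> c" using uv v0[of a b] by (auto simp: c_def d_def field_simps)
  have "open {p. v (fst p) (snd p) < c \<and> d < u (fst p) (snd p)}"
    using cu cv by (intro open_Collect_conj open_Collect_less continuous_intros) (auto simp: case_prod_beta')
  then obtain A B where AB: "open A" "open B" "(a, b) \<in> A \<times> B" "A \<times> B \<subseteq> {p. v (fst p) (snd p) < c \<and> d < u (fst p) (snd p)}"
    using vc by (elim open_prod_elim[of _ "(a, b)"]) auto
  obtain r1 where r1: "0 < r1" "ball a r1 \<subseteq> A" using AB by (auto simp: open_contains_ball)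
  obtain r2 where r2: "0 < r2" "ball b r2 \<subseteq> B" using AB by (auto simp: open_contains_ball)
  define r where "r = min r1 r2"
  have r: "0 < r" "ball a r \<subseteq> A" "ball b r \<subseteq> B" using r1 r2 by (auto simp: r_def)
  define V where "V = emeasure lborel (ball a r)"
  define W where "W = emeasure lborel (ball b r)"
  have pos: "V \<noteq> 0" "V < \<infinity>" "W \<noteq> 0" "W < \<infinity>"
    using emeasure_lborel_ball_finite[of a r] emeasure_lborel_ball_finite[of b r]
      emeasure_lborel_ball_pos[OF r(1), of a] emeasure_lborel_ball_pos[OF r(1), of b]
    by (simp_all add: V_def W_def)
  have const: "(\<integral>\<^sup>+x. \<integral>\<^sup>+y. ennreal e * (indicator (ball a r) x * indicator (ball b r) y) \<partial>lborel \<partial>lborel) = ennreal e * (V * W)" for e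
  proof -
    have "(\<integral>\<^sup>+y. ennreal e * (indicator (ball a r) x * indicator (ball b r) y) \<partial>lborel) = (ennreal e * W) * indicator (ball a r) x" for x
      unfolding mult.assoc[symmetric] W_def by (subst nn_integral_cmult) (auto simp: mult_ac intro!: borel_measurable_indicator)
    then have "(\<integral>\<^sup>+x. \<integral>\<^sup>+y. ennreal e * (indicator (ball a r) x * indicator (ball b r) y) \<partial>lborel \<partial>lborel)
      = (\<integral>\<^sup>+x. (ennreal e * W) * indicator (ball a r) x \<partial>lborel)" by (simp only:)
    also have "\<dots> = (ennreal e * W) * V" unfolding V_def by (rule nn_integral_cmult_indicator) simp
    finally show ?thesis by (simp only: mult_ac)
  qed
  have "ennreal d * (V * W) \<le> (\<integral>\<^sup>+x. \<integral>\<^sup>+y. ennreal (u x y) * (indicator (ball a r) x * indicator (ball b r) y) \<partial>lborel \<partial>lborel)"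
    unfolding const[symmetric]
  proof (intro nn_integral_mono)
    fix x y
    show "ennreal d * (indicator (ball a r) x * indicator (ball b r) y) \<le> ennreal (u x y) * (indicator (ball a r) x * indicator (ball b r) y)"
    proof (cases "x \<in> ball a r \<and> y \<in> ball b r")
      case True
      then have "(x, y) \<in> A \<times> B" using r by auto
      with AB(4) have "d < u x y" by auto
      then show ?thesis by (intro mult_right_mono) (auto simp: ennreal_leI)
    next
      case False
      then have "(indicator (ball a r) x * indicator (ball b r) y :: ennreal) = 0" by (auto simp: indicator_def)
      then show ?thesis by auto
    qed
  qed
  also note I
  also have "(\<integral>\<^sup>+x. \<integral>\<^sup>+y. ennreal (v x y) * (indicator (ball a r) x * indicator (ball b r) y) \<partial>lborel \<partial>lborel) \<le> ennreal c * (V * W)"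
    unfolding const[symmetric]
  proof (intro nn_integral_mono)
    fix x y
    show "ennreal (v x y) * (indicator (ball a r) x * indicator (ball b r) y) \<le> ennreal c * (indicator (ball a r) x * indicator (ball b r) y)"
    proof (cases "x \<in> ball a r \<and> y \<in> ball b r")
      case True
      then have "(x, y) \<in> A \<times> B" using r by auto
      with AB(4) have "v x y < c" by auto
      then show ?thesis by (intro mult_right_mono) (auto simp: ennreal_leI)
    next
      case False
      then have "(indicator (ball a r) x * indicator (ball b r) y :: ennreal) = 0" by (auto simp: indicator_def)
      then show ?thesis by auto
    qed
  qed
  finally have "ennreal d * (V * W) \<le> ennreal c * (V * W)" .
  moreover obtain t where t: "V * W = ennreal t" "0 < t"
  proof -
    have "V * W < \<infinity>" "V * W \<noteq> 0" using pos by (auto simp: ennreal_mult_less_top)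
    then show ?thesis using that by (cases "V * W") (auto simp: less_le)
  qed
  ultimately have "d * t \<le> c * t" using vc by (simp add: ennreal_mult[symmetric])
  then show False using t vc by simp
qed

section \<open>Correlation functions of determinantal processes\<close>

locale dpp = counting_process P \<omega> + pd_kernel K
  for P :: "'w measure" and \<omega> :: "'w \<Rightarrow> 'a::euclidean_space measure" and K :: "'a \<Rightarrow> 'a \<Rightarrow> complex" +
  assumes cont: "continuous_on UNIV (\<lambda>(x, y). K x y)"
    and stat: "stationary P \<omega>"
    and det: "determinantal P \<omega> K"
    and dens: "has_mean_density P \<omega> 1"
begin

lemma cont_comp:
  assumes "continuous_on A f" "continuous_on A h"
  shows "continuous_on A (\<lambda>x. K (f x) (h x))"
  using continuous_on_compose2[OF cont continuous_on_Pair[OF assms]] by simp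

text \<open>The one-point correlation function is \<open>K x x\<close> almost everywhere, and it is
  the mean density 1. Continuity extends this to every point.\<close>

lemma K_diag: "K x x = 1"
proof -
  have 1: "(\<integral>\<^sup>+x. ennreal (Re (K x x)) * indicator A x \<partial>lborel) = emeasure lborel A" if A: "A \<in> sets borel" for A
  proof -
    have m: "(\<lambda>x. ennreal (Re (K x x)) * indicator A x) \<in> borel_measurable borel"
      using A borel_measurable_continuous_onI[OF cont_comp[of UNIV "\<lambda>x. x" "\<lambda>x. x"]]
      by (simp add: continuous_on_id)
    have mA: "(indicator A :: 'a \<Rightarrow> ennreal) \<in> borel_measurable borel" using A by simp
    have mx: "(\<lambda>x. indicator A (x 0) :: ennreal) \<in> borel_measurable (\<Pi>\<^sub>M i\<in>{..<1::nat}. borel)"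
      by (rule measurable_compose[OF measurable_component_lessThan mA]) simp
    have "(\<integral>\<^sup>+x. ennreal (Re (K x x)) * indicator A x \<partial>lborel)
      = (\<integral>\<^sup>+x. ennreal (Re (K (x 0) (x 0))) * indicator A (x 0) \<partial>(\<Pi>\<^sub>M i\<in>{..<1::nat}. lborel))"
      by (rule nn_integral_PiM_lborel_1[OF m, symmetric])
    also have "\<dots> = (\<integral>\<^sup>+w. tuple_sum 1 (\<omega> w) (\<lambda>x. indicator A (x 0)) \<partial>P)"
      unfolding campbell_determinantal[OF det order_refl mx] kernel_det_1 ..
    also have "\<dots> = (\<integral>\<^sup>+w. emeasure (\<omega> w) A \<partial>P)"
    proof (rule nn_integral_cong)
      fix w assume w: "w \<in> space P"
      note c = \<omega>_counting[OF w]
      have "tuple_sum 1 (\<omega> w) (\<lambda>x. indicator A (x 0)) = (\<integral>\<^sup>+x. indicator A x \<partial>\<omega> w)"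
        unfolding tuple_sum_1 by (rule nn_integral_counting_measure[OF c mA, symmetric])
      also have "\<dots> = emeasure (\<omega> w) A"
        using A counting_measuresD(1)[OF c] by (intro nn_integral_indicator) simp
      finally show "tuple_sum 1 (\<omega> w) (\<lambda>x. indicator A (x 0)) = emeasure (\<omega> w) A" .
    qed
    also have "\<dots> = emeasure lborel A"
      using dens A unfolding has_mean_density_def by simp
    finally show ?thesis .
  qed
  \<comment> \<open>The comparison lemma concerns functions of two variables; it is applied to
    functions constant in the second one, so the ball for that variable only contributes a
    factor.\<close>
  have 2: "(\<integral>\<^sup>+x. \<integral>\<^sup>+y. ennreal (f x) * (indicator A x * indicator B y) \<partial>lborel \<partial>lborel)
    = (\<integral>\<^sup>+x. ennreal (f x) * indicator A x \<partial>lborel) * emeasure lborel B"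
    if "A \<in> sets borel" "B \<in> sets borel" "f \<in> borel_measurable borel" for A B :: "'a set" and f :: "'a \<Rightarrow> real"
  proof -
    have "(\<integral>\<^sup>+y. ennreal (f x) * (indicator A x * indicator B y) \<partial>lborel) = (ennreal (f x) * indicator A x) * emeasure lborel B" for x
      unfolding mult.assoc[symmetric] using that by (intro nn_integral_cmult_indicator) simp
    then have "(\<integral>\<^sup>+x. \<integral>\<^sup>+y. ennreal (f x) * (indicator A x * indicator B y) \<partial>lborel \<partial>lborel)
      = (\<integral>\<^sup>+x. (ennreal (f x) * indicator A x) * emeasure lborel B \<partial>lborel)" by (simp only:)
    also have "\<dots> = (\<integral>\<^sup>+x. ennreal (f x) * indicator A x \<partial>lborel) * emeasure lborel B"
      using that by (intro nn_integral_multc) auto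
    finally show ?thesis .
  qed
  have c1: "continuous_on UNIV (\<lambda>(x, y::'a). Re (K x x))"
    using continuous_on_Re[OF cont_comp[of UNIV fst fst]] by (simp add: case_prod_beta' continuous_on_fst continuous_on_id)
  have c2: "continuous_on UNIV (\<lambda>(x::'a, y::'a). 1 :: real)" by (simp add: case_prod_beta')
  have m1: "(\<lambda>x. Re (K x x)) \<in> borel_measurable borel"
    by (intro borel_measurable_continuous_onI continuous_on_Re cont_comp continuous_on_id)
  have e: "(\<integral>\<^sup>+x. \<integral>\<^sup>+y. ennreal (Re (K x x)) * (indicator (ball a r) x * indicator (ball b r) y) \<partial>lborel \<partial>lborel)
    = (\<integral>\<^sup>+x. \<integral>\<^sup>+y. ennreal 1 * (indicator (ball a r) x * indicator (ball b r) y) \<partial>lborel \<partial>lborel)" for a b :: 'a and r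
    using 2[of "ball a r" "ball b r" "\<lambda>x. Re (K x x)"] 2[of "ball a r" "ball b r" "\<lambda>x. 1"] m1 1[of "ball a r"] by simp
  have "Re (K x x) \<le> 1"
    by (rule continuous_le_of_ball_integrals[OF c1 c2]) (use e in auto)
  moreover have "1 \<le> Re (K x x)"
    by (rule continuous_le_of_ball_integrals[OF c2 c1]) (use e diag(2) in auto)
  ultimately have "Re (K x x) = 1" by simp
  then show ?thesis using diag(1)[of x] by simp
qed

text \<open>The two-point correlation function, that is, the two-point determinant for a kernel with
  unit diagonal.\<close>

definition \<rho>2 :: "'a \<Rightarrow> 'a \<Rightarrow> real" where
  "\<rho>2 x y = 1 - (cmod (K x y))\<^sup>2"

lemma norm_K_le: "(cmod (K x y))\<^sup>2 \<le> 1"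
  using cauchy[of x y] by (simp add: K_diag)

lemma \<rho>2_bounds: "0 \<le> \<rho>2 x y" "\<rho>2 x y \<le> 1"
  using norm_K_le[of x y] by (simp_all add: \<rho>2_def)

lemma \<rho>2_cont: "continuous_on UNIV (\<lambda>(x, y). \<rho>2 x y)"
  unfolding \<rho>2_def case_prod_beta'
  by (intro continuous_intros cont_comp)

lemma \<rho>2_measurable [measurable]: "(\<lambda>(x, y). \<rho>2 x y) \<in> borel_measurable (borel \<Otimes>\<^sub>M borel)"
  using borel_measurable_continuous_onI[OF \<rho>2_cont] by (simp add: borel_prod)

lemma Re_kernel_det_2': "Re (kernel_det K 2 x) = \<rho>2 (x 0) (x 1)"
  by (simp add: Re_kernel_det_2 K_diag \<rho>2_def)

lemma E1:
  assumes f: "f \<in> borel_measurable borel"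
  shows "(\<integral>\<^sup>+w. \<integral>\<^sup>+x. f x \<partial>\<omega> w \<partial>P) = (\<integral>\<^sup>+x. f x \<partial>lborel)"
proof -
  have mx: "(\<lambda>x. f (x 0)) \<in> borel_measurable (\<Pi>\<^sub>M i\<in>{..<1::nat}. borel)"
    by (rule measurable_compose[OF measurable_component_lessThan f]) simp
  have "(\<integral>\<^sup>+w. \<integral>\<^sup>+x. f x \<partial>\<omega> w \<partial>P) = (\<integral>\<^sup>+w. tuple_sum 1 (\<omega> w) (\<lambda>x. f (x 0)) \<partial>P)"
    unfolding tuple_sum_1 by (intro nn_integral_cong nn_integral_counting_measure \<omega>_counting f)
  also have "\<dots> = (\<integral>\<^sup>+x. f x \<partial>lborel)"
    unfolding campbell_determinantal[OF det order_refl mx] kernel_det_1 K_diag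
    using nn_integral_PiM_lborel_1[OF f] by simp
  finally show ?thesis .
qed

lemma E2:
  assumes f[measurable]: "(\<lambda>(x, y). f x y) \<in> borel_measurable (borel \<Otimes>\<^sub>M borel)"
  shows "(\<integral>\<^sup>+w. tuple_sum 2 (\<omega> w) (\<lambda>x. f (x 0) (x 1)) \<partial>P)
    = (\<integral>\<^sup>+x. \<integral>\<^sup>+y. ennreal (\<rho>2 x y) * f x y \<partial>lborel \<partial>lborel)"
  by (subst campbell_determinantal[OF det _ measurable_PiM_2[OF f]], simp)
     (unfold Re_kernel_det_2', rule nn_integral_PiM_lborel_2, measurable)

text \<open>The bound 1 for the third correlation function is enough here, because three-point sums
  only occur in error terms of lower order.\<close>

lemma E3:
  assumes f[measurable]: "(\<lambda>(x, y, z). f x y z) \<in> borel_measurable (borel \<Otimes>\<^sub>M borel \<Otimes>\<^sub>M borel)"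
  shows "(\<integral>\<^sup>+w. tuple_sum 3 (\<omega> w) (\<lambda>x. f (x 0) (x 1) (x 2)) \<partial>P)
    \<le> (\<integral>\<^sup>+x. \<integral>\<^sup>+y. \<integral>\<^sup>+z. f x y z \<partial>lborel \<partial>lborel \<partial>lborel)"
proof -
  have "(\<integral>\<^sup>+w. tuple_sum 3 (\<omega> w) (\<lambda>x. f (x 0) (x 1) (x 2)) \<partial>P)
    = (\<integral>\<^sup>+x. ennreal (Re (kernel_det K 3 x)) * f (x 0) (x 1) (x 2) \<partial>(\<Pi>\<^sub>M i\<in>{..<3}. lborel))"
    by (rule campbell_determinantal[OF det _ measurable_PiM_3[OF f]]) simp
  also have "\<dots> \<le> (\<integral>\<^sup>+x. 1 * f (x 0) (x 1) (x 2) \<partial>(\<Pi>\<^sub>M i\<in>{..<3::nat}. lborel))"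
    using fischer3[OF K_diag] by (intro nn_integral_mono mult_right_mono) (auto simp: ennreal_le_1)
  also have "\<dots> = (\<integral>\<^sup>+x. \<integral>\<^sup>+y. \<integral>\<^sup>+z. f x y z \<partial>lborel \<partial>lborel \<partial>lborel)"
    using nn_integral_PiM_lborel_3[OF f] by simp
  finally show ?thesis .
qed

text \<open>Negative association: by Fischer's inequality the fourth moment measure is dominated by
  the square of the second.\<close>

lemma E4:
  assumes f[measurable]: "(\<lambda>(x, y). f x y) \<in> borel_measurable (borel \<Otimes>\<^sub>M borel)"
  shows "(\<integral>\<^sup>+w. tuple_sum 4 (\<omega> w) (\<lambda>x. f (x 0) (x 1) * f (x 2) (x 3)) \<partial>P)
    \<le> (\<integral>\<^sup>+x. \<integral>\<^sup>+y. ennreal (\<rho>2 x y) * f x y \<partial>lborel \<partial>lborel)\<^sup>2"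
proof -
  let ?h = "\<lambda>x y. ennreal (\<rho>2 x y) * f x y"
  let ?I = "\<integral>\<^sup>+x. \<integral>\<^sup>+y. ?h x y \<partial>lborel \<partial>lborel"
  have m: "(\<lambda>(x, y, z, u). f x y * f z u) \<in> borel_measurable (borel \<Otimes>\<^sub>M borel \<Otimes>\<^sub>M borel \<Otimes>\<^sub>M borel)"
    by measurable
  have m': "(\<lambda>(x, y, z, u). ?h x y * ?h z u) \<in> borel_measurable (borel \<Otimes>\<^sub>M borel \<Otimes>\<^sub>M borel \<Otimes>\<^sub>M borel)"
    by measurable
  have "(\<integral>\<^sup>+w. tuple_sum 4 (\<omega> w) (\<lambda>x. f (x 0) (x 1) * f (x 2) (x 3)) \<partial>P)
    = (\<integral>\<^sup>+x. ennreal (Re (kernel_det K 4 x)) * (f (x 0) (x 1) * f (x 2) (x 3)) \<partial>(\<Pi>\<^sub>M i\<in>{..<4}. lborel))"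
    by (rule campbell_determinantal[OF det _ measurable_PiM_4[OF m]]) simp
  also have "\<dots> \<le> (\<integral>\<^sup>+x. ?h (x 0) (x 1) * ?h (x 2) (x 3) \<partial>(\<Pi>\<^sub>M i\<in>{..<4::nat}. lborel))"
  proof (rule nn_integral_mono)
    fix x :: "nat \<Rightarrow> 'a"
    have "Re (kernel_det K 4 x) \<le> \<rho>2 (x 0) (x 1) * \<rho>2 (x (0 + 2)) (x (1 + 2))"
      using fischer4[OF K_diag, of x] unfolding Re_kernel_det_2' .
    also have "(0::nat) + 2 = 2" by simp
    also have "(1::nat) + 2 = 3" by simp
    finally have "ennreal (Re (kernel_det K 4 x)) \<le> ennreal (\<rho>2 (x 0) (x 1)) * ennreal (\<rho>2 (x 2) (x 3))"
      using \<rho>2_bounds(1) by (simp add: ennreal_mult[symmetric] ennreal_leI)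
    then have "ennreal (Re (kernel_det K 4 x)) * (f (x 0) (x 1) * f (x 2) (x 3))
      \<le> (ennreal (\<rho>2 (x 0) (x 1)) * ennreal (\<rho>2 (x 2) (x 3))) * (f (x 0) (x 1) * f (x 2) (x 3))"
      by (rule mult_right_mono) simp
    also have "\<dots> = ?h (x 0) (x 1) * ?h (x 2) (x 3)" by (simp only: mult_ac)
    finally show "ennreal (Re (kernel_det K 4 x)) * (f (x 0) (x 1) * f (x 2) (x 3)) \<le> ?h (x 0) (x 1) * ?h (x 2) (x 3)" .
  qed
  also have "\<dots> = (\<integral>\<^sup>+x. \<integral>\<^sup>+y. \<integral>\<^sup>+z. \<integral>\<^sup>+u. ?h x y * ?h z u \<partial>lborel \<partial>lborel \<partial>lborel \<partial>lborel)"
    by (rule nn_integral_PiM_lborel_4[OF m'])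
  also have "\<dots> = (\<integral>\<^sup>+x. \<integral>\<^sup>+y. ?h x y * ?I \<partial>lborel \<partial>lborel)"
  proof (intro nn_integral_cong)
    fix x y
    have "(\<integral>\<^sup>+u. ?h x y * ?h z u \<partial>lborel) = ?h x y * (\<integral>\<^sup>+u. ?h z u \<partial>lborel)" for z
      by (rule nn_integral_cmult) measurable
    then have "(\<integral>\<^sup>+z. \<integral>\<^sup>+u. ?h x y * ?h z u \<partial>lborel \<partial>lborel) = (\<integral>\<^sup>+z. ?h x y * (\<integral>\<^sup>+u. ?h z u \<partial>lborel) \<partial>lborel)"
      by (simp only:)
    also have "\<dots> = ?h x y * ?I" by (rule nn_integral_cmult) measurable
    finally show "(\<integral>\<^sup>+z. \<integral>\<^sup>+u. ?h x y * ?h z u \<partial>lborel \<partial>lborel) = ?h x y * ?I" .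
  qed
  also have "\<dots> = (\<integral>\<^sup>+x. (\<integral>\<^sup>+y. ?h x y \<partial>lborel) * ?I \<partial>lborel)"
    by (intro nn_integral_cong nn_integral_multc) measurable
  also have "\<dots> = ?I * ?I" by (rule nn_integral_multc) measurable
  finally show ?thesis by (simp only: power2_eq_square)
qed

end

lemma ennreal_add_le_cancel:
  fixes a b c :: ennreal
  assumes "c + a \<le> c + b" "c < \<infinity>"
  shows "a \<le> b"
  using assms ennreal_add_left_cancel_le[of c a b] by auto

lemma eventually_less_real:
  "eventually (\<lambda>n. r < real n) sequentially"
proof -
  obtain N where "r < real N" using reals_Archimedean2 by blast
  then show ?thesis by (intro eventually_sequentiallyI[of N]) (erule less_le_trans, simp)
qed

lemma ball_borel [measurable, simp]: "ball (a::'a::euclidean_space) r \<in> sets borel"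
  by simp

lemma measurable_nn_integral_counting:
  assumes M: "M \<in> counting_measures" and f: "(\<lambda>(x, y). f x y) \<in> borel_measurable (borel \<Otimes>\<^sub>M borel)"
  shows "(\<lambda>x. \<integral>\<^sup>+y. f x y \<partial>M) \<in> borel_measurable borel"
  by (rule measurable_nn_integral_counting_kernel[OF M _ f]) simp

text \<open>The last term collects the pairs of equal labels. Distinctness refers to labels and not
  to positions, so the identity also holds with multiple points.\<close>

lemma double_nn_integral_counting:
  fixes M :: "'a::euclidean_space measure"
  assumes M: "M \<in> counting_measures" and f: "(\<lambda>(x, y). f x y) \<in> borel_measurable (borel \<Otimes>\<^sub>M borel)"
  shows "(\<integral>\<^sup>+x. \<integral>\<^sup>+y. f x y \<partial>M \<partial>M) = tuple_sum 2 M (\<lambda>x. f (x 0) (x 1)) + (\<integral>\<^sup>+x. f x x \<partial>M)"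
proof -
  have fx: "f x \<in> borel_measurable borel" for x using measurable_Pair2[OF f, of x] by simp
  have fd: "(\<lambda>x. f x x) \<in> borel_measurable borel"
    using measurable_compose[OF measurable_Pair[OF measurable_ident measurable_ident] f] by simp
  let ?I = "idx M" and ?p = "pos M"
  have "(\<integral>\<^sup>+x. \<integral>\<^sup>+y. f x y \<partial>M \<partial>M) = (\<integral>\<^sup>+i. \<integral>\<^sup>+y. f (?p i) y \<partial>M \<partial>count_space ?I)"
    by (rule nn_integral_counting_measure[OF M measurable_nn_integral_counting[OF M f]])
  also have "\<dots> = (\<integral>\<^sup>+i. \<integral>\<^sup>+j. f (?p i) (?p j) \<partial>count_space ?I \<partial>count_space ?I)"
    by (intro nn_integral_cong nn_integral_counting_measure[OF M] fx)
  also have "\<dots> = (\<integral>\<^sup>+i. (\<integral>\<^sup>+j. indicator {(i, j). i \<noteq> j} (i, j) * f (?p i) (?p j) \<partial>count_space ?I) + f (?p i) (?p i) \<partial>count_space ?I)"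
  proof (intro nn_integral_cong)
    fix i assume "i \<in> space (count_space ?I)"
    then have i: "i \<in> ?I" by simp
    have "(\<integral>\<^sup>+j. f (?p i) (?p j) \<partial>count_space ?I)
      = (\<integral>\<^sup>+j. indicator {(i, j). i \<noteq> j} (i, j) * f (?p i) (?p j) + indicator {i} j * f (?p i) (?p j) \<partial>count_space ?I)"
      by (intro nn_integral_cong) (simp add: indicator_def)
    also have "\<dots> = (\<integral>\<^sup>+j. indicator {(i, j). i \<noteq> j} (i, j) * f (?p i) (?p j) \<partial>count_space ?I) + (\<integral>\<^sup>+j. indicator {i} j * f (?p i) (?p j) \<partial>count_space ?I)"
      by (rule nn_integral_add) simp_all
    also have "(\<integral>\<^sup>+j. indicator {i} j * f (?p i) (?p j) \<partial>count_space ?I) = f (?p i) (?p i)"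
      using i by (subst nn_integral_count_space'[of "{i}"]) auto
    finally show "(\<integral>\<^sup>+j. f (?p i) (?p j) \<partial>count_space ?I)
      = (\<integral>\<^sup>+j. indicator {(i, j). i \<noteq> j} (i, j) * f (?p i) (?p j) \<partial>count_space ?I) + f (?p i) (?p i)" .
  qed
  also have "\<dots> = tuple_sum 2 M (\<lambda>x. f (x 0) (x 1)) + (\<integral>\<^sup>+i. f (?p i) (?p i) \<partial>count_space ?I)"
    unfolding tuple_sum_2 by (rule nn_integral_add) simp_all
  also have "(\<integral>\<^sup>+i. f (?p i) (?p i) \<partial>count_space ?I) = (\<integral>\<^sup>+x. f x x \<partial>M)"
    by (rule nn_integral_counting_measure[OF M fd, symmetric])
  finally show ?thesis .
qed

section \<open>Translates of counting measures\<close>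

lemma emeasure_translate:
  fixes M :: "'a::euclidean_space measure"
  assumes "sets M = sets borel" "A \<in> sets borel"
  shows "emeasure (translate t M) A = emeasure M ((\<lambda>y. t + y) -` A)"
proof -
  have "(\<lambda>y. t + y) \<in> M \<rightarrow>\<^sub>M borel" using assms(1) by (simp cong: measurable_cong_sets)
  moreover have "space M = UNIV" using sets_eq_imp_space_eq[OF assms(1)] by simp
  ultimately show ?thesis unfolding translate_def using assms by (subst emeasure_distr) auto
qed

lemma vimage_translate_borel:
  fixes A :: "'a::euclidean_space set"
  assumes "A \<in> sets borel"
  shows "(\<lambda>y. t + y) -` A \<in> sets borel"
proof -
  have "(\<lambda>y. t + y) \<in> borel \<rightarrow>\<^sub>M (borel :: 'a measure)" by measurable
  from measurable_sets[OF this assms] show ?thesis by simp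
qed

lemma translate_counting_measures:
  assumes M: "M \<in> counting_measures"
  shows "translate t M \<in> counting_measures"
proof -
  note D = counting_measuresD[OF M]
  have s: "sets (translate t M) = sets borel" by (simp add: translate_def)
  have "emeasure (translate t M) A < \<infinity>" if A: "A \<in> sets borel" "bounded A" for A
  proof -
    have "bounded ((\<lambda>y. t + y) -` A)"
    proof -
      have "(\<lambda>y. t + y) -` A \<subseteq> (\<lambda>y. - t + y) ` A"
      proof
        fix y assume y: "y \<in> (\<lambda>y. t + y) -` A"
        have "y = - t + (t + y)" by simp
        then show "y \<in> (\<lambda>y. - t + y) ` A" using y by (intro image_eqI[of _ _ "t + y"]) simp_all
      qed
      then show ?thesis using bounded_translation[OF A(2)] bounded_subset by blast
    qed
    then show ?thesis unfolding emeasure_translate[OF D(1) A(1)]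
      by (intro D(3) vimage_translate_borel A)
  qed
  moreover have "emeasure (translate t M) A \<in> insert \<infinity> (range of_nat)" if A: "A \<in> sets borel" for A
    unfolding emeasure_translate[OF D(1) A] by (intro D(4) vimage_translate_borel A)
  ultimately show ?thesis using s unfolding counting_measures_def locally_finite_def by blast
qed

lemma translate_measurable:
  fixes t :: "'a::euclidean_space"
  shows "translate t \<in> counting_space \<rightarrow>\<^sub>M counting_space"
proof -
  let ?G = "{{M \<in> counting_measures. emeasure M A \<in> B} | (A :: 'a set) B. A \<in> sets borel \<and> B \<in> sets borel}"
  have "translate t \<in> counting_space \<rightarrow>\<^sub>M sigma counting_measures ?G"
  proof (rule measurable_measure_of)
    show "?G \<subseteq> Pow counting_measures" by auto
    show "translate t \<in> space counting_space \<rightarrow> counting_measures"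
      using translate_counting_measures by (auto simp: space_counting_space)
    fix y assume "y \<in> ?G"
    then obtain A :: "'a set" and B where y: "y = {M \<in> counting_measures. emeasure M A \<in> B}"
      and AB: "A \<in> sets borel" "B \<in> sets borel" by blast
    let ?A = "(\<lambda>y. t + y) -` A"
    have "translate t -` y \<inter> space counting_space = (\<lambda>M. emeasure M ?A) -` B \<inter> space counting_space"
    proof -
      have "emeasure (translate t M) A = emeasure M ?A" if "M \<in> counting_measures" for M
        by (rule emeasure_translate[OF counting_measuresD(1)[OF that] AB(1)])
      then show ?thesis using translate_counting_measures[of _ t] by (auto simp: y space_counting_space)
    qed
    also have "\<dots> \<in> sets counting_space"
      by (rule measurable_sets[OF measurable_emeasure_counting[OF vimage_translate_borel[OF AB(1)]] AB(2)])
    finally show "translate t -` y \<inter> space counting_space \<in> sets counting_space" .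
  qed
  then show ?thesis unfolding counting_space_def .
qed

lemma nn_integral_lborel_translate:
  fixes f :: "'a::euclidean_space \<Rightarrow> ennreal"
  assumes f: "f \<in> borel_measurable borel"
  shows "(\<integral>\<^sup>+x. f (t + x) \<partial>lborel) = (\<integral>\<^sup>+x. f x \<partial>lborel)"
proof -
  have "(\<integral>\<^sup>+x. f x \<partial>lborel) = (\<integral>\<^sup>+x. f x \<partial>distr lborel borel ((+) t))" by (simp only: lborel_distr_plus)
  also have "\<dots> = (\<integral>\<^sup>+x. f (t + x) \<partial>lborel)" by (rule nn_integral_distr) (use f in simp_all)
  finally show ?thesis ..
qed

section \<open>Averages over pairs of points in a large ball\<close>

lemma emeasure_ball_product:
  fixes A B :: "'a::euclidean_space set"
  assumes "A \<in> sets borel" "B \<in> sets borel"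
  shows "(\<integral>\<^sup>+x. \<integral>\<^sup>+y. indicator A x * indicator B y \<partial>lborel \<partial>lborel) = emeasure lborel A * emeasure lborel B"
proof -
  have "(\<integral>\<^sup>+y. indicator A x * indicator B y \<partial>lborel) = indicator A x * emeasure lborel B" for x
    using assms by (intro nn_integral_cmult_indicator) simp
  then show ?thesis using assms by (simp add: nn_integral_multc)
qed

lemma nn_integral_window:
  "(\<integral>\<^sup>+x. indicator (ball (0::'a::euclidean_space) u) x * c \<partial>lborel) = emeasure lborel (ball (0::'a) u) * c"
  by (subst nn_integral_multc) simp_all

text \<open>If \<open>x\<close> keeps distance \<open>r\<close> from the boundary of the window,
  then the whole support of \<open>\<phi> (y - x)\<close> lies in the window, and the inner integral
  is the full integral of \<open>\<phi>\<close>.\<close>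

lemma window_integral_ge:
  fixes \<phi> :: "'a::euclidean_space \<Rightarrow> ennreal" and r s :: real
  assumes \<phi>[measurable]: "\<phi> \<in> borel_measurable borel" and r: "\<And>z. z \<notin> ball 0 r \<Longrightarrow> \<phi> z = 0"
  shows "emeasure lborel (ball (0::'a) (s - r)) * (\<integral>\<^sup>+z. \<phi> z \<partial>lborel)
    \<le> (\<integral>\<^sup>+x. \<integral>\<^sup>+y. (indicator (ball 0 s) x * indicator (ball 0 s) y) * \<phi> (y - x) \<partial>lborel \<partial>lborel)"
  unfolding nn_integral_window[symmetric]
proof (rule nn_integral_mono)
  let ?I = "\<integral>\<^sup>+z. \<phi> z \<partial>lborel"
  fix x :: 'a
  show "indicator (ball 0 (s - r)) x * ?I \<le> (\<integral>\<^sup>+y. (indicator (ball 0 s) x * indicator (ball 0 s) y) * \<phi> (y - x) \<partial>lborel)"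
  proof (cases "x \<in> ball 0 (s - r)")
    case True
    have "indicator (ball 0 (s - r)) x * ?I = (\<integral>\<^sup>+y. \<phi> (y - x) \<partial>lborel)"
      using True nn_integral_lborel_translate[OF \<phi>, of "- x"] by simp
    also have "\<dots> \<le> (\<integral>\<^sup>+y. (indicator (ball 0 s) x * indicator (ball 0 s) y) * \<phi> (y - x) \<partial>lborel)"
    proof (rule nn_integral_mono)
      fix y :: 'a
      show "\<phi> (y - x) \<le> (indicator (ball 0 s) x * indicator (ball 0 s) y) * \<phi> (y - x)"
      proof (cases "y - x \<in> ball 0 r")
        case True
        with \<open>x \<in> ball 0 (s - r)\<close> have a: "norm x < s - r" "norm (y - x) < r" by simp_all
        have "norm y \<le> norm x + norm (y - x)" using norm_triangle_ineq[of x "y - x"] by simp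
        with a have "norm x < s" "norm y < s" using norm_ge_zero[of "y - x"] by linarith+
        then show ?thesis by simp
      next
        case False
        then show ?thesis using r[OF False] by simp
      qed
    qed
    finally show ?thesis .
  qed simp
qed

lemma window_integral_le:
  fixes \<phi> :: "'a::euclidean_space \<Rightarrow> ennreal" and s :: real
  assumes \<phi>[measurable]: "\<phi> \<in> borel_measurable borel"
  shows "(\<integral>\<^sup>+x. \<integral>\<^sup>+y. (indicator (ball 0 s) x * indicator (ball 0 s) y) * \<phi> (y - x) \<partial>lborel \<partial>lborel)
    \<le> emeasure lborel (ball (0::'a) s) * (\<integral>\<^sup>+z. \<phi> z \<partial>lborel)"
  unfolding nn_integral_window[symmetric]
proof (rule nn_integral_mono)
  fix x :: 'a
  have "(\<integral>\<^sup>+y. (indicator (ball 0 s) x * indicator (ball 0 s) y) * \<phi> (y - x) \<partial>lborel)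
    \<le> (\<integral>\<^sup>+y. indicator (ball 0 s) x * \<phi> (y - x) \<partial>lborel)"
    by (intro nn_integral_mono mult_right_mono) (simp_all add: indicator_def)
  also have "\<dots> = indicator (ball 0 s) x * (\<integral>\<^sup>+z. \<phi> z \<partial>lborel)"
    using nn_integral_lborel_translate[OF \<phi>, of "- x"] by (subst nn_integral_cmult) simp_all
  finally show "(\<integral>\<^sup>+y. (indicator (ball 0 s) x * indicator (ball 0 s) y) * \<phi> (y - x) \<partial>lborel)
    \<le> indicator (ball 0 s) x * (\<integral>\<^sup>+z. \<phi> z \<partial>lborel)" .
qed

lemma shrink_tendsto_1:
  fixes r :: real
  shows "(\<lambda>n. ((real n - r) / real n) ^ d) \<longlonglongrightarrow> 1"
proof -
  have "(\<lambda>n. 1 - r * (1 / real n)) \<longlonglongrightarrow> 1 - r * 0"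
    by (intro tendsto_intros lim_1_over_n)
  moreover have "eventually (\<lambda>n. 1 - r * (1 / real n) = (real n - r) / real n) sequentially"
    using eventually_gt_at_top[of 0] by eventually_elim (simp add: field_simps)
  ultimately have "(\<lambda>n. (real n - r) / real n) \<longlonglongrightarrow> 1"
    by (simp add: tendsto_cong)
  then show ?thesis using tendsto_power[of "\<lambda>n. (real n - r) / real n" 1 sequentially d] by simp
qed

lemma emeasure_ball_eq:
  "0 \<le> s \<Longrightarrow> emeasure lborel (ball (0::'a::euclidean_space) s) = ennreal (unit_ball_vol (real DIM('a)) * s ^ DIM('a))"
  by (simp add: emeasure_ball)

text \<open>After division by the volume of the ball of radius \<open>n\<close>, the left side
  carries the factor \<open>((n - r) / n) ^ DIM('a)\<close>, which tends to 1: the boundary layer of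
  width \<open>r\<close> is negligible.\<close>

lemma window_limit:
  fixes I b :: ennreal and r :: real
  assumes r: "0 < r" and b: "b < \<infinity>"
    and le: "\<And>n. r < real n \<Longrightarrow> emeasure lborel (ball (0::'a::euclidean_space) (real n - r)) * I
      \<le> emeasure lborel (ball (0::'a) (real n)) * b"
  shows "I \<le> b"
proof -
  let ?c = "unit_ball_vol (real DIM('a))"
  have c: "0 < ?c" by (rule unit_ball_vol_pos) simp
  obtain B where B: "b = ennreal B" "0 \<le> B" using b by (cases b) auto
  \<comment> \<open>Infinity is excluded by a single window, whose right side is finite and whose
    shrunken ball has positive volume; only then can the limit be taken in the reals.\<close>
  have "I < \<infinity>"
  proof (rule ccontr)
    assume "\<not> I < \<infinity>"
    then have I: "I = \<infinity>" by (simp add: less_top[symmetric])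
    obtain n where n: "r < real n" using reals_Archimedean2 by blast
    have "emeasure lborel (ball (0::'a) (real n)) * b < \<infinity>"
      using emeasure_lborel_ball_finite[of "0::'a" "real n"] b by (simp add: ennreal_mult_less_top)
    then have "emeasure lborel (ball (0::'a) (real n - r)) * I < \<infinity>" using le[OF n] by (rule le_less_trans[rotated])
    then show False
      using emeasure_lborel_ball_pos[of "real n - r" "0::'a"] n by (simp add: I ennreal_mult_top split: if_splits)
  qed
  then obtain G where G: "I = ennreal G" "0 \<le> G" by (cases I) auto
  have key: "((real n - r) / real n) ^ DIM('a) * G \<le> B" if n: "r < real n" for n
  proof -
    have n0: "0 < real n" using n r by linarith
    have "ennreal (?c * (real n - r) ^ DIM('a)) * ennreal G \<le> ennreal (?c * real n ^ DIM('a)) * ennreal B"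
      using le[OF n] n by (simp add: emeasure_ball_eq G B)
    then have "?c * (real n - r) ^ DIM('a) * G \<le> ?c * real n ^ DIM('a) * B"
      using n c G B by (simp add: ennreal_mult[symmetric])
    then have "(real n - r) ^ DIM('a) * G \<le> real n ^ DIM('a) * B" using c by simp
    then show ?thesis using n0 by (simp add: power_divide field_simps)
  qed
  have "eventually (\<lambda>n. ((real n - r) / real n) ^ DIM('a) * G \<le> B) sequentially"
    using eventually_less_real[of r] by (rule eventually_mono) (rule key)
  moreover have "(\<lambda>n. ((real n - r) / real n) ^ DIM('a) * G) \<longlonglongrightarrow> 1 * G"
    by (intro tendsto_intros shrink_tendsto_1)
  ultimately have "1 * G \<le> B" by (intro tendsto_upperbound[of _ _ sequentially]) auto
  then show ?thesis using G B by simp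
qed

lemma nn_integral_le_ballI:
  fixes \<phi> :: "'a::euclidean_space \<Rightarrow> ennreal"
  assumes le: "\<And>r. 0 < r \<Longrightarrow> (\<integral>\<^sup>+z. \<phi> z * indicator (ball 0 r) z \<partial>lborel) \<le> b"
    and [measurable]: "\<phi> \<in> borel_measurable borel"
  shows "(\<integral>\<^sup>+z. \<phi> z \<partial>lborel) \<le> b"
proof -
  have "(\<integral>\<^sup>+z. \<phi> z \<partial>lborel) = (\<integral>\<^sup>+z. (SUP n. \<phi> z * indicator (ball 0 (real (Suc n))) z) \<partial>lborel)"
  proof (rule nn_integral_cong)
    fix z :: 'a
    obtain n where n: "norm z < real n" using reals_Archimedean2 by blast
    show "\<phi> z = (SUP n. \<phi> z * indicator (ball 0 (real (Suc n))) z)"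
    proof (rule antisym)
      have "\<phi> z = \<phi> z * indicator (ball 0 (real (Suc n))) z" using n by simp
      also have "\<dots> \<le> (SUP n. \<phi> z * indicator (ball 0 (real (Suc n))) z)" by (rule SUP_upper) simp
      finally show "\<phi> z \<le> (SUP n. \<phi> z * indicator (ball 0 (real (Suc n))) z)" .
      show "(SUP n. \<phi> z * indicator (ball 0 (real (Suc n))) z) \<le> \<phi> z"
        by (intro SUP_least) (simp add: indicator_def)
    qed
  qed
  also have "\<dots> = (SUP n. \<integral>\<^sup>+z. \<phi> z * indicator (ball 0 (real (Suc n))) z \<partial>lborel)"
  proof (rule nn_integral_monotone_convergence_SUP)
    show "incseq (\<lambda>n z. \<phi> z * indicator (ball (0::'a) (real (Suc n))) z)"
      unfolding incseq_def le_fun_def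
    proof (intro allI impI)
      fix m n :: nat and z :: 'a assume "m \<le> n"
      then show "\<phi> z * indicator (ball 0 (real (Suc m))) z \<le> \<phi> z * indicator (ball 0 (real (Suc n))) z"
        by (cases "z \<in> ball 0 (real (Suc m))") (simp_all add: indicator_def)
    qed
  qed simp
  also have "\<dots> \<le> b" by (intro SUP_least le) simp
  finally show ?thesis .
qed

section \<open>Second moments, translation invariance of the pair correlation and the function
  \<open>g\<close>\<close>

context dpp
begin

text \<open>The product of two counts is a double integral; pairs of distinct labels give the first
  term, equal labels the second. Both translation invariance and the integral bound on
  \<open>g\<close> are read off from this identity.\<close>

lemma second_moment:
  assumes A[measurable]: "A \<in> sets borel" and B[measurable]: "B \<in> sets borel"
  shows "(\<integral>\<^sup>+w. emeasure (\<omega> w) A * emeasure (\<omega> w) B \<partial>P)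
    = (\<integral>\<^sup>+x. \<integral>\<^sup>+y. ennreal (\<rho>2 x y) * (indicator A x * indicator B y) \<partial>lborel \<partial>lborel) + emeasure lborel (A \<inter> B)"
proof -
  let ?f = "\<lambda>x y. indicator A x * indicator B y :: ennreal"
  have m: "(\<lambda>(x, y). ?f x y) \<in> borel_measurable (borel \<Otimes>\<^sub>M borel)" by measurable
  have md: "(\<lambda>x. ?f x x) \<in> borel_measurable borel" by measurable
  have "(\<integral>\<^sup>+w. emeasure (\<omega> w) A * emeasure (\<omega> w) B \<partial>P)
    = (\<integral>\<^sup>+w. tuple_sum 2 (\<omega> w) (\<lambda>x. ?f (x 0) (x 1)) + (\<integral>\<^sup>+x. ?f x x \<partial>\<omega> w) \<partial>P)"
  proof (rule nn_integral_cong)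
    fix w assume w: "w \<in> space P"
    note c = \<omega>_counting[OF w] and D = counting_measuresD[OF \<omega>_counting[OF w]]
    have "(\<integral>\<^sup>+x. \<integral>\<^sup>+y. ?f x y \<partial>\<omega> w \<partial>\<omega> w) = (\<integral>\<^sup>+x. indicator A x * emeasure (\<omega> w) B \<partial>\<omega> w)"
      using B D(1) by (intro nn_integral_cong nn_integral_cmult_indicator) simp
    also have "\<dots> = emeasure (\<omega> w) A * emeasure (\<omega> w) B"
      using A D(1) by (subst nn_integral_multc) simp_all
    finally show "emeasure (\<omega> w) A * emeasure (\<omega> w) B = tuple_sum 2 (\<omega> w) (\<lambda>x. ?f (x 0) (x 1)) + (\<integral>\<^sup>+x. ?f x x \<partial>\<omega> w)"
      using double_nn_integral_counting[OF c m] by simp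
  qed
  also have "\<dots> = (\<integral>\<^sup>+w. tuple_sum 2 (\<omega> w) (\<lambda>x. ?f (x 0) (x 1)) \<partial>P) + (\<integral>\<^sup>+w. \<integral>\<^sup>+x. ?f x x \<partial>\<omega> w \<partial>P)"
  proof (rule nn_integral_add)
    show "(\<lambda>w. tuple_sum 2 (\<omega> w) (\<lambda>x. ?f (x 0) (x 1))) \<in> borel_measurable P"
      by (rule campbell(1)[OF measurable_PiM_2[OF m]])
    show "(\<lambda>w. \<integral>\<^sup>+x. ?f x x \<partial>\<omega> w) \<in> borel_measurable P"
      by (rule nn_integral_\<omega>_measurable) measurable
  qed
  also have "(\<integral>\<^sup>+w. \<integral>\<^sup>+x. ?f x x \<partial>\<omega> w \<partial>P) = (\<integral>\<^sup>+x. indicator (A \<inter> B) x \<partial>lborel)"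
    unfolding E1[OF md] by (simp add: indicator_inter_arith)
  also have "\<dots> = emeasure lborel (A \<inter> B)" by simp
  finally show ?thesis unfolding E2[OF m] .
qed

lemma second_moment_translate:
  assumes A: "A \<in> sets borel" and B: "B \<in> sets borel"
  shows "(\<integral>\<^sup>+w. emeasure (\<omega> w) ((\<lambda>y. t + y) -` A) * emeasure (\<omega> w) ((\<lambda>y. t + y) -` B) \<partial>P)
    = (\<integral>\<^sup>+w. emeasure (\<omega> w) A * emeasure (\<omega> w) B \<partial>P)"
proof -
  let ?f = "\<lambda>M. emeasure M A * emeasure M B"
  have f: "?f \<in> borel_measurable counting_space"
    by (rule borel_measurable_times_ennreal[OF measurable_emeasure_counting[OF A] measurable_emeasure_counting[OF B]])
  have t: "(\<lambda>w. translate t (\<omega> w)) \<in> P \<rightarrow>\<^sub>M counting_space"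
    by (rule measurable_compose[OF \<omega>_measurable translate_measurable])
  have "(\<integral>\<^sup>+w. emeasure (\<omega> w) ((\<lambda>y. t + y) -` A) * emeasure (\<omega> w) ((\<lambda>y. t + y) -` B) \<partial>P)
    = (\<integral>\<^sup>+w. ?f (translate t (\<omega> w)) \<partial>P)"
    using emeasure_translate[OF counting_measuresD(1)[OF \<omega>_counting]] A B by (intro nn_integral_cong) simp
  also have "\<dots> = (\<integral>\<^sup>+M. ?f M \<partial>distr P counting_space (\<lambda>w. translate t (\<omega> w)))"
    by (rule nn_integral_distr[OF t, symmetric]) (use f in simp)
  also have "distr P counting_space (\<lambda>w. translate t (\<omega> w)) = distr P counting_space \<omega>"
    using stat unfolding stationary_def by simp
  also have "(\<integral>\<^sup>+M. ?f M \<partial>\<dots>) = (\<integral>\<^sup>+w. ?f (\<omega> w) \<partial>P)"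
    by (rule nn_integral_distr[OF \<omega>_measurable]) (use f in simp)
  finally show ?thesis .
qed

text \<open>Stationarity makes the mixed second moments invariant under translation. Once the
  diagonal contributions are cancelled, the integrals of \<open>\<rho>2\<close> over products of
  balls are invariant, and continuity gives the identity at every pair of points.\<close>

lemma \<rho>2_translate: "\<rho>2 (x + t) (y + t) = \<rho>2 x y"
proof -
  have c: "continuous_on UNIV (\<lambda>(x, y). \<rho>2 (x + t) (y + t))" for t
    unfolding \<rho>2_def case_prod_beta' by (intro continuous_intros cont_comp)
  have I: "(\<integral>\<^sup>+x. \<integral>\<^sup>+y. ennreal (\<rho>2 (x + - t) (y + - t)) * (indicator A x * indicator B y) \<partial>lborel \<partial>lborel)
    = (\<integral>\<^sup>+x. \<integral>\<^sup>+y. ennreal (\<rho>2 x y) * (indicator A x * indicator B y) \<partial>lborel \<partial>lborel)"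
    if A: "A \<in> sets borel" "bounded A" and B: "B \<in> sets borel" for A B t
  proof -
    let ?A = "(\<lambda>y. t + y) -` A" and ?B = "(\<lambda>y. t + y) -` B"
    have [measurable]: "A \<in> sets borel" "B \<in> sets borel" using A B by auto
    have m: "(\<lambda>(x, y). ennreal (\<rho>2 (x + - t) (y + - t)) * (indicator A x * indicator B y)) \<in> borel_measurable (borel \<Otimes>\<^sub>M borel)"
    proof -
      have [measurable]: "(\<lambda>(x, y). \<rho>2 (x + - t) (y + - t)) \<in> borel_measurable (borel \<Otimes>\<^sub>M borel)"
        using borel_measurable_continuous_onI[OF c[of "- t"]] by (simp add: borel_prod)
      show ?thesis by measurable
    qed
    have m1: "(\<lambda>y. ennreal (\<rho>2 x (y + - t)) * (indicator A z * indicator B y)) \<in> borel_measurable borel" for x z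
    proof -
      have "(\<lambda>y. \<rho>2 x (y + - t)) \<in> borel_measurable borel"
        unfolding \<rho>2_def by (intro borel_measurable_continuous_onI continuous_intros cont_comp)
      then show ?thesis by simp
    qed
    have m2: "(\<lambda>x. \<integral>\<^sup>+y. ennreal (\<rho>2 (x + - t) (y + - t)) * (indicator A x * indicator B y) \<partial>lborel) \<in> borel_measurable borel"
      using lborel.borel_measurable_nn_integral[of "\<lambda>x y. ennreal (\<rho>2 (x + - t) (y + - t)) * (indicator A x * indicator B y)" borel] m
      by simp
    have "emeasure lborel (?A \<inter> ?B) = (\<integral>\<^sup>+x. indicator (?A \<inter> ?B) x \<partial>lborel)"
      using vimage_translate_borel[OF A(1), of t] vimage_translate_borel[OF B, of t]
      by (intro nn_integral_indicator[symmetric]) simp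
    also have "\<dots> = (\<integral>\<^sup>+x. indicator (A \<inter> B) (t + x) \<partial>lborel)"
      by (intro nn_integral_cong) (simp add: indicator_def)
    also have "\<dots> = emeasure lborel (A \<inter> B)"
      using A B by (subst nn_integral_lborel_translate) simp_all
    finally have \<lambda>: "emeasure lborel (?A \<inter> ?B) = emeasure lborel (A \<inter> B)" .
    \<comment> \<open>Boundedness of \<open>A\<close> makes the diagonal contribution finite, so
      that it may be cancelled in \<open>ennreal\<close>.\<close>
    have fin: "emeasure lborel (A \<inter> B) < \<infinity>"
      using A(2) by (intro emeasure_bounded_finite) (rule bounded_subset[OF _ Int_lower1])
    have "(\<integral>\<^sup>+x. \<integral>\<^sup>+y. ennreal (\<rho>2 x y) * (indicator ?A x * indicator ?B y) \<partial>lborel \<partial>lborel) + emeasure lborel (A \<inter> B)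
      = (\<integral>\<^sup>+x. \<integral>\<^sup>+y. ennreal (\<rho>2 x y) * (indicator A x * indicator B y) \<partial>lborel \<partial>lborel) + emeasure lborel (A \<inter> B)"
      using second_moment_translate[OF A(1) B, of t] second_moment[OF A(1) B]
        second_moment[OF vimage_translate_borel[OF A(1)] vimage_translate_borel[OF B], of t t] \<lambda> by simp
    then have e: "(\<integral>\<^sup>+x. \<integral>\<^sup>+y. ennreal (\<rho>2 x y) * (indicator ?A x * indicator ?B y) \<partial>lborel \<partial>lborel)
      = (\<integral>\<^sup>+x. \<integral>\<^sup>+y. ennreal (\<rho>2 x y) * (indicator A x * indicator B y) \<partial>lborel \<partial>lborel)"
      using fin by auto
    have "(\<integral>\<^sup>+x. \<integral>\<^sup>+y. ennreal (\<rho>2 (x + - t) (y + - t)) * (indicator A x * indicator B y) \<partial>lborel \<partial>lborel)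
      = (\<integral>\<^sup>+x. \<integral>\<^sup>+y. ennreal (\<rho>2 ((t + x) + - t) (y + - t)) * (indicator A (t + x) * indicator B y) \<partial>lborel \<partial>lborel)"
      by (rule nn_integral_lborel_translate[OF m2, symmetric])
    also have "\<dots> = (\<integral>\<^sup>+x. \<integral>\<^sup>+y. ennreal (\<rho>2 x y) * (indicator ?A x * indicator ?B y) \<partial>lborel \<partial>lborel)"
    proof (rule nn_integral_cong)
      fix x
      have "(\<integral>\<^sup>+y. ennreal (\<rho>2 ((t + x) + - t) (y + - t)) * (indicator A (t + x) * indicator B y) \<partial>lborel)
        = (\<integral>\<^sup>+y. ennreal (\<rho>2 ((t + x) + - t) ((t + y) + - t)) * (indicator A (t + x) * indicator B (t + y)) \<partial>lborel)"
        by (rule nn_integral_lborel_translate[OF m1, symmetric])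
      also have "\<dots> = (\<integral>\<^sup>+y. ennreal (\<rho>2 x y) * (indicator ?A x * indicator ?B y) \<partial>lborel)"
        by (intro nn_integral_cong) (simp add: indicator_def)
      finally show "(\<integral>\<^sup>+y. ennreal (\<rho>2 ((t + x) + - t) (y + - t)) * (indicator A (t + x) * indicator B y) \<partial>lborel)
        = (\<integral>\<^sup>+y. ennreal (\<rho>2 x y) * (indicator ?A x * indicator ?B y) \<partial>lborel)" .
    qed
    finally show ?thesis using e by simp
  qed
  have I': "(\<integral>\<^sup>+x. \<integral>\<^sup>+y. ennreal (\<rho>2 (x + t) (y + t)) * (indicator (ball a r) x * indicator (ball b r) y) \<partial>lborel \<partial>lborel)
    = (\<integral>\<^sup>+x. \<integral>\<^sup>+y. ennreal (\<rho>2 x y) * (indicator (ball a r) x * indicator (ball b r) y) \<partial>lborel \<partial>lborel)" for a b r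
    using I[of "ball a r" "ball b r" "- t"] by simp
  show ?thesis
  proof (rule antisym)
    show "\<rho>2 (x + t) (y + t) \<le> \<rho>2 x y"
      by (rule continuous_le_of_ball_integrals[OF c \<rho>2_cont \<rho>2_bounds(1)]) (simp only: I' order_refl)
    show "\<rho>2 x y \<le> \<rho>2 (x + t) (y + t)"
      by (rule continuous_le_of_ball_integrals[OF \<rho>2_cont c \<rho>2_bounds(1)]) (simp only: I' order_refl)
  qed
qed

definition g :: "'a \<Rightarrow> real" where
  "g x = (cmod (K 0 x))\<^sup>2"

lemma \<rho>2_g: "\<rho>2 x y = 1 - g (y - x)"
  using \<rho>2_translate[of 0 x "y - x"] by (simp add: \<rho>2_def g_def)

lemma K_g: "(cmod (K x y))\<^sup>2 = g (y - x)"
  using \<rho>2_g[of x y] by (simp add: \<rho>2_def)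

lemma g_bounds: "0 \<le> g x" "g x \<le> 1"
  using norm_K_le[of 0 x] by (simp_all add: g_def)

lemma g_0: "g 0 = 1"
  by (simp add: g_def K_diag)

lemma g_minus: "g (- x) = g x"
  using K_g[of x 0] K_g[of 0 x] sym[of x 0] by simp

lemma g_cont: "continuous_on UNIV g"
  unfolding g_def by (intro continuous_intros cont_comp)

lemma g_measurable [measurable]: "g \<in> borel_measurable borel"
  by (rule borel_measurable_continuous_onI[OF g_cont])


text \<open>Nonnegativity of the variance of the count \<open>X\<close> in the ball, with mean
  \<open>V\<close>, written without subtraction as \<open>2 * V * X \<le> X * X + V * V\<close>.
  Taking expectations gives \<open>V * V \<le> ?R + V\<close>, and since \<open>\<rho>2\<close> and
  \<open>g\<close> add up to 1 the left side equals \<open>?R + ?G\<close>.\<close>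

lemma window_variance:
  fixes s :: real
  assumes s: "0 \<le> s"
  shows "(\<integral>\<^sup>+x. \<integral>\<^sup>+y. (indicator (ball 0 s) x * indicator (ball 0 s) y) * ennreal (g (y - x)) \<partial>lborel \<partial>lborel)
    \<le> emeasure lborel (ball (0::'a) s)"
proof -
  let ?B = "ball (0::'a) s"
  define V where "V = emeasure lborel ?B"
  have V: "V < \<infinity>" unfolding V_def by (rule emeasure_lborel_ball_finite)
  let ?X = "\<lambda>w. emeasure (\<omega> w) ?B"
  have mX[measurable]: "?X \<in> borel_measurable P" by (rule emeasure_\<omega>_measurable) simp
  have EX: "(\<integral>\<^sup>+w. ?X w \<partial>P) = V" using dens by (simp add: has_mean_density_def V_def)
  have "2 * V * V = (\<integral>\<^sup>+w. 2 * V * ?X w \<partial>P)"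
    using EX by (subst nn_integral_cmult) simp_all
  also have "\<dots> \<le> (\<integral>\<^sup>+w. ?X w * ?X w + V * V \<partial>P)"
  proof (rule nn_integral_mono)
    fix w
    show "2 * V * ?X w \<le> ?X w * ?X w + V * V"
    proof (cases "?X w = \<infinity>")
      case True then show ?thesis by (simp add: ennreal_top_mult)
    next
      case False
      then obtain a where a: "?X w = ennreal a" "0 \<le> a" by (cases "?X w") auto
      obtain b where b: "V = ennreal b" "0 \<le> b" using V by (cases V) auto
      have "2 * b * a \<le> a * a + b * b" using sum_squares_bound[of b a] by (simp add: power2_eq_square)
      then have "ennreal (2 * b * a) \<le> ennreal (a * a + b * b)" by (rule ennreal_leI)
      then show ?thesis using a b by (simp add: ennreal_mult[symmetric] ennreal_plus[symmetric] ennreal_numeral[symmetric] del: ennreal_plus ennreal_numeral)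
    qed
  qed
  also have "\<dots> = (\<integral>\<^sup>+w. ?X w * ?X w \<partial>P) + V * V"
    by (subst nn_integral_add) (simp_all add: emeasure_space_1)
  also have "(\<integral>\<^sup>+w. ?X w * ?X w \<partial>P)
    = (\<integral>\<^sup>+x. \<integral>\<^sup>+y. ennreal (\<rho>2 x y) * (indicator ?B x * indicator ?B y) \<partial>lborel \<partial>lborel) + V"
    by (subst second_moment) (simp_all add: V_def)
  finally have "V * V + V * V \<le> ((\<integral>\<^sup>+x. \<integral>\<^sup>+y. ennreal (\<rho>2 x y) * (indicator ?B x * indicator ?B y) \<partial>lborel \<partial>lborel) + V) + V * V"
    by (simp add: mult_2 distrib_right)
  then have "V * V + V * V \<le> V * V + ((\<integral>\<^sup>+x. \<integral>\<^sup>+y. ennreal (\<rho>2 x y) * (indicator ?B x * indicator ?B y) \<partial>lborel \<partial>lborel) + V)"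
    by (simp only: add.commute)
  moreover have VV: "V * V < \<infinity>" using V by (simp add: ennreal_mult_less_top)
  ultimately have le: "V * V \<le> (\<integral>\<^sup>+x. \<integral>\<^sup>+y. ennreal (\<rho>2 x y) * (indicator ?B x * indicator ?B y) \<partial>lborel \<partial>lborel) + V"
    by (rule ennreal_add_le_cancel)
  let ?R = "\<integral>\<^sup>+x. \<integral>\<^sup>+y. ennreal (\<rho>2 x y) * (indicator ?B x * indicator ?B y) \<partial>lborel \<partial>lborel"
  let ?G = "\<integral>\<^sup>+x. \<integral>\<^sup>+y. (indicator ?B x * indicator ?B y) * ennreal (g (y - x)) \<partial>lborel \<partial>lborel"
  have "?R + ?G = (\<integral>\<^sup>+x. (\<integral>\<^sup>+y. ennreal (\<rho>2 x y) * (indicator ?B x * indicator ?B y) \<partial>lborel)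
      + (\<integral>\<^sup>+y. (indicator ?B x * indicator ?B y) * ennreal (g (y - x)) \<partial>lborel) \<partial>lborel)"
    by (rule nn_integral_add[symmetric]) measurable
  also have "\<dots> = (\<integral>\<^sup>+x. \<integral>\<^sup>+y. ennreal (\<rho>2 x y) * (indicator ?B x * indicator ?B y) + (indicator ?B x * indicator ?B y) * ennreal (g (y - x)) \<partial>lborel \<partial>lborel)"
    by (intro nn_integral_cong nn_integral_add[symmetric]) measurable
  also have "\<dots> = (\<integral>\<^sup>+x. \<integral>\<^sup>+y. indicator ?B x * indicator ?B y \<partial>lborel \<partial>lborel)"
  proof (intro nn_integral_cong)
    fix x y
    have "ennreal (\<rho>2 x y) + ennreal (g (y - x)) = 1"
      using \<rho>2_bounds(1)[of x y] g_bounds(1)[of "y - x"] by (simp add: ennreal_plus[symmetric] \<rho>2_g del: ennreal_plus)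
    moreover have "ennreal (\<rho>2 x y) * b + b * ennreal (g (y - x)) = (ennreal (\<rho>2 x y) + ennreal (g (y - x))) * b" for b
      by (simp only: distrib_right mult.commute[of b])
    ultimately show "ennreal (\<rho>2 x y) * (indicator ?B x * indicator ?B y) + (indicator ?B x * indicator ?B y) * ennreal (g (y - x)) = indicator ?B x * indicator ?B y"
      by simp
  qed
  also have "\<dots> = V * V" unfolding V_def by (rule emeasure_ball_product) simp_all
  finally have RG: "?R + ?G = V * V" .
  with le have "?R + ?G \<le> ?R + V" by simp
  moreover have "?R < \<infinity>"
  proof -
    have "?R \<le> ?R + ?G" by simp
    also have "\<dots> < \<infinity>" unfolding RG by (rule VV)
    finally show ?thesis .
  qed
  ultimately have "?G \<le> V" by (rule ennreal_add_le_cancel)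
  then show ?thesis by (simp add: V_def)
qed

text \<open>The variance inequality divided by the volume of the window. Cutting \<open>g\<close>
  off at radius \<open>r\<close> gives it the bounded support that the lower window estimate needs;
  monotone convergence removes the cut.\<close>

lemma nn_integral_g: "(\<integral>\<^sup>+z. ennreal (g z) \<partial>lborel) \<le> 1"
proof (rule nn_integral_le_ballI)
  fix r :: real assume r: "0 < r"
  let ?\<phi> = "\<lambda>z. ennreal (g z) * indicator (ball (0::'a) r) z"
  show "(\<integral>\<^sup>+z. ?\<phi> z \<partial>lborel) \<le> 1"
  proof (rule window_limit[OF r])
    fix n assume n: "r < real n"
    have "emeasure lborel (ball (0::'a) (real n - r)) * (\<integral>\<^sup>+z. ?\<phi> z \<partial>lborel)
      \<le> (\<integral>\<^sup>+x. \<integral>\<^sup>+y. (indicator (ball 0 (real n)) x * indicator (ball 0 (real n)) y) * ?\<phi> (y - x) \<partial>lborel \<partial>lborel)"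
      by (rule window_integral_ge) simp_all
    also have "\<dots> \<le> (\<integral>\<^sup>+x. \<integral>\<^sup>+y. (indicator (ball 0 (real n)) x * indicator (ball 0 (real n)) y) * ennreal (g (y - x)) \<partial>lborel \<partial>lborel)"
      by (intro nn_integral_mono mult_left_mono) (simp_all add: indicator_def)
    also have "\<dots> \<le> emeasure lborel (ball (0::'a) (real n))" by (rule window_variance) simp
    finally show "emeasure lborel (ball (0::'a) (real n - r)) * (\<integral>\<^sup>+z. ?\<phi> z \<partial>lborel)
      \<le> emeasure lborel (ball (0::'a) (real n)) * 1" by simp
  qed simp
qed simp

lemma g_integrable: "integrable lborel g"
  using nn_integral_g g_bounds(1)
  by (intro integrableI_nonneg) (auto intro: le_less_trans)

lemma integral_g_le: "(\<integral>z. g z \<partial>lborel) \<le> 1"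
proof -
  have "ennreal (\<integral>z. g z \<partial>lborel) \<le> 1"
    using nn_integral_g nn_integral_eq_integral[OF g_integrable] g_bounds(1) by simp
  then show ?thesis by (simp add: ennreal_le_1)
qed

end

section \<open>Positivity of the Fourier transform\<close>

lemma distr_PiM_pair:
  assumes M: "\<And>i. prob_space (M i)" and ij: "i \<in> I" "j \<in> I" "i \<noteq> j"
  shows "M i \<Otimes>\<^sub>M M j = distr (PiM I M) (M i \<Otimes>\<^sub>M M j) (\<lambda>x. (x i, x j))"
proof (rule pair_measure_eqI)
  interpret product_prob_space M by (rule product_prob_spaceI) (rule M)
  show "sigma_finite_measure (M i)" "sigma_finite_measure (M j)"
    using M by (auto intro: prob_space_imp_sigma_finite)
  fix A B assume A: "A \<in> sets (M i)" and B: "B \<in> sets (M j)"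
  have m: "(\<lambda>x. (x i, x j)) \<in> PiM I M \<rightarrow>\<^sub>M M i \<Otimes>\<^sub>M M j"
    by (intro measurable_Pair measurable_component_singleton ij)
  let ?X = "\<lambda>k. if k = i then A else B"
  have "emeasure (distr (PiM I M) (M i \<Otimes>\<^sub>M M j) (\<lambda>x. (x i, x j))) (A \<times> B)
    = emeasure (PiM I M) ((\<lambda>x. (x i, x j)) -` (A \<times> B) \<inter> space (PiM I M))"
    by (rule emeasure_distr[OF m pair_measureI[OF A B]])
  also have "(\<lambda>x. (x i, x j)) -` (A \<times> B) \<inter> space (PiM I M) = {x \<in> space (PiM I M). \<forall>k\<in>{i, j}. x k \<in> ?X k}"
    using ij by auto
  also have "emeasure (PiM I M) \<dots> = (\<Prod>k\<in>{i, j}. emeasure (M k) (?X k))"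
    using A B ij by (intro emeasure_PiM_Collect) auto
  also have "\<dots> = emeasure (M i) A * emeasure (M j) B" using ij by simp
  finally show "emeasure (M i) A * emeasure (M j) B = emeasure (distr (PiM I M) (M i \<Otimes>\<^sub>M M j) (\<lambda>x. (x i, x j))) (A \<times> B)" ..
qed simp

text \<open>Evaluate the quadratic form at \<open>n\<close> independent random points and let \<open>n\<close> tend to infinity:
  the diagonal terms become negligible.\<close>

lemma positive_definite_average:
  fixes \<psi> :: "'a \<Rightarrow> 'a \<Rightarrow> real"
  assumes U: "prob_space U" and m: "(\<lambda>(x, y). \<psi> x y) \<in> borel_measurable (U \<Otimes>\<^sub>M U)"
    and C: "\<And>x y. \<bar>\<psi> x y\<bar> \<le> C"
    and pos: "\<And>n X. 0 \<le> (\<Sum>i<n::nat. \<Sum>j<n. \<psi> (X i) (X j))"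
  shows "0 \<le> (\<integral>p. \<psi> (fst p) (snd p) \<partial>(U \<Otimes>\<^sub>M U))"
proof (rule ccontr)
  let ?J = "\<integral>p. \<psi> (fst p) (snd p) \<partial>(U \<Otimes>\<^sub>M U)"
  assume "\<not> 0 \<le> ?J"
  then have J: "?J < 0" by simp
  \<comment> \<open>With \<open>n + 1\<close> sample points the expected quadratic form is at most
    \<open>(n + 1) * (C + n * ?J)\<close>: \<open>C\<close> bounds each diagonal term and every
    other term has mean \<open>?J\<close>. The choice of \<open>n\<close> makes this
    negative.\<close>
  obtain n where n: "C / (- ?J) < real n" using reals_Archimedean2 by blast
  let ?N = "Suc n"
  let ?P = "PiM {..<?N} (\<lambda>_. U)"
  interpret U: prob_space U by (rule U)
  interpret PP: product_prob_space "\<lambda>_::nat. U" by (rule product_prob_spaceI) (rule U)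
  interpret P: prob_space ?P by (rule prob_space_PiM) (rule U)
  have comp: "(\<lambda>x. x i) \<in> ?P \<rightarrow>\<^sub>M U" if "i < ?N" for i
    using that by (intro measurable_component_singleton) simp
  have mp: "(\<lambda>p. \<psi> (fst p) (snd p)) \<in> borel_measurable (U \<Otimes>\<^sub>M U)" using m by (simp add: case_prod_beta')
  have mij: "(\<lambda>x. \<psi> (x i) (x j)) \<in> borel_measurable ?P" if "i < ?N" "j < ?N" for i j
    using measurable_compose[OF measurable_Pair[OF comp[OF that(1)] comp[OF that(2)]] mp] by simp
  have int: "integrable ?P (\<lambda>x. \<psi> (x i) (x j))" if "i < ?N" "j < ?N" for i j
    using C by (intro P.integrable_const_bound[where B = C] mij that) simp
  have off: "(\<integral>x. \<psi> (x i) (x j) \<partial>?P) = ?J" if "i < ?N" "j < ?N" "i \<noteq> j" for i j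
  proof -
    have "?J = (\<integral>p. \<psi> (fst p) (snd p) \<partial>distr ?P (U \<Otimes>\<^sub>M U) (\<lambda>x. (x i, x j)))"
      using distr_PiM_pair[of "\<lambda>_. U" i "{..<?N}" j] U that by simp
    also have "\<dots> = (\<integral>x. \<psi> (x i) (x j) \<partial>?P)"
      by (subst integral_distr[OF measurable_Pair[OF comp[OF that(1)] comp[OF that(2)]] mp]) simp
    finally show ?thesis ..
  qed
  have le: "(\<integral>x. \<psi> (x i) (x j) \<partial>?P) \<le> (if i = j then C else ?J)" if "i < ?N" "j < ?N" for i j
  proof (cases "i = j")
    case True
    have "(\<integral>x. \<psi> (x i) (x j) \<partial>?P) \<le> (\<integral>x. C \<partial>?P)"
      using C by (intro integral_mono int that) (auto intro: order_trans[OF abs_ge_self])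
    then show ?thesis using True P.prob_space by simp
  next
    case False then show ?thesis using off[OF that] by simp
  qed
  have "0 \<le> (\<integral>x. (\<Sum>i<?N. \<Sum>j<?N. \<psi> (x i) (x j)) \<partial>?P)"
    by (intro integral_nonneg_AE AE_I2 pos)
  also have "\<dots> = (\<Sum>i<?N. \<Sum>j<?N. \<integral>x. \<psi> (x i) (x j) \<partial>?P)"
  proof -
    have "(\<integral>x. (\<Sum>i<?N. \<Sum>j<?N. \<psi> (x i) (x j)) \<partial>?P) = (\<Sum>i<?N. \<integral>x. (\<Sum>j<?N. \<psi> (x i) (x j)) \<partial>?P)"
      by (rule Bochner_Integration.integral_sum) (intro Bochner_Integration.integrable_sum int; simp)
    also have "\<dots> = (\<Sum>i<?N. \<Sum>j<?N. \<integral>x. \<psi> (x i) (x j) \<partial>?P)"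
      by (intro sum.cong refl Bochner_Integration.integral_sum int) simp_all
    finally show ?thesis .
  qed
  also have "\<dots> \<le> (\<Sum>i<?N. \<Sum>j<?N. if i = j then C else ?J)"
    by (intro sum_mono le) simp_all
  also have "\<dots> = (\<Sum>i<?N. C + real n * ?J)"
  proof (intro sum.cong refl)
    fix i assume i: "i \<in> {..<?N}"
    have "(\<Sum>j<?N. if i = j then C else ?J) = (\<Sum>j<?N. (if i = j then C - ?J else 0) + ?J)"
      by (intro sum.cong) auto
    also have "\<dots> = (C - ?J) + real ?N * ?J" using i by (simp add: sum.distrib)
    also have "\<dots> = C + real n * ?J" by (simp add: algebra_simps)
    finally show "(\<Sum>j<?N. if i = j then C else ?J) = C + real n * ?J" .
  qed
  also have "\<dots> = real ?N * (C + real n * ?J)" by simp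
  finally have "0 \<le> C + real n * ?J" by (simp add: zero_le_mult_iff)
  moreover have "C < real n * (- ?J)" using n J pos_divide_less_eq[of "- ?J" C "real n"] by simp
  ultimately show False by simp
qed

lemma integral_lborel_uminus:
  fixes f :: "'a::euclidean_space \<Rightarrow> real"
  assumes f: "f \<in> borel_measurable borel"
  shows "(\<integral>x. f (- x) \<partial>lborel) = (\<integral>x. f x \<partial>lborel)"
proof -
  have "lborel = distr lborel borel (\<lambda>x::'a. - x)"
    using lborel_affine[of "- 1" "0::'a"] by (simp add: density_1)
  then have "(\<integral>x. f x \<partial>lborel) = (\<integral>x. f x \<partial>distr lborel borel (\<lambda>x. - x))" by simp
  also have "\<dots> = (\<integral>x. f (- x) \<partial>lborel)" using f by (intro integral_distr) auto
  finally show ?thesis ..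
qed

lemma AE_lborel_continuous_zero:
  fixes f :: "'a::euclidean_space \<Rightarrow> real"
  assumes c: "continuous_on UNIV f" and AE: "AE x in lborel. f x = 0"
  shows "f a = 0"
proof (rule ccontr)
  assume a: "f a \<noteq> 0"
  have "open {x. f x \<noteq> 0}" using c by (intro open_Collect_neq continuous_on_const) simp_all
  then obtain r where r: "0 < r" "ball a r \<subseteq> {x. f x \<noteq> 0}"
    using a unfolding open_contains_ball by blast
  have "AE x in lborel. x \<notin> ball a r" using AE r(2) by (auto elim!: eventually_mono)
  then have "emeasure lborel (ball a r) = 0" by (subst (asm) AE_iff_measurable[where N = "ball a r"]) auto
  then show False using emeasure_lborel_ball_pos[OF r(1), of a] by simp
qed

context dpp
begin

text \<open>The Fourier transform of \<open>g\<close>, which is real because \<open>g\<close> is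
  even. The cosine form keeps the sign and strictness arguments inside the reals.\<close>

definition G :: "'a \<Rightarrow> real" where
  "G t = (\<integral>x. g x * cos (2 * pi * inner x t) \<partial>lborel)"

lemma gcos_integrable: "integrable lborel (\<lambda>x. g x * cos (2 * pi * inner x t))"
  by (rule Bochner_Integration.integrable_bound[OF g_integrable])
    (auto simp: abs_mult intro!: mult_left_le)

lemma fourier_g: "fourier (\<lambda>x. complex_of_real (g x)) t = complex_of_real (G t)"
proof -
  have i: "integrable lborel (\<lambda>x. complex_of_real (g x) * wave x t)"
    by (intro integrable_wave integrable_of_real g_integrable)
  have s: "(\<integral>x. g x * sin (2 * pi * inner x t) \<partial>lborel) = 0"
  proof -
    have "(\<integral>x. g x * sin (2 * pi * inner x t) \<partial>lborel) = (\<integral>x. g (- x) * sin (2 * pi * inner (- x) t) \<partial>lborel)"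
      by (rule integral_lborel_uminus[symmetric]) measurable
    also have "\<dots> = - (\<integral>x. g x * sin (2 * pi * inner x t) \<partial>lborel)"
      by (simp add: g_minus)
    finally show ?thesis by simp
  qed
  have "Re (fourier (\<lambda>x. complex_of_real (g x)) t) = G t"
    unfolding fourier_wave G_def by (subst integral_Re[OF i, symmetric]) (simp add: wave_cis)
  moreover have "Im (fourier (\<lambda>x. complex_of_real (g x)) t) = 0"
    unfolding fourier_wave by (subst integral_Im[OF i, symmetric]) (simp add: wave_cis s)
  ultimately show ?thesis by (simp add: complex_eq_iff)
qed

lemma G_le_1: "G t \<le> 1"
proof -
  have "G t \<le> (\<integral>x. g x \<partial>lborel)"
    unfolding G_def using g_bounds by (intro integral_mono gcos_integrable g_integrable) (simp add: mult_left_le)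
  with integral_g_le show ?thesis by linarith
qed

text \<open>As \<open>g\<close> has integral at most 1, the value 1 of its transform forces the
  nonnegative function \<open>?f\<close> to have integral zero, hence to vanish everywhere by
  continuity. Near the origin \<open>g\<close> is positive, so there the cosine would have to be 1,
  which fails along small multiples of \<open>t\<close>.\<close>

lemma G_eq_1:
  assumes "G t = 1"
  shows "t = 0"
proof (rule ccontr)
  assume t: "t \<noteq> 0"
  let ?f = "\<lambda>x. g x * (1 - cos (2 * pi * inner x t))"
  have i: "integrable lborel ?f"
    using Bochner_Integration.integrable_diff[OF g_integrable gcos_integrable[of t]] by (simp add: right_diff_distrib)
  have nn: "0 \<le> ?f x" for x using g_bounds(1)[of x] by simp
  have "(\<integral>x. ?f x \<partial>lborel) = (\<integral>x. g x \<partial>lborel) - G t"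
    unfolding G_def using Bochner_Integration.integral_diff[OF g_integrable gcos_integrable[of t]]
    by (simp add: right_diff_distrib)
  then have "(\<integral>x. ?f x \<partial>lborel) \<le> 0" using integral_g_le assms by simp
  moreover have "0 \<le> (\<integral>x. ?f x \<partial>lborel)" using nn by simp
  ultimately have "(\<integral>x. ?f x \<partial>lborel) = 0" by simp
  then have AE: "AE x in lborel. ?f x = 0"
    using integral_nonneg_eq_0_iff_AE[OF i] nn by simp
  have z: "?f x = 0" for x
    by (rule AE_lborel_continuous_zero[OF _ AE]) (intro continuous_intros g_cont)
  have "(\<lambda>n. g ((1 / real (Suc n)) *\<^sub>R t)) \<longlonglongrightarrow> g (0 *\<^sub>R t)"
  proof -
    have "(\<lambda>n. (1 / real (Suc n)) *\<^sub>R t) \<longlonglongrightarrow> 0 *\<^sub>R t"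
      by (intro tendsto_intros LIMSEQ_Suc[OF lim_1_over_n])
    moreover have "isCont g (0 *\<^sub>R t)" using g_cont by (simp add: continuous_on_eq_continuous_at)
    ultimately show ?thesis by (rule isCont_tendsto_compose[rotated])
  qed
  then have "eventually (\<lambda>n. 0 < g ((1 / real (Suc n)) *\<^sub>R t)) sequentially"
    by (rule order_tendstoD) (simp add: g_0)
  \<comment> \<open>At the point \<open>t / (n + 1)\<close> the cosine has argument
    \<open>2 * pi * a\<close> with \<open>a = inner t t / (n + 1)\<close>. This bound on
    \<open>n\<close> makes \<open>a\<close> less than 1, so \<open>a\<close> is positive but not an
    integer.\<close>
  moreover have "eventually (\<lambda>n. inner t t < real n) sequentially" by (rule eventually_less_real)
  ultimately have "eventually (\<lambda>n. 0 < g ((1 / real (Suc n)) *\<^sub>R t) \<and> inner t t < real n) sequentially"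
    by (rule eventually_conj)
  then obtain n where n: "0 < g ((1 / real (Suc n)) *\<^sub>R t)" "inner t t < real n"
    by (auto simp: eventually_sequentially)
  define a where "a = inner t t / real (Suc n)"
  have tt: "0 < inner t t" using t by simp
  then have a: "0 < a" "a < 1" using n by (auto simp: a_def field_simps)
  have "cos (2 * pi * a) = 1" using z[of "(1 / real (Suc n)) *\<^sub>R t"] n by (simp add: a_def)
  then obtain k :: int where k: "2 * pi * a = of_int k * (2 * pi)" using cos_one_2pi_int[of "2 * pi * a"] by auto
  then have "a = of_int k" by simp
  with a show False by simp
qed

text \<open>The Schur product theorem with the values of a character as coefficients; the real part
  of the product of two of them is the cosine of the difference. The kernel is pulled back to
  indices because the points \<open>X i\<close> may coincide.\<close>

lemma quadratic_form_nonneg: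
  fixes X :: "nat \<Rightarrow> 'a"
  shows "0 \<le> (\<Sum>i<n. \<Sum>j<n. g (X j - X i) * cos (2 * pi * inner (X j - X i) t))"
proof -
  interpret KX: pd_kernel "\<lambda>i j. K (X i) (X j)" by (rule comp_pd)
  have "0 \<le> Re (\<Sum>i<n. \<Sum>j<n. cis (2 * pi * inner (X i) t) * cnj (cis (2 * pi * inner (X j) t)) * complex_of_real ((cmod (K (X i) (X j)))\<^sup>2))"
    by (rule KX.schur_product) simp
  also have "\<dots> = (\<Sum>i<n. \<Sum>j<n. g (X j - X i) * cos (2 * pi * inner (X j - X i) t))"
    unfolding Re_sum
  proof (intro sum.cong refl)
    fix i j
    have "cis (2 * pi * inner (X i) t) * cnj (cis (2 * pi * inner (X j) t)) = cis (- (2 * pi * inner (X j - X i) t))"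
      by (simp add: cis_cnj cis_mult inner_diff_left algebra_simps)
    then show "Re (cis (2 * pi * inner (X i) t) * cnj (cis (2 * pi * inner (X j) t)) * complex_of_real ((cmod (K (X i) (X j)))\<^sup>2))
      = g (X j - X i) * cos (2 * pi * inner (X j - X i) t)"
      unfolding K_g by simp
  qed
  finally show ?thesis .
qed

text \<open>The mean of \<open>?\<psi>\<close> over two independent uniform points of the ball is
  nonnegative. It is stated as a comparison of two nonnegative integrals, so that the window
  estimates in \<open>ennreal\<close> apply to both sides.\<close>

lemma window_compare:
  assumes s: "0 < s"
  shows "(\<integral>\<^sup>+x. \<integral>\<^sup>+y. (indicator (ball 0 s) x * indicator (ball 0 s) y) * ennreal (g (y - x) * (1 - cos (2 * pi * inner (y - x) t))) \<partial>lborel \<partial>lborel)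
    \<le> (\<integral>\<^sup>+x. \<integral>\<^sup>+y. (indicator (ball 0 s) x * indicator (ball (0::'a) s) y) * ennreal (g (y - x)) \<partial>lborel \<partial>lborel)"
proof -
  let ?B = "ball (0::'a) s"
  let ?U = "uniform_measure lborel ?B"
  define V where "V = emeasure lborel ?B"
  have V: "V \<noteq> 0" "V < \<infinity>" unfolding V_def
    using emeasure_lborel_ball_pos[OF s, of "0::'a"] emeasure_lborel_ball_finite[of "0::'a" s] by simp_all
  have U: "prob_space ?U" using V by (intro prob_space_uniform_measure) (simp_all add: V_def)
  interpret U: prob_space ?U by (rule U)
  interpret UU: pair_prob_space ?U ?U ..
  let ?h = "\<lambda>x y. g (y - x) * (1 - cos (2 * pi * inner (y - x) t))"
  let ?\<psi> = "\<lambda>x y. g (y - x) * cos (2 * pi * inner (y - x) t)"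
  have m1[measurable]: "(\<lambda>p. ?h (fst p) (snd p)) \<in> borel_measurable (borel \<Otimes>\<^sub>M borel)" by measurable
  have m2[measurable]: "(\<lambda>p. g (snd p - fst p)) \<in> borel_measurable (borel \<Otimes>\<^sub>M borel)" by measurable
  have m3: "(\<lambda>(x, y). ?\<psi> x y) \<in> borel_measurable (borel \<Otimes>\<^sub>M borel)" by measurable
  have sUU: "sets (?U \<Otimes>\<^sub>M ?U) = sets (borel \<Otimes>\<^sub>M borel)" by (rule sets_pair_measure_cong) simp_all
  have m: "(\<lambda>p. ?h (fst p) (snd p)) \<in> borel_measurable (?U \<Otimes>\<^sub>M ?U)"
    "(\<lambda>p. g (snd p - fst p)) \<in> borel_measurable (?U \<Otimes>\<^sub>M ?U)"
    "(\<lambda>(x, y). ?\<psi> x y) \<in> borel_measurable (?U \<Otimes>\<^sub>M ?U)"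
    using m1 m2 m3 sUU by (simp_all cong: measurable_cong_sets)
  have hb: "0 \<le> ?h x y" "?h x y \<le> 2" for x y
  proof -
    show "0 \<le> ?h x y" using g_bounds by simp
    have "?h x y \<le> 1 * 2"
      using g_bounds cos_ge_minus_one[of "2 * pi * inner (y - x) t"] by (intro mult_mono) auto
    then show "?h x y \<le> 2" by simp
  qed
  have ih: "integrable (?U \<Otimes>\<^sub>M ?U) (\<lambda>p. ?h (fst p) (snd p))"
    using hb by (intro UU.integrable_const_bound[where B = 2] m) auto
  have ig: "integrable (?U \<Otimes>\<^sub>M ?U) (\<lambda>p. g (snd p - fst p))"
    using g_bounds by (intro UU.integrable_const_bound[where B = 1] m) auto
  have "0 \<le> (\<integral>p. ?\<psi> (fst p) (snd p) \<partial>(?U \<Otimes>\<^sub>M ?U))"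
  proof (rule positive_definite_average[OF U m(3), where C = 1])
    show "\<bar>?\<psi> x y\<bar> \<le> 1" for x y
      unfolding abs_mult using g_bounds[of "y - x"] abs_cos_le_one by (intro mult_le_one) auto
    show "0 \<le> (\<Sum>i<n. \<Sum>j<n. ?\<psi> (X i) (X j))" for n and X :: "nat \<Rightarrow> 'a" by (rule quadratic_form_nonneg)
  qed
  also have "(\<integral>p. ?\<psi> (fst p) (snd p) \<partial>(?U \<Otimes>\<^sub>M ?U)) = (\<integral>p. g (snd p - fst p) - ?h (fst p) (snd p) \<partial>(?U \<Otimes>\<^sub>M ?U))"
    by (intro Bochner_Integration.integral_cong) (simp_all add: algebra_simps)
  also have "\<dots> = (\<integral>p. g (snd p - fst p) \<partial>(?U \<Otimes>\<^sub>M ?U)) - (\<integral>p. ?h (fst p) (snd p) \<partial>(?U \<Otimes>\<^sub>M ?U))"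
    by (rule Bochner_Integration.integral_diff[OF ig ih])
  finally have "ennreal (\<integral>p. ?h (fst p) (snd p) \<partial>(?U \<Otimes>\<^sub>M ?U)) \<le> ennreal (\<integral>p. g (snd p - fst p) \<partial>(?U \<Otimes>\<^sub>M ?U))"
    by (intro ennreal_leI) simp
  then have le: "(\<integral>\<^sup>+p. ennreal (?h (fst p) (snd p)) \<partial>(?U \<Otimes>\<^sub>M ?U)) \<le> (\<integral>\<^sup>+p. ennreal (g (snd p - fst p)) \<partial>(?U \<Otimes>\<^sub>M ?U))"
    using nn_integral_eq_integral[OF ih] nn_integral_eq_integral[OF ig] hb g_bounds by simp
  \<comment> \<open>Each uniform measure is Lebesgue measure on the ball divided by
    \<open>V\<close>; multiplying by \<open>V * V\<close> restores the unnormalised window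
    integrals.\<close>
  have conv: "(\<integral>\<^sup>+p. f (fst p) (snd p) \<partial>(?U \<Otimes>\<^sub>M ?U)) * (V * V)
    = (\<integral>\<^sup>+x. \<integral>\<^sup>+y. (indicator ?B x * indicator ?B y) * f x y \<partial>lborel \<partial>lborel)"
    if f[measurable]: "(\<lambda>(x, y). f x y) \<in> borel_measurable (borel \<Otimes>\<^sub>M borel)" for f :: "'a \<Rightarrow> 'a \<Rightarrow> ennreal"
  proof -
    have fU: "(\<lambda>(x, y). f x y) \<in> borel_measurable (?U \<Otimes>\<^sub>M ?U)"
      using f sUU by (simp cong: measurable_cong_sets)
    have u: "(\<integral>\<^sup>+x. k x \<partial>?U) * V = (\<integral>\<^sup>+x. k x * indicator ?B x \<partial>lborel)"
      if "k \<in> borel_measurable borel" for k :: "'a \<Rightarrow> ennreal"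
    proof -
      have "(\<integral>\<^sup>+x. k x \<partial>?U) = (\<integral>\<^sup>+x. k x * indicator ?B x \<partial>lborel) / V"
        unfolding V_def using that by (intro nn_integral_uniform_measure) simp_all
      then show ?thesis using V by (simp add: ennreal_divide_times mult_divide_eq_ennreal)
    qed
    have fx: "f x \<in> borel_measurable borel" for x using measurable_Pair2[OF f, of x] by simp
    have "(\<integral>\<^sup>+p. f (fst p) (snd p) \<partial>(?U \<Otimes>\<^sub>M ?U)) = (\<integral>\<^sup>+x. \<integral>\<^sup>+y. f x y \<partial>?U \<partial>?U)"
      using U.nn_integral_fst[OF fU] by (simp add: case_prod_beta')
    then have "(\<integral>\<^sup>+p. f (fst p) (snd p) \<partial>(?U \<Otimes>\<^sub>M ?U)) * (V * V) = (\<integral>\<^sup>+x. \<integral>\<^sup>+y. f x y \<partial>?U \<partial>?U) * V * V"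
      by (simp only: mult.assoc)
    also have "\<dots> = (\<integral>\<^sup>+x. (\<integral>\<^sup>+y. f x y \<partial>?U) * indicator ?B x \<partial>lborel) * V"
    proof (subst u)
      have "(\<lambda>x. \<integral>\<^sup>+y. f x y \<partial>?U) \<in> borel_measurable ?U"
        using U.borel_measurable_nn_integral[OF fU] by simp
      then show "(\<lambda>x. \<integral>\<^sup>+y. f x y \<partial>?U) \<in> borel_measurable borel" by simp
    qed simp
    also have "\<dots> = (\<integral>\<^sup>+x. ((\<integral>\<^sup>+y. f x y \<partial>?U) * indicator ?B x) * V \<partial>lborel)"
    proof (rule nn_integral_multc[symmetric])
      have "(\<lambda>x. \<integral>\<^sup>+y. f x y \<partial>?U) \<in> borel_measurable ?U"
        using U.borel_measurable_nn_integral[OF fU] by simp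
      then have [measurable]: "(\<lambda>x. \<integral>\<^sup>+y. f x y \<partial>?U) \<in> borel_measurable borel" by simp
      show "(\<lambda>x. (\<integral>\<^sup>+y. f x y \<partial>?U) * indicator ?B x) \<in> borel_measurable lborel" by measurable
    qed
    also have "\<dots> = (\<integral>\<^sup>+x. \<integral>\<^sup>+y. (indicator ?B x * indicator ?B y) * f x y \<partial>lborel \<partial>lborel)"
    proof (rule nn_integral_cong)
      fix x
      have "((\<integral>\<^sup>+y. f x y \<partial>?U) * indicator ?B x) * V = indicator ?B x * ((\<integral>\<^sup>+y. f x y \<partial>?U) * V)" by (simp only: mult_ac)
      also have "\<dots> = indicator ?B x * (\<integral>\<^sup>+y. f x y * indicator ?B y \<partial>lborel)" unfolding u[OF fx] ..
      also have "\<dots> = (\<integral>\<^sup>+y. indicator ?B x * (f x y * indicator ?B y) \<partial>lborel)"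
        using fx[of x] by (intro nn_integral_cmult[symmetric]) measurable
      finally show "((\<integral>\<^sup>+y. f x y \<partial>?U) * indicator ?B x) * V = (\<integral>\<^sup>+y. (indicator ?B x * indicator ?B y) * f x y \<partial>lborel)"
        by (simp only: mult_ac)
    qed
    finally show ?thesis .
  qed
  have c1: "(\<integral>\<^sup>+p. ennreal (?h (fst p) (snd p)) \<partial>(?U \<Otimes>\<^sub>M ?U)) * (V * V)
    = (\<integral>\<^sup>+x. \<integral>\<^sup>+y. (indicator ?B x * indicator ?B y) * ennreal (?h x y) \<partial>lborel \<partial>lborel)"
    by (rule conv) measurable
  have c2: "(\<integral>\<^sup>+p. ennreal (g (snd p - fst p)) \<partial>(?U \<Otimes>\<^sub>M ?U)) * (V * V)
    = (\<integral>\<^sup>+x. \<integral>\<^sup>+y. (indicator ?B x * indicator ?B y) * ennreal (g (y - x)) \<partial>lborel \<partial>lborel)"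
    by (rule conv[of "\<lambda>x y. ennreal (g (y - x))"]) measurable
  show ?thesis
    unfolding c1[symmetric] c2[symmetric] by (rule mult_right_mono[OF le]) simp
qed


text \<open>In the limit of large windows the comparison becomes: the integral of \<open>g\<close>
  times one minus cosine is at most the integral of \<open>g\<close>. The difference of the two is
  \<open>G t\<close>.\<close>

lemma G_nonneg: "0 \<le> G t"
proof -
  let ?h = "\<lambda>x. g x * (1 - cos (2 * pi * inner x t))"
  let ?I = "\<integral>\<^sup>+z. ennreal (g z) \<partial>lborel"
  have [measurable]: "?h \<in> borel_measurable borel" by measurable
  have "(\<integral>\<^sup>+z. ennreal (?h z) \<partial>lborel) \<le> ?I"
  proof (rule nn_integral_le_ballI)
    fix r :: real assume r: "0 < r"
    show "(\<integral>\<^sup>+z. ennreal (?h z) * indicator (ball 0 r) z \<partial>lborel) \<le> ?I"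
    proof (rule window_limit[OF r])
      show "?I < \<infinity>" using nn_integral_g by (rule le_less_trans) simp
      fix n assume n: "r < real n"
      let ?W = "\<lambda>\<phi>. \<integral>\<^sup>+x. \<integral>\<^sup>+y. (indicator (ball 0 (real n)) x * indicator (ball (0::'a) (real n)) y) * \<phi> (y - x) \<partial>lborel \<partial>lborel"
      have "emeasure lborel (ball (0::'a) (real n - r)) * (\<integral>\<^sup>+z. ennreal (?h z) * indicator (ball 0 r) z \<partial>lborel)
        \<le> ?W (\<lambda>z. ennreal (?h z) * indicator (ball 0 r) z)"
        by (rule window_integral_ge) simp_all
      also have "\<dots> \<le> ?W (\<lambda>z. ennreal (?h z))"
        by (intro nn_integral_mono mult_left_mono) (simp_all add: indicator_def)
      also have "\<dots> \<le> ?W (\<lambda>z. ennreal (g z))"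
        by (rule window_compare) (use n r in linarith)
      also have "\<dots> \<le> emeasure lborel (ball (0::'a) (real n)) * ?I"
        by (rule window_integral_le) simp
      finally show "emeasure lborel (ball (0::'a) (real n - r)) * (\<integral>\<^sup>+z. ennreal (?h z) * indicator (ball 0 r) z \<partial>lborel)
        \<le> emeasure lborel (ball (0::'a) (real n)) * ?I" .
    qed
  qed measurable
  moreover have i: "integrable lborel ?h"
    using Bochner_Integration.integrable_diff[OF g_integrable gcos_integrable[of t]] by (simp add: right_diff_distrib)
  moreover have "0 \<le> ?h x" for x using g_bounds(1)[of x] by simp
  ultimately have "ennreal (\<integral>x. ?h x \<partial>lborel) \<le> ennreal (\<integral>x. g x \<partial>lborel)"
    using nn_integral_eq_integral[OF i] nn_integral_eq_integral[OF g_integrable] g_bounds(1) by simp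
  moreover have "0 \<le> (\<integral>x. g x \<partial>lborel)" using g_bounds(1) by simp
  ultimately have "(\<integral>x. ?h x \<partial>lborel) \<le> (\<integral>x. g x \<partial>lborel)" by simp
  moreover have "(\<integral>x. ?h x \<partial>lborel) = (\<integral>x. g x \<partial>lborel) - G t"
    unfolding G_def using Bochner_Integration.integral_diff[OF g_integrable gcos_integrable[of t]]
    by (simp add: right_diff_distrib)
  ultimately show ?thesis by simp
qed

end

section \<open>Almost sure asymptotics of pair counts\<close>

text \<open>The square is a sum over two pairs \<open>(i, j)\<close> and \<open>(k, l)\<close>. If
  the four labels are distinct, the exact product is kept. Otherwise the pairs share a label in one
  of four ways, whence the factor 4, and each way is bounded by the sum over \<open>i\<close> of the
  squared row sums of \<open>H\<close>. The symmetric majorant \<open>H\<close> is there because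
  \<open>F\<close> need not be symmetric, whereas the shared label may sit in either
  position.\<close>

lemma pair_sum_square_le:
  fixes F H :: "nat \<Rightarrow> nat \<Rightarrow> ennreal" and I :: "nat set"
  assumes FH: "\<And>i j. F i j \<le> H i j" and H: "\<And>i j. H i j = H j i"
  defines "S \<equiv> (\<lambda>f. \<integral>\<^sup>+i. f i \<partial>count_space I)"
  shows "(S (\<lambda>i. S (\<lambda>j. indicator {(i, j). i \<noteq> j} (i, j) * F i j)))\<^sup>2
    \<le> S (\<lambda>i. S (\<lambda>j. S (\<lambda>k. S (\<lambda>l. indicator {(i, j, k, l). distinct [i, j, k, l]} (i, j, k, l) * (F i j * F k l)))))
      + 4 * (S (\<lambda>i. S (\<lambda>j. S (\<lambda>k. indicator {(i, j, k). distinct [i, j, k]} (i, j, k) * (H i j * H i k))))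
        + S (\<lambda>i. S (\<lambda>j. indicator {(i, j). i \<noteq> j} (i, j) * (H i j * H i j))))"
proof -
  define e where "e i j = (indicator {(i, j). i \<noteq> j} (i, j) :: ennreal)" for i j :: nat
  define d where "d i j k l = (indicator {(i, j, k, l). distinct [i, j, k, l]} (i, j, k, l) :: ennreal)" for i j k l :: nat
  define \<delta> where "\<delta> i j = (indicator {(i, j). i = j} (i, j) :: ennreal)" for i j :: nat
  have mono: "S f \<le> S h" if "\<And>i. i \<in> I \<Longrightarrow> f i \<le> h i" for f h
    unfolding S_def using that by (intro nn_integral_mono) simp
  have add: "S (\<lambda>i. f i + h i) = S f + S h" for f h unfolding S_def by (rule nn_integral_add) simp_all
  have cm: "S (\<lambda>i. c * f i) = c * S f" for c f unfolding S_def by (rule nn_integral_cmult) simp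
  have mc: "S (\<lambda>i. f i * c) = S f * c" for c f unfolding S_def by (rule nn_integral_multc) simp
  have swap: "S (\<lambda>i. S (\<lambda>j. f i j)) = S (\<lambda>j. S (\<lambda>i. f i j))" for f
  proof -
    interpret sigma_finite_measure "count_space I" by (rule sigma_finite_measure_count_space_countable) simp
    interpret pair_sigma_finite "count_space I" "count_space I" ..
    have "count_space I \<Otimes>\<^sub>M count_space I = count_space (I \<times> I)" by (rule pair_measure_countable) simp_all
    then show ?thesis unfolding S_def by (intro Fubini') simp
  qed
  have single: "S (\<lambda>j. \<delta> i j * f j) = f i" if "i \<in> I" for i f
    unfolding S_def \<delta>_def using that by (subst nn_integral_count_space'[of "{i}"]) auto
  define T where "T = S (\<lambda>i. S (\<lambda>j. e i j * F i j))"
  define R where "R i = S (\<lambda>l. e i l * H i l)" for i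
  \<comment> \<open>For a fixed pair \<open>(i, j)\<close>, a second pair either avoids both labels
    or has one of them as first or second entry; symmetry of \<open>H\<close> brings the shared
    label to the front, so each of \<open>R i\<close> and \<open>R j\<close> occurs twice.\<close>
  have T_le: "T \<le> S (\<lambda>k. S (\<lambda>l. d i j k l * F k l)) + 2 * (R i + R j)" if ij: "i \<in> I" "j \<in> I" "i \<noteq> j" for i j
  proof -
    have "T \<le> S (\<lambda>k. S (\<lambda>l. d i j k l * F k l + (\<delta> i k * (e i l * H i l) + \<delta> i l * (e i k * H i k)
      + (\<delta> j k * (e j l * H j l) + \<delta> j l * (e j k * H j k)))))"
      unfolding T_def
    proof (intro mono)
      fix k l
      have F1: "F k l \<le> H l k" using FH[of k l] H[of k l] by simp
      consider "k = l" | "k = i" "k \<noteq> l" | "l = i" "k \<noteq> l" | "k = j" "k \<noteq> l" | "l = j" "k \<noteq> l"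
        | "distinct [i, j, k, l]" using ij by auto
      then show "e k l * F k l \<le> d i j k l * F k l + (\<delta> i k * (e i l * H i l) + \<delta> i l * (e i k * H i k)
      + (\<delta> j k * (e j l * H j l) + \<delta> j l * (e j k * H j k)))"
      proof cases
        case 1 then show ?thesis by (simp add: e_def)
      next
        case 2
        then have "e k l * F k l \<le> \<delta> i k * (e i l * H i l)" using FH[of k l] by (simp add: e_def \<delta>_def)
        also have "\<dots> \<le> d i j k l * F k l + (\<delta> i k * (e i l * H i l) + \<delta> i l * (e i k * H i k)
      + (\<delta> j k * (e j l * H j l) + \<delta> j l * (e j k * H j k)))" by (simp add: add_increasing add_increasing2)
        finally show ?thesis .
      next
        case 3
        then have "e k l * F k l \<le> \<delta> i l * (e i k * H i k)" using F1 by (simp add: e_def \<delta>_def)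
        also have "\<dots> \<le> d i j k l * F k l + (\<delta> i k * (e i l * H i l) + \<delta> i l * (e i k * H i k)
      + (\<delta> j k * (e j l * H j l) + \<delta> j l * (e j k * H j k)))" by (simp add: add_increasing add_increasing2)
        finally show ?thesis .
      next
        case 4
        then have "e k l * F k l \<le> \<delta> j k * (e j l * H j l)" using FH[of k l] by (simp add: e_def \<delta>_def)
        also have "\<dots> \<le> d i j k l * F k l + (\<delta> i k * (e i l * H i l) + \<delta> i l * (e i k * H i k)
      + (\<delta> j k * (e j l * H j l) + \<delta> j l * (e j k * H j k)))" by (simp add: add_increasing add_increasing2)
        finally show ?thesis .
      next
        case 5
        then have "e k l * F k l \<le> \<delta> j l * (e j k * H j k)" using F1 by (simp add: e_def \<delta>_def)
        also have "\<dots> \<le> d i j k l * F k l + (\<delta> i k * (e i l * H i l) + \<delta> i l * (e i k * H i k)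
      + (\<delta> j k * (e j l * H j l) + \<delta> j l * (e j k * H j k)))" by (simp add: add_increasing add_increasing2)
        finally show ?thesis .
      next
        case 6
        then have "e k l * F k l = d i j k l * F k l" by (simp add: e_def d_def)
        also have "\<dots> \<le> d i j k l * F k l + (\<delta> i k * (e i l * H i l) + \<delta> i l * (e i k * H i k)
      + (\<delta> j k * (e j l * H j l) + \<delta> j l * (e j k * H j k)))" by simp
        finally show ?thesis .
      qed
    qed
    also have "\<dots> = S (\<lambda>k. S (\<lambda>l. d i j k l * F k l)) + (R i + R i + (R j + R j))"
      using ij by (simp add: add cm single R_def)
    also have "R i + R i + (R j + R j) = 2 * (R i + R j)" by (simp add: mult_2 add_ac)
    finally show ?thesis .
  qed
  have "T\<^sup>2 = S (\<lambda>i. S (\<lambda>j. (e i j * F i j) * T))"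
    by (simp only: power2_eq_square mc T_def[symmetric])
  also have "\<dots> \<le> S (\<lambda>i. S (\<lambda>j. (e i j * F i j) * S (\<lambda>k. S (\<lambda>l. d i j k l * F k l))
     + (2 * ((e i j * H i j) * R i) + 2 * ((e j i * H j i) * R j))))"
  proof (intro mono)
    fix i j assume ij: "i \<in> I" "j \<in> I"
    show "(e i j * F i j) * T \<le> (e i j * F i j) * S (\<lambda>k. S (\<lambda>l. d i j k l * F k l))
     + (2 * ((e i j * H i j) * R i) + 2 * ((e j i * H j i) * R j))"
    proof (cases "i = j")
      case True then show ?thesis by (simp add: e_def)
    next
      case False
      have a: "e i j * F i j \<le> e i j * H i j" by (rule mult_left_mono[OF FH]) simp
      have b: "e i j * F i j \<le> e j i * H j i" using FH[of i j] H[of i j] by (auto simp: e_def indicator_def)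
      have "(e i j * F i j) * T \<le> (e i j * F i j) * (S (\<lambda>k. S (\<lambda>l. d i j k l * F k l)) + 2 * (R i + R j))"
        by (rule mult_left_mono[OF T_le[OF ij False]]) simp
      also have "\<dots> = (e i j * F i j) * S (\<lambda>k. S (\<lambda>l. d i j k l * F k l)) + (2 * ((e i j * F i j) * R i) + 2 * ((e i j * F i j) * R j))"
        by (simp only: distrib_left mult_ac)
      also have "\<dots> \<le> (e i j * F i j) * S (\<lambda>k. S (\<lambda>l. d i j k l * F k l)) + (2 * ((e i j * H i j) * R i) + 2 * ((e j i * H j i) * R j))"
        by (rule add_left_mono[OF add_mono[OF mult_left_mono[OF mult_right_mono[OF a]] mult_left_mono[OF mult_right_mono[OF b]]]]) simp_all
      finally show ?thesis .
    qed
  qed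
  also have "\<dots> = S (\<lambda>i. S (\<lambda>j. (e i j * F i j) * S (\<lambda>k. S (\<lambda>l. d i j k l * F k l))))
     + (2 * S (\<lambda>i. R i * R i) + 2 * S (\<lambda>i. S (\<lambda>j. (e j i * H j i) * R j)))"
    by (simp only: add cm mc R_def[symmetric])
  also have "S (\<lambda>i. S (\<lambda>j. (e j i * H j i) * R j)) = S (\<lambda>j. R j * R j)"
    by (subst swap) (simp only: mc R_def[symmetric])
  also have "S (\<lambda>i. S (\<lambda>j. (e i j * F i j) * S (\<lambda>k. S (\<lambda>l. d i j k l * F k l))))
    = S (\<lambda>i. S (\<lambda>j. S (\<lambda>k. S (\<lambda>l. d i j k l * (F i j * F k l)))))"
  proof -
    have "(e i j * F i j) * (d i j k l * F k l) = d i j k l * (F i j * F k l)" for i j k l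
      by (auto simp: e_def d_def indicator_def)
    then show ?thesis by (simp only: cm[symmetric])
  qed
  also have "2 * S (\<lambda>i. R i * R i) + 2 * S (\<lambda>i. R i * R i) = 4 * S (\<lambda>i. R i * R i)"
    by (simp flip: distrib_right)
  \<comment> \<open>In the square of a row sum, different second labels give triples and equal ones
    give pairs.\<close>
  also have "S (\<lambda>i. R i * R i) \<le> S (\<lambda>i. S (\<lambda>j. S (\<lambda>k. indicator {(i, j, k). distinct [i, j, k]} (i, j, k) * (H i j * H i k))))
        + S (\<lambda>i. S (\<lambda>j. e i j * (H i j * H i j)))"
  proof -
    have "S (\<lambda>i. R i * R i) = S (\<lambda>i. S (\<lambda>j. S (\<lambda>k. (e i j * H i j) * (e i k * H i k))))"
      by (simp only: R_def cm mc)
    also have "\<dots> \<le> S (\<lambda>i. S (\<lambda>j. S (\<lambda>k. indicator {(i, j, k). distinct [i, j, k]} (i, j, k) * (H i j * H i k) + \<delta> j k * (e i k * (H i k * H i k)))))"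
      by (intro mono) (auto simp: e_def \<delta>_def indicator_def)
    also have "\<dots> = S (\<lambda>i. S (\<lambda>j. S (\<lambda>k. indicator {(i, j, k). distinct [i, j, k]} (i, j, k) * (H i j * H i k))
        + S (\<lambda>k. \<delta> j k * (e i k * (H i k * H i k)))))" by (simp only: add)
    also have "\<dots> \<le> S (\<lambda>i. S (\<lambda>j. S (\<lambda>k. indicator {(i, j, k). distinct [i, j, k]} (i, j, k) * (H i j * H i k))
        + e i j * (H i j * H i j)))"
    proof (intro mono add_left_mono)
      fix i j assume "j \<in> I"
      then show "S (\<lambda>k. \<delta> j k * (e i k * (H i k * H i k))) \<le> e i j * (H i j * H i j)"
        using single[of j "\<lambda>k. e i k * (H i k * H i k)"] by simp
    qed
    finally show ?thesis by (simp only: add)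
  qed
  finally show ?thesis
    unfolding T_def e_def d_def by (simp add: mult_left_mono)
qed

text \<open>Between consecutive squares, monotonicity encloses \<open>x n\<close> by the values at
  both ends, and the ratio of consecutive squares tends to 1, so the normalisation changes by a
  negligible factor.\<close>

lemma square_subsequence_tendsto:
  fixes x :: "nat \<Rightarrow> real"
  assumes mono: "incseq x" and x0: "\<And>n. 0 \<le> x n"
    and lim: "(\<lambda>k. x (k\<^sup>2) / real (k\<^sup>2) ^ d) \<longlonglongrightarrow> L"
  shows "(\<lambda>n. x n / real n ^ d) \<longlonglongrightarrow> L"
proof -
  define a where "a k = x (k\<^sup>2) / real (k\<^sup>2) ^ d" for k :: nat
  define s where "s n = nat \<lfloor>sqrt (real n)\<rfloor>" for n
  have s: "(s n)\<^sup>2 \<le> n" "n < (Suc (s n))\<^sup>2" for n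
  proof -
    have nn: "0 \<le> \<lfloor>sqrt (real n)\<rfloor>" by simp
    have r: "real (s n) \<le> sqrt (real n)" "sqrt (real n) < real (s n) + 1"
      unfolding s_def using nn by (auto simp: of_nat_nat)
    have "(real (s n))\<^sup>2 \<le> (sqrt (real n))\<^sup>2" using r by (intro power_mono) auto
    then have "real ((s n)\<^sup>2) \<le> real n" by simp
    then show "(s n)\<^sup>2 \<le> n" by (simp only: of_nat_le_iff)
    have "(sqrt (real n))\<^sup>2 < (real (s n) + 1)\<^sup>2" using r by (intro power_strict_mono) auto
    then have "real n < real ((Suc (s n))\<^sup>2)" by (simp add: add.commute)
    then show "n < (Suc (s n))\<^sup>2" by (simp only: of_nat_less_iff)
  qed
  have s_top: "filterlim s at_top sequentially"
    unfolding filterlim_at_top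
  proof
    fix Z :: nat
    show "eventually (\<lambda>n. Z \<le> s n) sequentially"
      using eventually_ge_at_top[of "Z\<^sup>2"]
    proof eventually_elim
      case (elim n)
      then have "Z\<^sup>2 < (Suc (s n))\<^sup>2" using s(2)[of n] by simp
      then have "Z < Suc (s n)" by (rule power_less_imp_less_base) simp
      then show ?case by simp
    qed
  qed
  have q: "(\<lambda>k. real (Suc k) / real k) \<longlonglongrightarrow> 1" "(\<lambda>k. real k / real (Suc k)) \<longlonglongrightarrow> 1"
    by (rule LIMSEQ_Suc_n_over_n, rule LIMSEQ_n_over_Suc_n)
  have aL: "a \<longlonglongrightarrow> L" using lim unfolding a_def .
  have up: "(\<lambda>k. a (Suc k) * ((real (Suc k) / real k) ^ 2) ^ d) \<longlonglongrightarrow> L * (1 ^ 2) ^ d"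
    by (intro tendsto_intros q LIMSEQ_Suc[OF aL])
  have lo: "(\<lambda>k. a k * ((real k / real (Suc k)) ^ 2) ^ d) \<longlonglongrightarrow> L * (1 ^ 2) ^ d"
    by (intro tendsto_intros q aL)
  show ?thesis
  proof (rule tendsto_sandwich)
    show "(\<lambda>n. a (s n) * ((real (s n) / real (Suc (s n))) ^ 2) ^ d) \<longlonglongrightarrow> L"
      using filterlim_compose[OF lo s_top] by simp
    show "(\<lambda>n. a (Suc (s n)) * ((real (Suc (s n)) / real (s n)) ^ 2) ^ d) \<longlonglongrightarrow> L"
      using filterlim_compose[OF up s_top] by simp
    have ev: "eventually (\<lambda>n. 0 < s n) sequentially"
      using filterlim_at_top[THEN iffD1, rule_format, OF s_top, of 1] by (rule eventually_mono) simp
    show "eventually (\<lambda>n. a (s n) * ((real (s n) / real (Suc (s n))) ^ 2) ^ d \<le> x n / real n ^ d) sequentially"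
      using ev
    proof eventually_elim
      case (elim n)
      have n0: "0 < n" using s(1)[of n] elim by (metis le_zero_eq neq0_conv power_eq_0_iff zero_less_power)
      have "a (s n) * ((real (s n) / real (Suc (s n))) ^ 2) ^ d = x ((s n)\<^sup>2) / (real ((Suc (s n))\<^sup>2)) ^ d"
        using elim by (simp add: a_def power_divide del: of_nat_Suc)
      also have "\<dots> \<le> x n / (real ((Suc (s n))\<^sup>2)) ^ d"
        using incseqD[OF mono s(1)[of n]] by (intro divide_right_mono) simp_all
      also have "\<dots> \<le> x n / real n ^ d"
      proof (intro divide_left_mono power_mono)
        show "real n \<le> real ((Suc (s n))\<^sup>2)" using s(2)[of n] by (simp only: of_nat_le_iff less_imp_le)
        show "0 < real ((Suc (s n))\<^sup>2) ^ d * real n ^ d" using n0 by simp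
      qed (simp_all add: x0)
      finally show ?case .
    qed
    show "eventually (\<lambda>n. x n / real n ^ d \<le> a (Suc (s n)) * ((real (Suc (s n)) / real (s n)) ^ 2) ^ d) sequentially"
      using ev
    proof eventually_elim
      case (elim n)
      have n0: "0 < n" using s(1)[of n] elim by (metis le_zero_eq neq0_conv power_eq_0_iff zero_less_power)
      have "x n / real n ^ d \<le> x ((Suc (s n))\<^sup>2) / real n ^ d"
        using incseqD[OF mono less_imp_le[OF s(2)[of n]]] by (intro divide_right_mono) simp_all
      also have "\<dots> \<le> x ((Suc (s n))\<^sup>2) / real ((s n)\<^sup>2) ^ d"
      proof (intro divide_left_mono power_mono)
        show "real ((s n)\<^sup>2) \<le> real n" using s(1)[of n] by (simp only: of_nat_le_iff)
        show "0 < real n ^ d * real ((s n)\<^sup>2) ^ d" using n0 elim by simp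
      qed (simp_all add: x0)
      also have "\<dots> = a (Suc (s n)) * ((real (Suc (s n)) / real (s n)) ^ 2) ^ d"
        using elim by (simp add: a_def power_divide del: of_nat_Suc)
      finally show ?case .
    qed
  qed
qed


text \<open>Here \<open>b\<close> plays the role of a variance bound. The term
  \<open>2 * e * X\<close> is added to both sides so that the expansion of the square involves only
  nonnegative quantities, and the finite part \<open>2 * e * e\<close> is cancelled at the
  end.\<close>

lemma (in prob_space) second_moment_centered:
  fixes X :: "'a \<Rightarrow> ennreal"
  assumes X[measurable]: "X \<in> borel_measurable M"
    and E: "(\<integral>\<^sup>+w. X w \<partial>M) = ennreal e" "0 \<le> e"
    and V: "(\<integral>\<^sup>+w. X w * X w \<partial>M) \<le> ennreal e * ennreal e + b"
  shows "(\<integral>\<^sup>+w. ennreal ((enn2real (X w) - e)\<^sup>2) \<partial>M) \<le> b"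
proof -
  have AE: "AE w in M. X w \<noteq> \<infinity>"
    using nn_integral_PInf_AE[OF X] E by simp
  let ?D = "\<integral>\<^sup>+w. ennreal ((enn2real (X w) - e)\<^sup>2) \<partial>M"
  have ee: "ennreal e * ennreal e < \<infinity>" by (simp add: ennreal_mult_less_top)
  have "(\<integral>\<^sup>+w. 2 * ennreal e * X w \<partial>M) = 2 * ennreal e * ennreal e"
    unfolding E(1)[symmetric] by (rule nn_integral_cmult) measurable
  then have "(ennreal e * ennreal e + ennreal e * ennreal e) + ?D = (\<integral>\<^sup>+w. 2 * ennreal e * X w \<partial>M) + ?D"
    by (simp only: mult_2 distrib_right)
  also have "\<dots> = (\<integral>\<^sup>+w. 2 * ennreal e * X w + ennreal ((enn2real (X w) - e)\<^sup>2) \<partial>M)"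
    by (rule nn_integral_add[symmetric]) measurable
  also have "\<dots> = (\<integral>\<^sup>+w. X w * X w + ennreal e * ennreal e \<partial>M)"
    using AE
  proof (intro nn_integral_cong_AE, eventually_elim)
    case (elim w)
    then obtain x where x: "X w = ennreal x" "0 \<le> x" by (cases "X w") auto
    have "2 * e * x + (x - e)\<^sup>2 = x * x + e * e" by (simp add: power2_eq_square algebra_simps)
    then have "ennreal (2 * e * x + (x - e)\<^sup>2) = ennreal (x * x + e * e)" by simp
    then show ?case using x E(2)
      by (simp add: ennreal_mult[symmetric] ennreal_plus[symmetric] ennreal_numeral[symmetric] del: ennreal_plus ennreal_numeral)
  qed
  also have "\<dots> = (\<integral>\<^sup>+w. X w * X w \<partial>M) + ennreal e * ennreal e"
    by (subst nn_integral_add) (simp_all add: emeasure_space_1)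
  also have "\<dots> \<le> (ennreal e * ennreal e + b) + ennreal e * ennreal e"
    by (rule add_right_mono[OF V])
  also have "\<dots> = (ennreal e * ennreal e + ennreal e * ennreal e) + b" by (simp only: add_ac)
  finally show ?thesis by (rule ennreal_add_le_cancel) (use ee in simp)
qed

text \<open>At radius \<open>N = (k + 1)^2\<close> the normalised variance is at most
  \<open>b / N ^ d\<close>, hence at most \<open>b / (k + 1)^2\<close>. The sum of the squared
  relative deviations thus has finite expectation, so it is almost surely finite and its terms tend
  to 0. Monotonicity then fills the gaps between the squares.\<close>

lemma (in prob_space) second_moment_strong_law:
  fixes X :: "nat \<Rightarrow> 'a \<Rightarrow> ennreal"
  assumes X: "\<And>n. X n \<in> borel_measurable M"
    and mono: "\<And>w. w \<in> space M \<Longrightarrow> incseq (\<lambda>n. X n w)"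
    and E: "\<And>n. (\<integral>\<^sup>+w. X n w \<partial>M) = ennreal (e n)" "\<And>n. 0 \<le> e n"
    and eL: "(\<lambda>n. e n / real n ^ d) \<longlonglongrightarrow> L" and d: "0 < d"
    and V: "\<And>n. (\<integral>\<^sup>+w. X n w * X n w \<partial>M) \<le> ennreal (e n) * ennreal (e n) + ennreal (b * real n ^ d)"
    and b: "0 \<le> b"
  shows "AE w in M. (\<lambda>n. enn2real (X n w) / real n ^ d) \<longlonglongrightarrow> L"
proof -
  note X[measurable]
  \<comment> \<open>The index is shifted by one so that the normalisation is never 0.\<close>
  define N where "N k = (Suc k)\<^sup>2" for k :: nat
  define Y where "Y k w = (enn2real (X (N k) w) - e (N k))\<^sup>2 / (real (N k) ^ d)\<^sup>2" for k w
  have N0: "0 < real (N k) ^ d" for k by (simp add: N_def)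
  have [measurable]: "Y k \<in> borel_measurable M" for k unfolding Y_def by measurable
  have Y0: "0 \<le> Y k w" for k w by (simp add: Y_def)
  have EY: "(\<integral>\<^sup>+w. ennreal (Y k w) \<partial>M) \<le> ennreal (b * (1 / real (Suc k) ^ 2))" for k
  proof -
    let ?c = "1 / (real (N k) ^ d)\<^sup>2"
    have "(\<integral>\<^sup>+w. ennreal (Y k w) \<partial>M) = (\<integral>\<^sup>+w. ennreal ?c * ennreal ((enn2real (X (N k) w) - e (N k))\<^sup>2) \<partial>M)"
      by (intro nn_integral_cong) (simp add: Y_def ennreal_mult[symmetric])
    also have "\<dots> = ennreal ?c * (\<integral>\<^sup>+w. ennreal ((enn2real (X (N k) w) - e (N k))\<^sup>2) \<partial>M)"
      by (rule nn_integral_cmult) measurable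
    also have "\<dots> \<le> ennreal ?c * ennreal (b * real (N k) ^ d)"
      by (rule mult_left_mono[OF second_moment_centered[OF X E V]]) simp
    also have "\<dots> = ennreal (b * (1 / real (N k) ^ d))"
      using b N0[of k] by (simp add: ennreal_mult[symmetric] power2_eq_square)
    also have "\<dots> \<le> ennreal (b * (1 / real (Suc k) ^ 2))"
    proof (intro ennreal_leI mult_left_mono divide_left_mono b)
      have "real (N k) ^ 1 \<le> real (N k) ^ d" using d by (intro power_increasing) (simp_all add: N_def)
      then show "real (Suc k) ^ 2 \<le> real (N k) ^ d" by (simp add: N_def del: of_nat_Suc)
    qed (use N0 in simp_all)
    finally show ?thesis .
  qed
  have "(\<integral>\<^sup>+w. (\<Sum>k. ennreal (Y k w)) \<partial>M) = (\<Sum>k. \<integral>\<^sup>+w. ennreal (Y k w) \<partial>M)"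
    by (rule nn_integral_suminf) measurable
  also have "\<dots> \<le> (\<Sum>k. ennreal (b * (1 / real (Suc k) ^ 2)))"
    by (intro suminf_le EY) simp_all
  also have "\<dots> < \<infinity>"
  proof -
    have "summable (\<lambda>k. 1 / real k ^ 2)" using inverse_power_summable[of 2, where 'a = real] by (simp add: inverse_eq_divide)
    have nn: "0 \<le> b * (1 / real (Suc k) ^ 2)" for k using b by simp
    from summable_Suc_iff[THEN iffD2, OF \<open>summable (\<lambda>k. 1 / real k ^ 2)\<close>] have "summable (\<lambda>k. b * (1 / real (Suc k) ^ 2))"
      by (rule summable_mult)
    from ennreal_suminf_neq_top[OF this nn] show ?thesis
      unfolding infinity_ennreal_def less_top[symmetric] .
  qed
  finally have fin: "(\<integral>\<^sup>+w. (\<Sum>k. ennreal (Y k w)) \<partial>M) \<noteq> \<infinity>" by simp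
  have AE1: "AE w in M. (\<Sum>k. ennreal (Y k w)) \<noteq> \<infinity>"
    by (rule nn_integral_PInf_AE[OF _ fin]) measurable
  have "AE w in M. X n w \<noteq> \<infinity>" for n
    using nn_integral_PInf_AE[OF X] E by simp
  then have AE2: "AE w in M. \<forall>n. X n w \<noteq> \<infinity>" by (simp add: AE_all_countable)
  show ?thesis
    using AE1 AE2 AE_space
  proof eventually_elim
    case (elim w)
    let ?x = "\<lambda>n. enn2real (X n w)"
    have "summable (\<lambda>k. Y k w)" using elim(1) Y0 by (intro summable_suminf_not_top) simp_all
    then have "(\<lambda>k. Y k w) \<longlonglongrightarrow> 0" by (rule summable_LIMSEQ_zero)
    then have "(\<lambda>k. sqrt (Y k w)) \<longlonglongrightarrow> 0" using tendsto_real_sqrt[of "\<lambda>k. Y k w" 0] by simp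
    then have "(\<lambda>k. \<bar>(?x (N k) - e (N k)) / real (N k) ^ d\<bar>) \<longlonglongrightarrow> 0"
      by (simp add: Y_def real_sqrt_divide real_sqrt_abs abs_divide)
    then have z: "(\<lambda>k. (?x (N k) - e (N k)) / real (N k) ^ d) \<longlonglongrightarrow> 0" by (rule tendsto_rabs_zero_cancel)
    have "filterlim N at_top sequentially"
      by (rule filterlim_subseq) (simp add: strict_mono_def N_def power_strict_mono)
    then have "(\<lambda>k. e (N k) / real (N k) ^ d) \<longlonglongrightarrow> L" by (rule filterlim_compose[OF eL])
    from tendsto_add[OF z this] have "(\<lambda>k. ?x (N k) / real (N k) ^ d) \<longlonglongrightarrow> L"
      by (simp add: diff_divide_distrib)
    then have lim: "(\<lambda>k. ?x (k\<^sup>2) / real (k\<^sup>2) ^ d) \<longlonglongrightarrow> L"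
      unfolding N_def by (subst (asm) filterlim_sequentially_Suc)
    have inc: "incseq ?x"
      using mono[OF elim(3)] elim(2) unfolding incseq_def
      by (intro allI impI enn2real_mono) (simp_all add: less_top)
    show ?case by (rule square_subsequence_tendsto[OF inc _ lim]) simp
  qed
qed

context dpp
begin

definition pair_count :: "'a set \<Rightarrow> nat \<Rightarrow> 'w \<Rightarrow> ennreal" where
  "pair_count C n w = tuple_sum 2 (\<omega> w) (\<lambda>x. (indicator (ball 0 (real n)) (x 0) * indicator (ball 0 (real n)) (x 1)) * indicator C (x 1 - x 0))"

text \<open>The mean lies between the window integrals for the shrunken and the full ball, which
  gives its asymptotics. In the second moment the four-point term is at most the squared mean, and
  the remainder is bounded by a constant times the volume.\<close>

lemma pair_count_strong_law:
  assumes C[measurable]: "C \<in> sets borel" and r: "0 < r" "C \<subseteq> ball 0 r"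
  defines "c \<equiv> (\<integral>x. (1 - g x) * indicator C x \<partial>lborel)"
  shows "AE w in P. (\<lambda>n. enn2real (pair_count C n w) / real n ^ DIM('a)) \<longlonglongrightarrow> unit_ball_vol (real DIM('a)) * c"
proof -
  let ?B = "\<lambda>n::nat. ball (0::'a) (real n)"
  let ?D = "ball (0::'a) r"
  let ?v = "unit_ball_vol (real DIM('a))"
  have v: "0 < ?v" by (rule unit_ball_vol_pos) simp
  define F where "F n x y = (indicator (?B n) x * indicator (?B n) y) * (indicator C (y - x) :: ennreal)" for n and x y :: 'a
  \<comment> \<open>The ball around 0 that contains \<open>C\<close> replaces \<open>C\<close>
    itself: \<open>C\<close> need not be symmetric, while the expansion of the square asks for a
    symmetric majorant. The integral of \<open>H n x\<close> is at most \<open>q\<close>, uniformly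
    in \<open>x\<close> and \<open>n\<close>.\<close>
  define H where "H n x y = (indicator (?B n) x * indicator (?B n) y) * (indicator ?D (y - x) :: ennreal)" for n and x y :: 'a
  have mF[measurable]: "(\<lambda>(x, y). F n x y) \<in> borel_measurable (borel \<Otimes>\<^sub>M borel)" for n unfolding F_def by measurable
  have mH[measurable]: "(\<lambda>(x, y). H n x y) \<in> borel_measurable (borel \<Otimes>\<^sub>M borel)" for n unfolding H_def by measurable
  have pc: "pair_count C n w = tuple_sum 2 (\<omega> w) (\<lambda>x. F n (x 0) (x 1))" for n w
    by (simp add: pair_count_def F_def)
  have FH: "F n x y \<le> H n x y" for n x y
    using r(2) unfolding F_def H_def by (intro mult_left_mono) (auto simp: indicator_def)
  have Hs: "H n x y = H n y x" for n x y
    by (simp add: H_def indicator_def norm_minus_commute mult_ac)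
  have HH: "H n x y * H n x y = H n x y" for n x y by (simp add: H_def indicator_def)
  define \<phi> where "\<phi> z = ennreal (1 - g z) * indicator C z" for z
  have m\<phi>[measurable]: "\<phi> \<in> borel_measurable borel" unfolding \<phi>_def by measurable
  define W where "W n = (\<integral>\<^sup>+x. \<integral>\<^sup>+y. (indicator (?B n) x * indicator (?B n) y) * \<phi> (y - x) \<partial>lborel \<partial>lborel)" for n
  define R where "R n = (\<integral>\<^sup>+x. \<integral>\<^sup>+y. (indicator (?B n) x * indicator (?B n) y) * indicator ?D (y - x) \<partial>lborel \<partial>lborel)" for n
  define V where "V n = emeasure lborel (?B n)" for n
  define q where "q = emeasure lborel ?D"
  have q: "q < \<infinity>" unfolding q_def by (rule emeasure_lborel_ball_finite)
  have Vn: "V n = ennreal (?v * real n ^ DIM('a))" for n unfolding V_def by (rule emeasure_ball_eq) simp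
  have EW: "(\<integral>\<^sup>+w. pair_count C n w \<partial>P) = W n" for n
    unfolding pc E2[OF mF] W_def
    by (intro nn_integral_cong) (simp add: F_def \<phi>_def \<rho>2_g mult_ac)
  have ic: "integrable lborel (\<lambda>x. (1 - g x) * indicator C x)"
  proof (rule Bochner_Integration.integrable_bound)
    show "integrable lborel (indicator ?D :: 'a \<Rightarrow> real)"
      using emeasure_lborel_ball_finite[of "0::'a" r] by (intro integrable_real_indicator) simp_all
    show "(\<lambda>x. (1 - g x) * indicator C x) \<in> borel_measurable lborel" by measurable
    show "AE x in lborel. norm ((1 - g x) * indicator C x) \<le> norm (indicator ?D x :: real)"
      using r(2) g_bounds by (intro AE_I2) (auto simp: indicator_def)
  qed
  have I\<phi>: "(\<integral>\<^sup>+z. \<phi> z \<partial>lborel) = ennreal c"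
  proof -
    have "(\<integral>\<^sup>+z. \<phi> z \<partial>lborel) = (\<integral>\<^sup>+z. ennreal ((1 - g z) * indicator C z) \<partial>lborel)"
      by (intro nn_integral_cong) (simp add: \<phi>_def indicator_def)
    also have "\<dots> = ennreal c"
      unfolding c_def using g_bounds by (intro nn_integral_eq_integral[OF ic]) simp
    finally show ?thesis .
  qed
  have c0: "0 \<le> c" unfolding c_def using g_bounds by (intro integral_nonneg_AE AE_I2) simp
  have Wle: "W n \<le> V n * ennreal c" for n
    unfolding W_def V_def I\<phi>[symmetric] by (rule window_integral_le) measurable
  have Wge: "emeasure lborel (ball (0::'a) (real n - r)) * ennreal c \<le> W n" for n
    unfolding W_def I\<phi>[symmetric] using r(2) by (intro window_integral_ge) (auto simp: \<phi>_def indicator_def)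
  have Wfin: "W n < \<infinity>" for n
    using Wle[of n] by (rule le_less_trans) (simp add: Vn ennreal_mult_less_top)
  define e where "e n = enn2real (W n)" for n
  have We: "W n = ennreal (e n)" and e0: "0 \<le> e n" for n using Wfin[of n] by (simp_all add: e_def less_top)
  have eup: "e n \<le> ?v * real n ^ DIM('a) * c" for n
    using Wle[of n] c0 v by (simp add: We Vn ennreal_mult[symmetric])
  have elo: "?v * (real n - r) ^ DIM('a) * c \<le> e n" if "r < real n" for n
    using Wge[of n] c0 v that e0[of n] by (simp add: We emeasure_ball_eq ennreal_mult[symmetric])
  have eL: "(\<lambda>n. e n / real n ^ DIM('a)) \<longlonglongrightarrow> ?v * c"
  proof (rule tendsto_sandwich)
    show "(\<lambda>n. ?v * c * ((real n - r) / real n) ^ DIM('a)) \<longlonglongrightarrow> ?v * c"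
      using tendsto_mult_left[OF shrink_tendsto_1, of "?v * c"] by simp
    show "(\<lambda>n. ?v * c) \<longlonglongrightarrow> ?v * c" by simp
    show "eventually (\<lambda>n. ?v * c * ((real n - r) / real n) ^ DIM('a) \<le> e n / real n ^ DIM('a)) sequentially"
      using eventually_less_real[of r]
    proof eventually_elim
      case (elim n)
      then have n0: "0 < real n ^ DIM('a)" using r(1) by simp
      then show ?case using elo[OF elim] by (simp add: power_divide divide_right_mono mult_ac)
    qed
    show "eventually (\<lambda>n. e n / real n ^ DIM('a) \<le> ?v * c) sequentially"
      using eventually_less_real[of r]
    proof eventually_elim
      case (elim n)
      then have n0: "0 < real n ^ DIM('a)" using r(1) by simp
      then show ?case using eup[of n] by (simp add: divide_le_eq mult_ac)
    qed
  qed
  have E3': "(\<integral>\<^sup>+w. tuple_sum 3 (\<omega> w) (\<lambda>x. H n (x 0) (x 1) * H n (x 0) (x 2)) \<partial>P) \<le> V n * (q * q)" for n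
  proof -
    have "(\<integral>\<^sup>+w. tuple_sum 3 (\<omega> w) (\<lambda>x. H n (x 0) (x 1) * H n (x 0) (x 2)) \<partial>P)
      \<le> (\<integral>\<^sup>+x. \<integral>\<^sup>+y. \<integral>\<^sup>+z. H n x y * H n x z \<partial>lborel \<partial>lborel \<partial>lborel)"
      by (rule E3) measurable
    also have "\<dots> \<le> (\<integral>\<^sup>+x. indicator (?B n) x * (q * q) \<partial>lborel)"
    proof (rule nn_integral_mono)
      fix x
      have Hx: "(\<lambda>y. H n x y) \<in> borel_measurable borel" using measurable_Pair2[OF mH, of x n] by simp
      have Hq: "(\<integral>\<^sup>+y. H n x y \<partial>lborel) \<le> indicator (?B n) x * q"
      proof -
        have "(\<integral>\<^sup>+y. H n x y \<partial>lborel) \<le> (\<integral>\<^sup>+y. indicator (?B n) x * indicator ?D (y - x) \<partial>lborel)"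
          unfolding H_def by (intro nn_integral_mono mult_right_mono) (simp_all add: indicator_def)
        also have "\<dots> = indicator (?B n) x * q"
          using nn_integral_lborel_translate[of "indicator ?D" "- x"]
          by (subst nn_integral_cmult) (simp_all add: q_def)
        finally show ?thesis .
      qed
      have "(\<integral>\<^sup>+y. \<integral>\<^sup>+z. H n x y * H n x z \<partial>lborel \<partial>lborel) = (\<integral>\<^sup>+y. H n x y \<partial>lborel) * (\<integral>\<^sup>+y. H n x y \<partial>lborel)"
        using Hx by (simp add: nn_integral_cmult nn_integral_multc)
      also have "\<dots> \<le> (indicator (?B n) x * q) * (indicator (?B n) x * q)"
        by (intro mult_mono Hq) simp_all
      also have "\<dots> = indicator (?B n) x * (q * q)" by (simp add: indicator_def)
      finally show "(\<integral>\<^sup>+y. \<integral>\<^sup>+z. H n x y * H n x z \<partial>lborel \<partial>lborel) \<le> indicator (?B n) x * (q * q)" .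
    qed
    also have "\<dots> = V n * (q * q)" unfolding V_def by (rule nn_integral_window)
    finally show ?thesis .
  qed
  have E2': "(\<integral>\<^sup>+w. tuple_sum 2 (\<omega> w) (\<lambda>x. H n (x 0) (x 1) * H n (x 0) (x 1)) \<partial>P) \<le> V n * q" for n
  proof -
    have "(\<integral>\<^sup>+w. tuple_sum 2 (\<omega> w) (\<lambda>x. H n (x 0) (x 1) * H n (x 0) (x 1)) \<partial>P)
      = (\<integral>\<^sup>+x. \<integral>\<^sup>+y. ennreal (\<rho>2 x y) * H n x y \<partial>lborel \<partial>lborel)"
      unfolding HH by (rule E2[OF mH])
    also have "\<dots> \<le> (\<integral>\<^sup>+x. \<integral>\<^sup>+y. (indicator (?B n) x * indicator (?B n) y) * indicator ?D (y - x) \<partial>lborel \<partial>lborel)"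
    proof (intro nn_integral_mono)
      fix x y
      have "ennreal (\<rho>2 x y) * H n x y \<le> 1 * H n x y"
        using \<rho>2_bounds(2)[of x y] by (intro mult_right_mono) (simp_all add: ennreal_le_1)
      then show "ennreal (\<rho>2 x y) * H n x y \<le> (indicator (?B n) x * indicator (?B n) y) * indicator ?D (y - x)"
        by (simp add: H_def)
    qed
    also have "\<dots> \<le> V n * (\<integral>\<^sup>+z. indicator ?D z \<partial>lborel)"
      unfolding V_def by (rule window_integral_le) measurable
    finally show ?thesis by (simp add: q_def)
  qed
  \<comment> \<open>By \<open>E4\<close> the four-point term contributes at most
    \<open>W n * W n\<close>, the square of the mean; the other two terms grow only like the volume
    \<open>V n\<close>.\<close>
  have V2: "(\<integral>\<^sup>+w. pair_count C n w * pair_count C n w \<partial>P) \<le> W n * W n + 4 * (V n * (q * q) + V n * q)" for n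
  proof -
    let ?t4 = "\<lambda>w. tuple_sum 4 (\<omega> w) (\<lambda>x. F n (x 0) (x 1) * F n (x 2) (x 3))"
    let ?t3 = "\<lambda>w. tuple_sum 3 (\<omega> w) (\<lambda>x. H n (x 0) (x 1) * H n (x 0) (x 2))"
    let ?t2 = "\<lambda>w. tuple_sum 2 (\<omega> w) (\<lambda>x. H n (x 0) (x 1) * H n (x 0) (x 1))"
    have m4: "(\<lambda>(x, y, z, u). F n x y * F n z u) \<in> borel_measurable (borel \<Otimes>\<^sub>M borel \<Otimes>\<^sub>M borel \<Otimes>\<^sub>M borel)" by measurable
    have m3: "(\<lambda>(x, y, z). H n x y * H n x z) \<in> borel_measurable (borel \<Otimes>\<^sub>M borel \<Otimes>\<^sub>M borel)" by measurable
    have m2: "(\<lambda>(x, y). H n x y * H n x y) \<in> borel_measurable (borel \<Otimes>\<^sub>M borel)" by measurable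
    have mt: "?t4 \<in> borel_measurable P" "?t3 \<in> borel_measurable P" "?t2 \<in> borel_measurable P"
      using campbell(1)[OF measurable_PiM_4[OF m4]] campbell(1)[OF measurable_PiM_3[OF m3]] campbell(1)[OF measurable_PiM_2[OF m2]]
      by simp_all
    have lin: "(\<integral>\<^sup>+w. a w + 4 * (b w + c w) \<partial>P) = (\<integral>\<^sup>+w. a w \<partial>P) + 4 * ((\<integral>\<^sup>+w. b w \<partial>P) + (\<integral>\<^sup>+w. c w \<partial>P))"
      if [measurable]: "a \<in> borel_measurable P" "b \<in> borel_measurable P" "c \<in> borel_measurable P" for a b c
    proof -
      have "(\<integral>\<^sup>+w. a w + 4 * (b w + c w) \<partial>P) = (\<integral>\<^sup>+w. a w \<partial>P) + (\<integral>\<^sup>+w. 4 * (b w + c w) \<partial>P)"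
        by (rule nn_integral_add) measurable
      also have "(\<integral>\<^sup>+w. 4 * (b w + c w) \<partial>P) = 4 * (\<integral>\<^sup>+w. b w + c w \<partial>P)"
        by (rule nn_integral_cmult) measurable
      also have "(\<integral>\<^sup>+w. b w + c w \<partial>P) = (\<integral>\<^sup>+w. b w \<partial>P) + (\<integral>\<^sup>+w. c w \<partial>P)"
        by (rule nn_integral_add) measurable
      finally show ?thesis .
    qed
    have "(\<integral>\<^sup>+w. pair_count C n w * pair_count C n w \<partial>P) \<le> (\<integral>\<^sup>+w. ?t4 w + 4 * (?t3 w + ?t2 w) \<partial>P)"
    proof (rule nn_integral_mono)
      fix w
      show "pair_count C n w * pair_count C n w \<le> ?t4 w + 4 * (?t3 w + ?t2 w)"
        using pair_sum_square_le[of "\<lambda>i j. F n (pos (\<omega> w) i) (pos (\<omega> w) j)" "\<lambda>i j. H n (pos (\<omega> w) i) (pos (\<omega> w) j)" "idx (\<omega> w)", OF FH Hs, unfolded power2_eq_square]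
        unfolding pc tuple_sum_2[of "\<omega> w" "F n"] tuple_sum_2[of "\<omega> w" "\<lambda>x y. H n x y * H n x y"]
          tuple_sum_3[of "\<omega> w" "\<lambda>x y z. H n x y * H n x z"] tuple_sum_4[of "\<omega> w" "\<lambda>x y z u. F n x y * F n z u"] .
    qed
    also have "\<dots> = (\<integral>\<^sup>+w. ?t4 w \<partial>P) + 4 * ((\<integral>\<^sup>+w. ?t3 w \<partial>P) + (\<integral>\<^sup>+w. ?t2 w \<partial>P))"
      by (rule lin[OF mt])
    also have "\<dots> \<le> W n * W n + 4 * (V n * (q * q) + V n * q)"
    proof (intro add_mono mult_left_mono E3' E2')
      show "(\<integral>\<^sup>+w. ?t4 w \<partial>P) \<le> W n * W n"
        using E4[OF mF] unfolding E2[OF mF, symmetric] pc[symmetric] EW power2_eq_square .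
    qed simp
    finally show ?thesis .
  qed
  obtain Q where Q: "q = ennreal Q" "0 \<le> Q" using q by (cases q) auto
  show ?thesis
  proof (rule second_moment_strong_law[OF _ _ _ e0 eL])
    show "pair_count C n \<in> borel_measurable P" for n
      unfolding pc[abs_def] by (rule campbell(1)[OF measurable_PiM_2[OF mF]])
    show "incseq (\<lambda>n. pair_count C n w)" for w
      unfolding incseq_def
    proof (intro allI impI)
      fix m n :: nat assume mn: "m \<le> n"
      have "F m x y \<le> F n x y" for x y
        unfolding F_def using mn by (intro mult_right_mono mult_mono indicator_leI) simp_all
      then show "pair_count C m w \<le> pair_count C n w"
        unfolding pc tuple_sum_2[of "\<omega> w" "F m"] tuple_sum_2[of "\<omega> w" "F n"] by (intro nn_integral_mono mult_left_mono) simp_all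
    qed
    show "(\<integral>\<^sup>+w. pair_count C n w \<partial>P) = ennreal (e n)" for n unfolding EW We ..
    show "0 < DIM('a)" by simp
    show "0 \<le> 4 * (?v * (Q * Q) + ?v * Q)" using v Q by simp
    show "(\<integral>\<^sup>+w. pair_count C n w * pair_count C n w \<partial>P)
      \<le> ennreal (e n) * ennreal (e n) + ennreal (4 * (?v * (Q * Q) + ?v * Q) * real n ^ DIM('a))" for n
    proof -
      have "4 * (V n * (q * q) + V n * q) = ennreal (4 * (?v * (Q * Q) + ?v * Q) * real n ^ DIM('a))"
        using v Q by (simp add: Vn ennreal_mult[symmetric] ennreal_plus[symmetric] ennreal_numeral[symmetric] del: ennreal_plus ennreal_numeral)
          (simp add: algebra_simps)
      then show ?thesis using V2[of n] unfolding We by simp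
    qed
  qed
qed

text \<open>The variance of the count is at most its mean because \<open>\<rho>2\<close> is at most
  1. The result supplies the weight of the unit mass at 0 in the autocorrelation.\<close>

lemma count_strong_law:
  "AE w in P. (\<lambda>n. enn2real (emeasure (\<omega> w) (ball 0 (real n))) / real n ^ DIM('a)) \<longlonglongrightarrow> unit_ball_vol (real DIM('a))"
proof -
  let ?B = "\<lambda>n::nat. ball (0::'a) (real n)"
  let ?v = "unit_ball_vol (real DIM('a))"
  define e where "e n = ?v * real n ^ DIM('a)" for n
  have v: "0 < ?v" by (rule unit_ball_vol_pos) simp
  have e: "emeasure lborel (?B n) = ennreal (e n)" for n unfolding e_def by (rule emeasure_ball_eq) simp
  show ?thesis
  proof (rule second_moment_strong_law[where e = e and b = ?v])
    show "(\<lambda>w. emeasure (\<omega> w) (?B n)) \<in> borel_measurable P" for n by (rule emeasure_\<omega>_measurable) simp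
    show "incseq (\<lambda>n. emeasure (\<omega> w) (?B n))" if w: "w \<in> space P" for w
      unfolding incseq_def
    proof (intro allI impI emeasure_mono)
      show "?B n \<in> sets (\<omega> w)" for n using counting_measuresD(1)[OF \<omega>_counting[OF w]] by simp
    qed (simp add: subset_ball)
    show "(\<integral>\<^sup>+w. emeasure (\<omega> w) (?B n) \<partial>P) = ennreal (e n)" for n
      using dens by (simp add: has_mean_density_def e)
    show "0 \<le> e n" for n using v by (simp add: e_def)
    show "(\<lambda>n. e n / real n ^ DIM('a)) \<longlonglongrightarrow> ?v"
    proof (rule Lim_transform_eventually[OF tendsto_const])
      show "eventually (\<lambda>n. ?v = e n / real n ^ DIM('a)) sequentially"
        using eventually_gt_at_top[of 0] by eventually_elim (simp add: e_def)
    qed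
    show "0 < DIM('a)" "0 \<le> ?v" using v by simp_all
    show "(\<integral>\<^sup>+w. emeasure (\<omega> w) (?B n) * emeasure (\<omega> w) (?B n) \<partial>P)
      \<le> ennreal (e n) * ennreal (e n) + ennreal (?v * real n ^ DIM('a))" for n
    proof -
      have "(\<integral>\<^sup>+w. emeasure (\<omega> w) (?B n) * emeasure (\<omega> w) (?B n) \<partial>P)
        = (\<integral>\<^sup>+x. \<integral>\<^sup>+y. ennreal (\<rho>2 x y) * (indicator (?B n) x * indicator (?B n) y) \<partial>lborel \<partial>lborel) + emeasure lborel (?B n)"
        by (subst second_moment) simp_all
      also have "\<dots> \<le> (\<integral>\<^sup>+x. \<integral>\<^sup>+y. 1 * (indicator (?B n) x * indicator (?B n) y) \<partial>lborel \<partial>lborel) + emeasure lborel (?B n)"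
        using \<rho>2_bounds(2) by (intro add_right_mono nn_integral_mono mult_right_mono) (simp_all add: ennreal_le_1)
      also have "\<dots> = ennreal (e n) * ennreal (e n) + ennreal (e n)"
        using emeasure_ball_product[of "?B n" "?B n"] by (simp add: e)
      finally show ?thesis by (simp add: e_def)
    qed
  qed
qed

end

section \<open>Vague convergence of the autocorrelation\<close>

text \<open>The half-open dyadic cube of side \<open>2 ^ -m\<close> with lower corner
  \<open>corner m z\<close>. Floors make the cubes of one level a partition, and there are only
  countably many over all levels, so that a single exceptional null event suffices.\<close>

definition cell :: "nat \<Rightarrow> int ^ 'd \<Rightarrow> (real ^ 'd) set" where
  "cell m z = {x. \<forall>i. \<lfloor>2 ^ m * vec_nth x i\<rfloor> = vec_nth z i}"

definition corner :: "nat \<Rightarrow> int ^ 'd \<Rightarrow> real ^ 'd" where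
  "corner m z = (\<chi> i. real_of_int (vec_nth z i) / 2 ^ m)"

lemma cell_borel [measurable]: "cell m z \<in> sets borel"
proof -
  have m: "(\<lambda>x::real ^ 'd. 2 ^ m * vec_nth x i) \<in> borel_measurable borel" for i
    by (intro borel_measurable_continuous_onI continuous_intros)
  have "cell m z = (\<Inter>i\<in>UNIV. (\<lambda>x. 2 ^ m * vec_nth x i) -` {real_of_int (vec_nth z i) ..< real_of_int (vec_nth z i) + 1} \<inter> space borel)"
    by (auto simp: cell_def floor_eq_iff)
  also have "\<dots> \<in> sets borel"
    by (intro sets.finite_INT measurable_sets[OF m]) simp_all
  finally show ?thesis .
qed

text \<open>The Euclidean norm is at most the sum of the absolute coordinates, each of which is at
  most the side length.\<close>

lemma dist_corner:
  fixes x :: "real ^ 'd"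
  assumes "x \<in> cell m z"
  shows "norm (x - corner m z) \<le> real CARD('d) / 2 ^ m"
proof -
  have c: "\<bar>vec_nth (x - corner m z) i\<bar> \<le> 1 / 2 ^ m" for i
  proof -
    have "\<lfloor>2 ^ m * vec_nth x i\<rfloor> = vec_nth z i" using assms by (simp add: cell_def)
    then have "real_of_int (vec_nth z i) \<le> 2 ^ m * vec_nth x i" "2 ^ m * vec_nth x i < real_of_int (vec_nth z i) + 1"
      by (simp_all add: floor_eq_iff)
    moreover have "vec_nth (x - corner m z) i = (2 ^ m * vec_nth x i - real_of_int (vec_nth z i)) / 2 ^ m"
      by (simp add: corner_def diff_divide_distrib)
    ultimately show ?thesis by (simp add: abs_divide divide_right_mono)
  qed
  have "norm (x - corner m z) \<le> (\<Sum>i\<in>UNIV. \<bar>vec_nth (x - corner m z) i\<bar>)" by (rule norm_le_l1_cart)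
  also have "\<dots> \<le> (\<Sum>i\<in>(UNIV :: 'd set). 1 / 2 ^ m)" by (intro sum_mono c)
  finally show ?thesis by simp
qed

lemma cell_unique: "x \<in> cell m z \<Longrightarrow> x \<in> cell m z' \<Longrightarrow> z = z'"
  by (simp add: cell_def Finite_Cartesian_Product.vec_eq_iff)

lemma cell_bounded: "bounded (cell m z)"
proof -
  have "cell m z \<subseteq> cball (corner m z) (real CARD('a) / 2 ^ m)"
    using dist_corner[of _ m z] by (auto simp: dist_norm norm_minus_commute)
  then show ?thesis by (rule bounded_subset[OF bounded_cball])
qed

lemma finite_cells:
  fixes R :: real
  shows "finite {z :: int ^ 'd. cell m z \<inter> cball 0 R \<noteq> {}}"
proof -
  let ?b = "\<lceil>2 ^ m * R\<rceil> + 1"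
  have "{z :: int ^ 'd. cell m z \<inter> cball 0 R \<noteq> {}} \<subseteq> {z. \<forall>i. vec_nth z i \<in> {- ?b..?b}}"
  proof
    fix z :: "int ^ 'd"
    assume "z \<in> {z. cell m z \<inter> cball 0 R \<noteq> {}}"
    then obtain x where xz: "x \<in> cell m z" "norm x \<le> R" by auto
    have "vec_nth z i \<in> {- ?b..?b}" for i
    proof -
      have e: "\<lfloor>2 ^ m * vec_nth x i\<rfloor> = vec_nth z i" using xz(1) by (simp add: cell_def)
      have "\<bar>vec_nth x i\<bar> \<le> R" using component_le_norm_cart[of x i] xz(2) by linarith
      then have a: "\<bar>2 ^ m * vec_nth x i\<bar> \<le> 2 ^ m * R" by (simp add: abs_mult)
      have "2 ^ m * vec_nth x i \<le> of_int \<lceil>2 ^ m * R\<rceil>" "- of_int \<lceil>2 ^ m * R\<rceil> \<le> 2 ^ m * vec_nth x i"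
        using a le_of_int_ceiling[of "2 ^ m * R"] by linarith+
      then have "- \<lceil>2 ^ m * R\<rceil> \<le> \<lfloor>2 ^ m * vec_nth x i\<rfloor>" "\<lfloor>2 ^ m * vec_nth x i\<rfloor> \<le> \<lceil>2 ^ m * R\<rceil>"
        by linarith+
      then show ?thesis unfolding e by simp
    qed
    then show "z \<in> {z. \<forall>i. vec_nth z i \<in> {- ?b..?b}}" by blast
  qed
  moreover have "finite {z :: int ^ 'd. \<forall>i. vec_nth z i \<in> {- ?b..?b}}"
  proof -
    have "{z :: int ^ 'd. \<forall>i. vec_nth z i \<in> {- ?b..?b}} \<subseteq> vec_lambda ` (PiE UNIV (\<lambda>_. {- ?b..?b}))"
    proof
      fix z :: "int ^ 'd" assume "z \<in> {z. \<forall>i. vec_nth z i \<in> {- ?b..?b}}"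
      then have "vec_nth z \<in> PiE UNIV (\<lambda>_. {- ?b..?b})" by (simp add: PiE_UNIV_domain)
      then show "z \<in> vec_lambda ` (PiE UNIV (\<lambda>_. {- ?b..?b}))" by (rule image_eqI[rotated]) simp
    qed
    then show ?thesis by (rule finite_subset) (intro finite_imageI finite_PiE; simp)
  qed
  ultimately show ?thesis by (rule finite_subset)
qed

text \<open>A continuous function of compact support is uniformly close to a step function on the
  cells of a fine level. Convergence is assumed on the cells themselves, so no discussion of their
  boundaries is needed.\<close>

lemma vague_from_cells:
  fixes \<mu> :: "nat \<Rightarrow> (real ^ 'd) measure" and \<gamma> :: "(real ^ 'd) measure"
  assumes s: "\<And>n. sets (\<mu> n) = sets borel" "sets \<gamma> = sets borel"
    and fin: "\<And>n A. A \<in> sets borel \<Longrightarrow> bounded A \<Longrightarrow> emeasure (\<mu> n) A < \<infinity>"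
      "\<And>A. A \<in> sets borel \<Longrightarrow> bounded A \<Longrightarrow> emeasure \<gamma> A < \<infinity>"
    and conv: "\<And>m z. (\<lambda>n. measure (\<mu> n) (cell m z)) \<longlonglongrightarrow> measure \<gamma> (cell m z)"
  shows "vague_limit \<mu> \<gamma>"
  unfolding vague_limit_def
proof (intro conjI allI impI)
  show "locally_finite \<gamma>" using s fin by (simp add: locally_finite_def)
next
  fix f :: "real ^ 'd \<Rightarrow> real"
  assume cf: "continuous_on UNIV f" and cs: "compact (closure {x. f x \<noteq> 0})"
  let ?d = "real CARD('d)"
  obtain R where R: "\<And>x. x \<in> closure {x. f x \<noteq> 0} \<Longrightarrow> norm x \<le> R"
    using compact_imp_bounded[OF cs] by (auto simp: bounded_iff)
  have f0: "f x = 0" if "x \<notin> cball 0 R" for x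
  proof (rule ccontr)
    assume "f x \<noteq> 0"
    then have "x \<in> closure {x. f x \<noteq> 0}" using closure_subset[of "{x. f x \<noteq> 0}"] by auto
    with R that show False by simp
  qed
  \<comment> \<open>Points of a cell lie within \<open>?d / 2 ^ m\<close>, hence within
    \<open>?d\<close>, of its corner. Going from a point of the support ball to the corner and on to
    another point of the cell adds at most \<open>2 * ?d\<close> to the norm.\<close>
  let ?K = "cball (0 :: real ^ 'd) (R + 2 * ?d)"
  have uc: "uniformly_continuous_on ?K f"
    by (rule compact_uniformly_continuous[OF continuous_on_subset[OF cf]]) simp_all
  define A where "A = measure \<gamma> ?K"
  have A0: "0 \<le> A" by (simp add: A_def)
  show "(\<lambda>n. integral\<^sup>L (\<mu> n) f) \<longlonglongrightarrow> integral\<^sup>L \<gamma> f"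
  proof (rule LIMSEQ_I)
    fix e :: real assume e: "0 < e"
    \<comment> \<open>The step function errors under the two measures and the error between the two
      sums add up to \<open>\<epsilon> * (A + 1) + \<epsilon> * A + \<epsilon>\<close>; the
      denominator exceeds \<open>2 * A + 2\<close> by one to make the final inequality
      strict.\<close>
    define \<epsilon> where "\<epsilon> = e / (2 * A + 3)"
    have \<epsilon>: "0 < \<epsilon>" using e A0 by (simp add: \<epsilon>_def)
    have "\<epsilon> * (2 * A + 3) = e" using A0 by (simp add: \<epsilon>_def)
    moreover have "\<epsilon> * (2 * A + 3) = \<epsilon> * (2 * A + 2) + \<epsilon>" by (simp add: algebra_simps)
    ultimately have \<epsilon>2: "\<epsilon> * (2 * A + 2) < e" using \<epsilon> by linarith
    have "\<exists>\<delta>>0. \<forall>x\<in>?K. \<forall>y\<in>?K. dist y x < \<delta> \<longrightarrow> dist (f y) (f x) < \<epsilon>"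
      using uc[unfolded uniformly_continuous_on_def, THEN spec[of _ \<epsilon>]] \<epsilon> by simp
    then obtain \<delta> where \<delta>: "0 < \<delta>" "\<forall>x\<in>?K. \<forall>y\<in>?K. dist y x < \<delta> \<longrightarrow> dist (f y) (f x) < \<epsilon>"
      by auto
    obtain m where m: "?d / \<delta> < 2 ^ m" using real_arch_pow[of 2 "?d / \<delta>"] by auto
    have dm: "?d / 2 ^ m < \<delta>" "?d / 2 ^ m \<le> ?d"
      using m \<delta>(1) by (simp_all add: field_simps)
    define Z where "Z = {z :: int ^ 'd. cell m z \<inter> cball 0 R \<noteq> {}}"
    have Z: "finite Z" unfolding Z_def by (rule finite_cells)
    define S where "S = (\<Union>z\<in>Z. cell m z)"
    have S: "S \<in> sets borel" unfolding S_def using Z by (intro sets.finite_UN) simp_all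
    have near: "x \<in> ?K \<and> corner m z \<in> ?K \<and> dist x (corner m z) < \<delta>" if z: "z \<in> Z" "x \<in> cell m z" for x z
    proof -
      obtain y where y: "y \<in> cell m z" "norm y \<le> R" using z(1) by (auto simp: Z_def)
      have 1: "norm (x - corner m z) \<le> ?d / 2 ^ m" "norm (y - corner m z) \<le> ?d / 2 ^ m"
        using dist_corner z(2) y(1) by blast+
      have "norm (corner m z) \<le> norm y + norm (y - corner m z)"
        using norm_triangle_sub[of "corner m z" y] by (simp add: norm_minus_commute)
      moreover have "norm x \<le> norm (corner m z) + norm (x - corner m z)" by (rule norm_triangle_sub)
      ultimately show ?thesis using 1 dm y(2) by (simp add: dist_norm)
    qed
    have SK: "S \<subseteq> ?K" using near by (auto simp: S_def)
    have Sb: "bounded S" by (rule bounded_subset[OF bounded_cball SK])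
    define h where "h x = (\<Sum>z\<in>Z. f (corner m z) * indicator (cell m z) x)" for x
    have hz: "h x = f (corner m z)" if "z \<in> Z" "x \<in> cell m z" for x z
    proof -
      have "h x = (\<Sum>z'\<in>Z. if z' = z then f (corner m z) else 0)"
        unfolding h_def
      proof (intro sum.cong refl)
        fix z'
        show "f (corner m z') * indicator (cell m z') x = (if z' = z then f (corner m z) else 0)"
        proof (cases "z' = z")
          case False
          then have "x \<notin> cell m z'" using cell_unique[OF that(2)] by metis
          with False show ?thesis by simp
        qed (use that in simp)
      qed
      then show ?thesis using Z that by simp
    qed
    have approx: "\<bar>f x - h x\<bar> \<le> \<epsilon> * indicator S x" for x
    proof (cases "x \<in> S")
      case True
      then obtain z where z: "z \<in> Z" "x \<in> cell m z" by (auto simp: S_def)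
      have "dist (f x) (f (corner m z)) < \<epsilon>" using near[OF z] \<delta>(2)[rule_format, of "corner m z" x] by simp
      then show ?thesis using True hz[OF z] by (simp add: dist_real_def)
    next
      case False
      have "x \<notin> cball 0 R"
      proof
        assume x: "x \<in> cball 0 R"
        have "x \<in> cell m (\<chi> i. \<lfloor>2 ^ m * vec_nth x i\<rfloor>)" by (simp add: cell_def)
        with x have "(\<chi> i. \<lfloor>2 ^ m * vec_nth x i\<rfloor>) \<in> Z" unfolding Z_def by auto
        with \<open>x \<in> cell m (\<chi> i. \<lfloor>2 ^ m * vec_nth x i\<rfloor>)\<close> have "x \<in> S" unfolding S_def by (rule UN_I[rotated])
        with False show False by simp
      qed
      moreover have "h x = 0" unfolding h_def using False by (intro sum.neutral ballI) (auto simp: S_def)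
      ultimately show ?thesis using f0 False by simp
    qed
    have fm: "f \<in> borel_measurable borel" by (rule borel_measurable_continuous_onI[OF cf])
    have main: "\<bar>integral\<^sup>L \<nu> f - (\<Sum>z\<in>Z. f (corner m z) * measure \<nu> (cell m z))\<bar> \<le> \<epsilon> * measure \<nu> S"
      and meas: "measure \<nu> S = (\<Sum>z\<in>Z. measure \<nu> (cell m z))"
      if sn: "sets \<nu> = sets borel" and fn: "\<And>A. A \<in> sets borel \<Longrightarrow> bounded A \<Longrightarrow> emeasure \<nu> A < \<infinity>" for \<nu>
    proof -
      have sp: "space \<nu> = UNIV" using sets_eq_imp_space_eq[OF sn] by simp
      have iS: "integrable \<nu> (\<lambda>x. \<epsilon> * indicator S x)"
        using S sn fn[OF S Sb] by (intro integrable_mult_right integrable_real_indicator) simp_all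
      have ic: "integrable \<nu> (\<lambda>x. f (corner m z) * indicator (cell m z) x)" for z
        using sn fn[OF cell_borel cell_bounded, of m z] by (intro integrable_mult_right integrable_real_indicator) simp_all
      have ih: "integrable \<nu> h" unfolding h_def by (intro Bochner_Integration.integrable_sum ic)
      have mfh: "(\<lambda>x. f x - h x) \<in> borel_measurable \<nu>"
        using fm sn borel_measurable_integrable[OF ih] by (intro borel_measurable_diff) (simp_all cong: measurable_cong_sets)
      have ifh: "integrable \<nu> (\<lambda>x. f x - h x)"
        by (rule Bochner_Integration.integrable_bound[OF iS mfh])
          (intro AE_I2, use approx \<epsilon> in \<open>simp add: abs_mult\<close>)
      have "integrable \<nu> (\<lambda>x. (f x - h x) + h x)" by (rule Bochner_Integration.integrable_add[OF ifh ih])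
      then have if': "integrable \<nu> f" by simp
      have "integral\<^sup>L \<nu> h = (\<Sum>z\<in>Z. f (corner m z) * measure \<nu> (cell m z))"
        unfolding h_def by (subst Bochner_Integration.integral_sum[OF ic]) (simp add: sp)
      then have "integral\<^sup>L \<nu> f - (\<Sum>z\<in>Z. f (corner m z) * measure \<nu> (cell m z)) = (\<integral>x. f x - h x \<partial>\<nu>)"
        using Bochner_Integration.integral_diff[OF if' ih] by simp
      moreover have "\<bar>\<integral>x. f x - h x \<partial>\<nu>\<bar> \<le> (\<integral>x. \<bar>f x - h x\<bar> \<partial>\<nu>)" by (rule integral_abs_bound)
      moreover have "(\<integral>x. \<bar>f x - h x\<bar> \<partial>\<nu>) \<le> (\<integral>x. \<epsilon> * indicator S x \<partial>\<nu>)"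
        by (intro integral_mono integrable_abs ifh iS approx)
      moreover have "(\<integral>x. \<epsilon> * indicator S x \<partial>\<nu>) = \<epsilon> * measure \<nu> S" by (simp add: sp)
      ultimately show "\<bar>integral\<^sup>L \<nu> f - (\<Sum>z\<in>Z. f (corner m z) * measure \<nu> (cell m z))\<bar> \<le> \<epsilon> * measure \<nu> S" by linarith
      show "measure \<nu> S = (\<Sum>z\<in>Z. measure \<nu> (cell m z))"
        unfolding S_def
      proof (rule measure_finite_Union[OF Z])
        show "cell m ` Z \<subseteq> sets \<nu>" unfolding sn by (rule image_subsetI) (rule cell_borel)
        show "disjoint_family_on (cell m) Z" unfolding disjoint_family_on_def
        proof (intro ballI impI equals0I)
          fix z z' x assume "z \<noteq> z'" "x \<in> cell m z \<inter> cell m z'"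
          then show False using cell_unique[of x m z z'] by (elim IntE) (erule notE, simp only:)
        qed
        show "emeasure \<nu> (cell m z) \<noteq> \<infinity>" if "z \<in> Z" for z using fn[OF cell_borel cell_bounded, of m z] by simp
      qed
    qed
    have "measure \<gamma> S \<le> A"
      unfolding A_def using s(2) fin(2)[of ?K] SK S by (intro measure_mono_fmeasurable) (auto simp: fmeasurable_def)
    have l1: "(\<lambda>n. measure (\<mu> n) S) \<longlonglongrightarrow> measure \<gamma> S"
    proof -
      have "measure (\<mu> n) S = (\<Sum>z\<in>Z. measure (\<mu> n) (cell m z))" for n by (rule meas[OF s(1)]) (rule fin(1))
      moreover have "measure \<gamma> S = (\<Sum>z\<in>Z. measure \<gamma> (cell m z))" by (rule meas[OF s(2)]) (rule fin(2))
      ultimately show ?thesis by (simp only:) (intro tendsto_sum conv)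
    qed
    have l2: "(\<lambda>n. \<Sum>z\<in>Z. f (corner m z) * measure (\<mu> n) (cell m z)) \<longlonglongrightarrow> (\<Sum>z\<in>Z. f (corner m z) * measure \<gamma> (cell m z))"
      by (intro tendsto_sum tendsto_mult tendsto_const conv)
    \<comment> \<open>Convergence on the finitely many cells also bounds the mass that the
      approximating measures give to \<open>S\<close>, uniformly in large \<open>n\<close>.\<close>
    obtain N1 where N1: "\<And>n. n \<ge> N1 \<Longrightarrow> \<bar>measure (\<mu> n) S - measure \<gamma> S\<bar> < 1"
    proof -
      have "\<exists>N. \<forall>n\<ge>N. \<bar>measure (\<mu> n) S - measure \<gamma> S\<bar> < 1" using LIMSEQ_D[OF l1, of 1] by simp
      then show thesis using that by blast
    qed
    obtain N2 where N2: "\<And>n. n \<ge> N2 \<Longrightarrow> \<bar>(\<Sum>z\<in>Z. f (corner m z) * measure (\<mu> n) (cell m z)) - (\<Sum>z\<in>Z. f (corner m z) * measure \<gamma> (cell m z))\<bar> < \<epsilon>"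
      using LIMSEQ_D[OF l2 \<epsilon>] unfolding real_norm_def by blast
    show "\<exists>no. \<forall>n\<ge>no. norm (integral\<^sup>L (\<mu> n) f - integral\<^sup>L \<gamma> f) < e"
    proof (intro exI allI impI)
      fix n assume n: "max N1 N2 \<le> n"
      have a: "\<epsilon> * measure (\<mu> n) S \<le> \<epsilon> * (A + 1)"
        using N1[of n] n \<open>measure \<gamma> S \<le> A\<close> \<epsilon> by (intro mult_left_mono) auto
      have b: "\<epsilon> * measure \<gamma> S \<le> \<epsilon> * A" using \<open>measure \<gamma> S \<le> A\<close> \<epsilon> by (intro mult_left_mono) auto
      have "\<bar>integral\<^sup>L (\<mu> n) f - (\<Sum>z\<in>Z. f (corner m z) * measure (\<mu> n) (cell m z))\<bar> \<le> \<epsilon> * measure (\<mu> n) S"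
        by (rule main[OF s(1)]) (rule fin(1))
      moreover have "\<bar>integral\<^sup>L \<gamma> f - (\<Sum>z\<in>Z. f (corner m z) * measure \<gamma> (cell m z))\<bar> \<le> \<epsilon> * measure \<gamma> S"
        by (rule main[OF s(2)]) (rule fin(2))
      moreover have "\<bar>(\<Sum>z\<in>Z. f (corner m z) * measure (\<mu> n) (cell m z)) - (\<Sum>z\<in>Z. f (corner m z) * measure \<gamma> (cell m z))\<bar> < \<epsilon>"
        using N2[of n] n by simp
      ultimately have "\<bar>integral\<^sup>L (\<mu> n) f - integral\<^sup>L \<gamma> f\<bar> \<le> \<epsilon> * (A + 1) + \<epsilon> * A + \<epsilon>"
        using a b by arith
      also have "\<dots> = \<epsilon> * (2 * A + 2)" by (simp add: algebra_simps)
      also have "\<dots> < e" by (rule \<epsilon>2)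
      finally show "norm (integral\<^sup>L (\<mu> n) f - integral\<^sup>L \<gamma> f) < e" by simp
    qed
  qed
qed

lemma restricted_finite_measure:
  assumes "M \<in> counting_measures"
  shows "finite_measure (restricted M n)"
proof (rule finite_measureI)
  have [simp]: "sets M = sets borel" "space M = UNIV" by (rule counting_measuresD[OF assms])+
  have "emeasure (restricted M n) UNIV = emeasure M (ball 0 (real n))"
    unfolding restricted_def by (subst emeasure_density) (simp_all add: borel_measurable_indicator)
  then show "emeasure (restricted M n) (space (restricted M n)) \<noteq> \<infinity>"
    using counting_measuresD(3)[OF assms, of "ball 0 (real n)"] by (simp add: restricted_def)
qed

text \<open>The convolution counts differences of pairs of points in the ball. Each point paired
  with itself has difference 0, which yields the last term. The reflected set appears because the
  convolution takes first minus second point, whereas the pair count takes second minus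
  first.\<close>

lemma emeasure_restricted_convolution:
  fixes M :: "'a::ordered_euclidean_space measure"
  assumes M: "M \<in> counting_measures" and C[measurable]: "C \<in> sets borel"
  shows "emeasure (convolution (restricted M n) (reflect (restricted M n))) C
    = tuple_sum 2 M (\<lambda>x. (indicator (ball 0 (real n)) (x 0) * indicator (ball 0 (real n)) (x 1)) * indicator (uminus -` C) (x 1 - x 0))
      + indicator C 0 * emeasure M (ball 0 (real n))"
proof -
  let ?B = "ball (0::'a) (real n)"
  have [simp, measurable_cong]: "sets M = sets borel" and sp[simp]: "space M = UNIV" by (rule counting_measuresD[OF M])+
  interpret R: finite_measure "restricted M n" by (rule restricted_finite_measure[OF M])
  have [measurable_cong, simp]: "sets (restricted M n) = sets borel" by (simp add: restricted_def)
  have fr: "finite_measure (reflect (restricted M n))"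
    unfolding reflect_def by (rule R.finite_measure_distr) measurable
  have m: "(\<lambda>(x, y). (indicator ?B x * indicator ?B y) * (indicator C (x - y) :: ennreal)) \<in> borel_measurable (borel \<Otimes>\<^sub>M borel)"
    by measurable
  have "emeasure (convolution (restricted M n) (reflect (restricted M n))) C
    = (\<integral>\<^sup>+x. \<integral>\<^sup>+y. indicator C (x + y) \<partial>reflect (restricted M n) \<partial>restricted M n)"
    by (rule convolution_emeasure'[OF C R.finite_measure_axioms fr]) (simp_all add: reflect_def)
  also have "\<dots> = (\<integral>\<^sup>+x. \<integral>\<^sup>+y. indicator C (x - y) \<partial>restricted M n \<partial>restricted M n)"
    unfolding reflect_def by (intro nn_integral_cong) (subst nn_integral_distr; measurable; simp)
  also have "\<dots> = (\<integral>\<^sup>+x. (\<integral>\<^sup>+y. indicator ?B y * indicator C (x - y) \<partial>M) \<partial>restricted M n)"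
    unfolding restricted_def by (intro nn_integral_cong) (subst nn_integral_density; measurable)
  also have "\<dots> = (\<integral>\<^sup>+x. indicator ?B x * (\<integral>\<^sup>+y. indicator ?B y * indicator C (x - y) \<partial>M) \<partial>M)"
    unfolding restricted_def
  proof (rule nn_integral_density)
    have "(\<lambda>(x, y). indicator ?B y * (indicator C (x - y) :: ennreal)) \<in> borel_measurable (borel \<Otimes>\<^sub>M borel)" by measurable
    from measurable_nn_integral_counting[OF M this]
    show "(\<lambda>x. \<integral>\<^sup>+y. indicator ?B y * indicator C (x - y) \<partial>M) \<in> borel_measurable M" by measurable
  qed measurable
  also have "\<dots> = (\<integral>\<^sup>+x. \<integral>\<^sup>+y. (indicator ?B x * indicator ?B y) * indicator C (x - y) \<partial>M \<partial>M)"
    by (intro nn_integral_cong) (subst nn_integral_cmult[symmetric]; (measurable; simp add: mult.assoc))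
  also have "\<dots> = tuple_sum 2 M (\<lambda>x. (indicator ?B (x 0) * indicator ?B (x 1)) * indicator C (x 0 - x 1))
      + (\<integral>\<^sup>+x. (indicator ?B x * indicator ?B x) * indicator C (x - x) \<partial>M)"
    by (rule double_nn_integral_counting[OF M m])
  also have "(\<integral>\<^sup>+x. (indicator ?B x * indicator ?B x) * indicator C (x - x) \<partial>M) = (\<integral>\<^sup>+x. indicator C 0 * indicator ?B x \<partial>M)"
    by (intro nn_integral_cong) (simp add: indicator_def)
  also have "\<dots> = indicator C 0 * emeasure M ?B" by (subst nn_integral_cmult_indicator) simp_all
  also have "(\<lambda>x::nat \<Rightarrow> 'a. (indicator ?B (x 0) * indicator ?B (x 1)) * (indicator C (x 0 - x 1) :: ennreal))
    = (\<lambda>x. (indicator ?B (x 0) * indicator ?B (x 1)) * indicator (uminus -` C) (x 1 - x 0))"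
    by (simp add: indicator_def)
  finally show ?thesis .
qed

text \<open>The strong law for pair counts holds for each dyadic cell outside a null event, and
  these events are countably many. Outside their union, and where the law for single counts holds
  too, all cells converge at once, which suffices for vague convergence.\<close>

lemma autocorrelation_dpp:
  fixes K :: "real ^ 'd \<Rightarrow> real ^ 'd \<Rightarrow> complex"
  assumes "dpp P \<omega> K"
  shows "AE w in P. is_autocorrelation (\<omega> w) (add_measure (return borel 0) (density lborel (\<lambda>x. ennreal (1 - dpp.g K x))))"
proof -
  interpret dpp P \<omega> K by fact
  let ?\<gamma> = "add_measure (return borel 0) (density lborel (\<lambda>x. ennreal (1 - g x)))"
  let ?v = "unit_ball_vol (real DIM(real ^ 'd))"
  let ?B = "\<lambda>n::nat. ball (0 :: real ^ 'd) (real n)"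
  have v: "0 < ?v" by (rule unit_ball_vol_pos) simp
  have v0: "unit_ball_vol (real CARD('d)) \<noteq> 0" using v by (simp del: unit_ball_vol_pos)
  have I: "integrable lborel (\<lambda>x. (1 - g x) * indicator C x)" if [measurable]: "C \<in> sets borel" and "bounded C" for C
  proof (rule Bochner_Integration.integrable_bound[where f = "indicator C :: _ \<Rightarrow> real"])
    show "integrable lborel (indicator C :: _ \<Rightarrow> real)"
      using that emeasure_bounded_finite[of C] by (intro integrable_real_indicator) simp_all
    show "AE x in lborel. norm ((1 - g x) * indicator C x) \<le> norm (indicator C x :: real)"
      using g_bounds by (intro AE_I2) (simp add: indicator_def)
  qed measurable
  have \<gamma>e: "emeasure ?\<gamma> C = ennreal (indicator C 0 + (\<integral>x. (1 - g x) * indicator C x \<partial>lborel))"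
    if [measurable]: "C \<in> sets borel" and b: "bounded C" for C
  proof -
    have "emeasure (density lborel (\<lambda>x. ennreal (1 - g x))) C = (\<integral>\<^sup>+x. ennreal ((1 - g x) * indicator C x) \<partial>lborel)"
      using g_bounds by (subst emeasure_density) (measurable, auto intro!: nn_integral_cong simp: indicator_def)
    also have "\<dots> = ennreal (\<integral>x. (1 - g x) * indicator C x \<partial>lborel)"
      using g_bounds by (intro nn_integral_eq_integral I b AE_I2) simp_all
    finally show ?thesis
      using g_bounds by (simp add: emeasure_add_measure ennreal_plus[OF _ Bochner_Integration.integral_nonneg] ennreal_indicator)
  qed
  have \<gamma>m: "measure ?\<gamma> C = indicator C 0 + (\<integral>x. (1 - g x) * indicator C x \<partial>lborel)"
    if "C \<in> sets borel" "bounded C" for C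
    unfolding measure_def \<gamma>e[OF that] using g_bounds
    by (intro enn2real_ennreal add_nonneg_nonneg Bochner_Integration.integral_nonneg) simp_all
  have cells: "AE w in P. \<forall>m z. (\<lambda>n. enn2real (pair_count (uminus -` cell m z) n w) / real n ^ DIM(real ^ 'd)) \<longlonglongrightarrow> ?v * (\<integral>x. (1 - g x) * indicator (cell m z) x \<partial>lborel)"
    unfolding AE_all_countable
  proof (intro allI)
    fix m and z :: "int ^ 'd"
    obtain r where r: "\<And>x. x \<in> cell m z \<Longrightarrow> norm x \<le> r" using cell_bounded[of m z] by (auto simp: bounded_iff)
    have "uminus -` cell m z \<subseteq> ball 0 (\<bar>r\<bar> + 1)"
    proof
      fix x assume "x \<in> uminus -` cell m z"
      then have "norm (- x) \<le> r" by (intro r) simp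
      then show "x \<in> ball 0 (\<bar>r\<bar> + 1)" by simp
    qed
    moreover have mb: "uminus -` cell m z \<in> sets borel" using measurable_sets[OF borel_measurable_continuous_onI[OF continuous_on_minus[OF continuous_on_id]] cell_borel, of m z] by simp
    ultimately have "AE w in P. (\<lambda>n. enn2real (pair_count (uminus -` cell m z) n w) / real n ^ DIM(real ^ 'd)) \<longlonglongrightarrow> ?v * (\<integral>x. (1 - g x) * indicator (uminus -` cell m z) x \<partial>lborel)"
      by (intro pair_count_strong_law[where r = "\<bar>r\<bar> + 1"]) simp_all
    \<comment> \<open>Since \<open>g\<close> is even, reflecting the cell does not change the
      limit.\<close>
    moreover have "(\<integral>x. (1 - g x) * indicator (uminus -` cell m z) x \<partial>lborel) = (\<integral>x. (1 - g x) * indicator (cell m z) x \<partial>lborel)"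
    proof -
      have "(\<lambda>x. (1 - g x) * indicator (cell m z) x) \<in> borel_measurable borel" by measurable
      from integral_lborel_uminus[OF this] show ?thesis by (simp add: g_minus indicator_def)
    qed
    ultimately show "AE w in P. (\<lambda>n. enn2real (pair_count (uminus -` cell m z) n w) / real n ^ DIM(real ^ 'd)) \<longlonglongrightarrow> ?v * (\<integral>x. (1 - g x) * indicator (cell m z) x \<partial>lborel)"
      by simp
  qed
  show ?thesis
    using AE_space cells count_strong_law
  proof eventually_elim
    case (elim w)
    let ?M = "\<omega> w"
    have M: "?M \<in> counting_measures" by (rule \<omega>_counting[OF elim(1)])
    define T where "T n = convolution (restricted ?M n) (reflect (restricted ?M n))" for n
    define N where "N n = scale_measure (1 / emeasure lborel (?B n)) (T n)" for n
    have sT: "sets (T n) = sets borel" for n by (simp add: T_def)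
    have T: "emeasure (T n) C = pair_count (uminus -` C) n w + indicator C 0 * emeasure ?M (?B n)" if "C \<in> sets borel" for n C
      unfolding T_def pair_count_def by (rule emeasure_restricted_convolution[OF M that])
    have fT: "emeasure (T n) C < \<infinity>" for n C
    proof -
      have s: "sets (restricted ?M n) = sets borel" using counting_measuresD(1)[OF M] by (simp add: restricted_def)
      have m: "uminus \<in> restricted ?M n \<rightarrow>\<^sub>M borel" using s by (simp cong: measurable_cong_sets)
      have f: "finite_measure (restricted ?M n)" by (rule restricted_finite_measure[OF M])
      have "finite_measure (T n)"
        unfolding T_def
        by (rule convolution_finite[OF f]) (simp_all add: reflect_def s finite_measure.finite_measure_distr[OF f m])
      then show ?thesis by (simp add: finite_measure.emeasure_finite less_top[symmetric])
    qed
    \<comment> \<open>At \<open>n = 0\<close> the window is empty, so the scaling factor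
      \<open>1 / 0\<close> is infinite in \<open>ennreal\<close>; the vanishing of the convolution
      makes the scaled measure 0 and hence locally finite.\<close>
    have T0: "emeasure (T 0) C = 0" if "C \<in> sets borel" for C
      unfolding T[OF that] by (simp add: pair_count_def tuple_sum_def)
    have b: "emeasure lborel (?B n) = ennreal (?v * real n ^ DIM(real ^ 'd))" for n by (rule emeasure_ball_eq) simp
    have b': "1 / emeasure lborel (?B n) = ennreal (1 / (?v * real n ^ DIM(real ^ 'd)))" if "n \<noteq> 0" for n
      unfolding b using v that by (simp add: divide_ennreal[symmetric])
    have "vague_limit N ?\<gamma>"
    proof (rule vague_from_cells)
      show "sets (N n) = sets borel" for n by (simp add: N_def sT)
      show "sets ?\<gamma> = sets borel" by simp
      show "emeasure ?\<gamma> A < \<infinity>" if "A \<in> sets borel" "bounded A" for A unfolding \<gamma>e[OF that] by simp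
      show "emeasure (N n) A < \<infinity>" if "A \<in> sets borel" "bounded A" for n A
      proof (cases "n = 0")
        case True
        then show ?thesis using T0[OF that(1)] by (simp add: N_def)
      next
        case False
        show ?thesis unfolding N_def b'[OF False] emeasure_scale_measure
          using fT[of n A] by (simp add: ennreal_mult_less_top)
      qed
      fix m and z :: "int ^ 'd"
      let ?C = "cell m z"
      have "(\<lambda>n. (enn2real (pair_count (uminus -` ?C) n w) / real n ^ DIM(real ^ 'd) + indicator ?C 0 * (enn2real (emeasure ?M (?B n)) / real n ^ DIM(real ^ 'd))) / ?v)
        \<longlonglongrightarrow> (?v * (\<integral>x. (1 - g x) * indicator ?C x \<partial>lborel) + indicator ?C 0 * ?v) / ?v"
        using elim(2,3) v0 by (intro tendsto_divide tendsto_add tendsto_mult tendsto_const) simp_all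
      also have "(?v * (\<integral>x. (1 - g x) * indicator ?C x \<partial>lborel) + indicator ?C 0 * ?v) / ?v = measure ?\<gamma> ?C"
        unfolding \<gamma>m[OF cell_borel cell_bounded] using v0 by (simp add: add_divide_distrib)
      finally show "(\<lambda>n. measure (N n) ?C) \<longlonglongrightarrow> measure ?\<gamma> ?C"
      proof (rule Lim_transform_eventually)
        show "\<forall>\<^sub>F n in sequentially. (enn2real (pair_count (uminus -` ?C) n w) / real n ^ DIM(real ^ 'd) + indicator ?C 0 * (enn2real (emeasure ?M (?B n)) / real n ^ DIM(real ^ 'd))) / ?v = measure (N n) ?C"
          using eventually_gt_at_top[of "0::nat"]
        proof eventually_elim
          case (elim n)
          \<comment> \<open>Finiteness of both summands is what makes \<open>enn2real\<close>
            additive here; it comes from the finiteness of the convolution.\<close>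
          have f: "pair_count (uminus -` ?C) n w < \<infinity>" "indicator ?C 0 * emeasure ?M (?B n) < \<infinity>"
            using fT[of n ?C] unfolding T[OF cell_borel] by (simp_all add: less_top)
          have "measure (T n) ?C = enn2real (pair_count (uminus -` ?C) n w) + indicator ?C 0 * enn2real (emeasure ?M (?B n))"
            unfolding measure_def T[OF cell_borel] using f by (simp add: enn2real_plus less_top[symmetric] enn2real_mult) (simp add: indicator_def)
          moreover have "measure (N n) ?C = 1 / (?v * real n ^ DIM(real ^ 'd)) * measure (T n) ?C"
            using elim v unfolding N_def by (subst b') (simp, rule measure_scale_measure, simp)
          ultimately show ?case by (simp add: add_divide_distrib mult.commute)
        qed
      qed
    qed
    then show ?case unfolding is_autocorrelation_def N_def T_def .
  qed
qed

text \<open>\<open>ennreal\<close> truncates negative numbers, and the integral of a non-integrable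
  function is 0 by convention. The conjuncts on integrability, on realness and on the upper bounds 1
  certify that \<open>ghat\<close> and the two densities are the intended objects.\<close>

theorem proposition3p5:
  fixes K :: "real ^ 'd \<Rightarrow> real ^ 'd \<Rightarrow> complex"
    and P :: "'w measure"
    and \<omega> :: "'w \<Rightarrow> (real ^ 'd) measure"
    and g :: "real ^ 'd \<Rightarrow> real"
    and ghat :: "real ^ 'd \<Rightarrow> complex"
    and \<gamma> \<gamma>hat :: "(real ^ 'd) measure"
  assumes "continuous_on UNIV (\<lambda>(x, y). K x y)"
    and "hermitian_kernel K"
    and "positive_definite_kernel K"
    and "point_process P \<omega>"
    and "stationary P \<omega>"
    and "ergodic P \<omega>"
    and "determinantal P \<omega> K"
    and "has_mean_density P \<omega> 1"
    and g_def: "g = (\<lambda>x. (cmod (K 0 x))\<^sup>2)"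
    and ghat_def: "ghat = fourier (\<lambda>x. complex_of_real (g x))"
    and \<gamma>_def: "\<gamma> = add_measure (return borel 0) (density lborel (\<lambda>x. ennreal (1 - g x)))"
    and \<gamma>hat_def: "\<gamma>hat = add_measure (return borel 0) (density lborel (\<lambda>t. ennreal (1 - Re (ghat t))))"
  shows "integrable lborel g \<and> (\<forall>x. g x \<le> 1) \<and>
    (AE w in P. is_autocorrelation (\<omega> w) \<gamma> \<and> is_diffraction (\<omega> w) \<gamma>hat) \<and>
    (\<forall>t. ghat t \<in> \<real> \<and> 0 \<le> Re (ghat t) \<and> Re (ghat t) \<le> 1) \<and>
    (\<forall>t. ghat t = 1 \<longrightarrow> t = 0) \<and>
    equivalent_measures (ac_part \<gamma>hat) lborel"
proof -
  have D: "dpp P \<omega> K"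
    unfolding dpp_def dpp_axioms_def counting_process_def counting_process_axioms_def pd_kernel_def
    using assms by (simp add: point_process_def)
  interpret D: dpp P \<omega> K by (rule D)
  have g: "g = D.g" unfolding g_def by (rule ext) (simp add: D.g_def)
  have ghat: "ghat t = complex_of_real (D.G t)" for t unfolding ghat_def g by (rule D.fourier_g)
  then have Re: "Re (ghat t) = D.G t" for t by simp
  \<comment> \<open>This pair of measures is deterministic, so the existence of the diffraction
    follows from that of the autocorrelation on the same event.\<close>
  have ft: "is_fourier_transform \<gamma> \<gamma>hat"
    unfolding \<gamma>_def \<gamma>hat_def Re g
    by (rule is_fourier_transform_delta_density[OF D.g_integrable D.g_bounds D.fourier_g D.G_nonneg D.G_le_1])
  have ac: "AE w in P. is_autocorrelation (\<omega> w) \<gamma> \<and> is_diffraction (\<omega> w) \<gamma>hat"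
    using autocorrelation_dpp[OF D] unfolding \<gamma>_def[symmetric, unfolded g]
  proof eventually_elim
    case (elim w)
    with ft show ?case by (auto simp: is_diffraction_def)
  qed
  have [measurable]: "D.g \<in> borel_measurable borel" by (rule D.g_measurable)
  have "(\<lambda>t. Re (fourier (\<lambda>x. complex_of_real (D.g x)) t)) \<in> borel_measurable borel" by measurable
  then have [measurable]: "D.G \<in> borel_measurable borel" by (simp add: D.fourier_g)
  have "ac_part \<gamma>hat = density lborel (\<lambda>t. ennreal (1 - D.G t))"
    unfolding \<gamma>hat_def Re by (rule ac_part_delta_density) measurable
  \<comment> \<open>The density \<open>1 - D.G t\<close> is positive except possibly at the origin,
    which is a Lebesgue null set; so it can only kill null sets.\<close>
  moreover have "null_sets (density lborel (\<lambda>t. ennreal (1 - D.G t))) = null_sets lborel"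
  proof (intro equalityI subsetI)
    fix N assume "N \<in> null_sets (density lborel (\<lambda>t. ennreal (1 - D.G t)))"
    then have N: "N \<in> sets lborel" "AE t in lborel. t \<in> N \<longrightarrow> ennreal (1 - D.G t) = 0"
      by (simp_all add: null_sets_density_iff)
    have "AE t in lborel. t \<notin> N"
      using N(2) AE_lborel_singleton[of 0]
    proof eventually_elim
      case (elim t)
      have "1 - D.G t \<noteq> 0" "0 \<le> 1 - D.G t" using D.G_eq_1[of t] D.G_le_1[of t] elim(2) by auto
      then have "ennreal (1 - D.G t) \<noteq> 0" by simp
      with elim(1) show ?case by blast
    qed
    then show "N \<in> null_sets lborel" using N(1) by (simp add: AE_iff_null_sets)
  next
    fix N :: "(real ^ 'd) set" assume "N \<in> null_sets lborel"
    then show "N \<in> null_sets (density lborel (\<lambda>t. ennreal (1 - D.G t)))"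
      using AE_not_in[of N lborel] by (subst null_sets_density_iff) (measurable, auto)
  qed
  ultimately have "equivalent_measures (ac_part \<gamma>hat) lborel" by (simp add: equivalent_measures_def)
  moreover have "ghat t \<in> \<real> \<and> 0 \<le> Re (ghat t) \<and> Re (ghat t) \<le> 1" for t
    unfolding Re unfolding ghat using D.G_nonneg D.G_le_1 by simp
  moreover have "t = 0" if "ghat t = 1" for t using that D.G_eq_1[of t] unfolding ghat by simp
  moreover have "integrable lborel g" "g x \<le> 1" for x unfolding g by (rule D.g_integrable, rule D.g_bounds)
  ultimately show ?thesis using ac by blast
qed

end
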